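(* Let $p$ be a prime and let $G$ be a non-trivial finite $p$-group. Then $G$ has a favourable polycyclic presentation (consistent and with all $e_i>1$) with respect to which every concatenation of two normal words can be collected from the left to a normal word in at most $$\bigl((p-1)\log_p|G|\bigr)^{3\log_2\log_p|G|+1}$$ steps.
   Context: Polycyclic presentations. A finite polycyclic presentation is a presentation $\{\mathcal{A}\mid\mathcal{R}\}$ where $\mathcal{A}=\{a_1,\dots,a_m\}$ (ordered by $a_1<\dots<a_m$) and $\mathcal{R}$ consists of the relations $a_i^{e_i}=v_{ii}$ for $1\le i\le m$ and $a_ja_i=a_iv_{ij}$ for $1\le i<j\le m$, where each $e_i$ is a positive integer and $v_{ij}$ is a word in $\{a_{i+1},\dots,a_m\}$ for $1\le i\le j\le m$. Only non-negative words are considered (words in letters of $\mathcal{A}$, without inverses; the empty word is allowed). The normal words in $\mathcal{A}$ are the words $a_1^{\alpha_1}\cdots a_m^{\alpha_m}$ with integers $0\le\alpha_i<e_i$. The right-hand sides of all relations in $\mathcal{R}$ are normal words. The left-hand sides of the relations in $\mathcal{R}$ are the minimal non-normal words. The presentation is a presentation of $G$ if the group it defines is isomorphic to $G$; it is consistent if $|G|=e_1\cdots e_m$. It is a standing assumption that the presentations considered are consistent and that all $e_i>1$. Collection. Given a non-normal word, a collection step replaces a minimal non-normal subword (an occurrence of the left-hand side of a relation of $\mathcal{R}$ as a contiguous subword) by the right-hand side of that relation. Collection from the left is the process in which each step replaces the left-most minimal non-normal subword of the current word. The number of steps is the number of collection steps. Favourable presentations. A finite polycyclic presentation $\{\mathcal{A}\mid\mathcal{R}\}$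 is favourable if there are a positive integer $d$ and a non-decreasing (with respect to $a_1<\dots<a_m$) surjective function $\delta:\mathcal{A}\to\{1,\dots,d\}$ such that: for each $i$, either $v_{ii}$ is $a_{i+1}$ or $v_{ii}$ is a normal word in $\{a_k,\dots,a_m\}$ with $\delta(a_k)>\delta(a_i)$; and for $j>i$ each $v_{ij}$ is a normal word equal either to $v^*_{ij}$ or to $a_jv^*_{ij}$, where $v^*_{ij}$ is a normal word in $\{a_k,\dots,a_m\}$ with $\delta(a_k)>\delta(a_i)$. (Thus the normal words $v_{ii}$ of the second kind and $v^*_{ij}$ involve only generators of $\delta$-value greater than $\delta(a_i)$, and may be empty.) *)

theory Defs
  imports Complex_Main "HOL-Computational_Algebra.Primes" "HOL-Algebra.Coset"
begin

section \<open>Groups defined by presentations\<close>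

text \<open>
  The group defined by generators \<open>S\<close> and relations \<open>R\<close> (pairs of non-negative words) is the
  quotient of the words in signed letters, where \<open>(x, True)\<close> stands for \<open>x\<close> and \<open>(x, False)\<close> for
  the inverse of \<open>x\<close>, by the congruence generated by free cancellation and \<open>R\<close>.
\<close>

definition pos_word :: "'a list \<Rightarrow> ('a \<times> bool) list" where
  "pos_word w = map (\<lambda>x. (x, True)) w"

inductive pres_eq :: "'a set \<Rightarrow> ('a list \<times> 'a list) set \<Rightarrow>
    ('a \<times> bool) list \<Rightarrow> ('a \<times> bool) list \<Rightarrow> bool"
  for S :: "'a set" and R :: "('a list \<times> 'a list) set" where
  cancel: "x \<in> S \<Longrightarrow> pres_eq S R (s @ [(x, b), (x, \<not> b)] @ t) (s @ t)"
| rel: "(l, r) \<in> R \<Longrightarrow> pres_eq S R (s @ pos_word l @ t) (s @ pos_word r @ t)"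
| refl: "pres_eq S R u u"
| sym: "pres_eq S R u w \<Longrightarrow> pres_eq S R w u"
| trans: "pres_eq S R u w \<Longrightarrow> pres_eq S R w z \<Longrightarrow> pres_eq S R u z"

definition pres_rel :: "'a set \<Rightarrow> ('a list \<times> 'a list) set \<Rightarrow>
    (('a \<times> bool) list \<times> ('a \<times> bool) list) set" where
  "pres_rel S R = {(u, w). u \<in> lists (S \<times> UNIV) \<and> w \<in> lists (S \<times> UNIV) \<and> pres_eq S R u w}"

definition presented_group :: "'a set \<Rightarrow> ('a list \<times> 'a list) set \<Rightarrow>
    ('a \<times> bool) list set monoid" where
  "presented_group S R = \<lparr>carrier = lists (S \<times> UNIV) // pres_rel S R,
     mult = (\<lambda>X Y. \<Union>u\<in>X. \<Union>w\<in>Y. pres_rel S R `` {u @ w}),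
     one = pres_rel S R `` {[]}\<rparr>"

section \<open>Polycyclic presentations\<close>

text \<open>
  The generator \<open>a\<^sub>i\<close> is represented by its index \<open>i \<in> {1..ngens P}\<close> and non-negative words by lists of
  indices. Only the values \<open>expo P i\<close> for \<open>1 \<le> i \<le> ngens P\<close> and \<open>rhs P i j\<close> for
  \<open>1 \<le> i \<le> j \<le> ngens P\<close> are relevant; the latter is the word \<open>v\<^sub>i\<^sub>j\<close>.
\<close>

record pc_data =
  ngens :: nat
  expo :: "nat \<Rightarrow> nat"
  rhs :: "nat \<Rightarrow> nat \<Rightarrow> nat list"

definition pc_gens :: "pc_data \<Rightarrow> nat set" where
  "pc_gens P = {1..ngens P}"

definition pc_rels :: "pc_data \<Rightarrow> (nat list \<times> nat list) set" where
  "pc_rels P = {(replicate (expo P i) i, rhs P i i) | i. i \<in> pc_gens P}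
     \<union> {([j, i], i # rhs P i j) | i j. i \<in> pc_gens P \<and> j \<in> pc_gens P \<and> i < j}"

definition normal_word :: "pc_data \<Rightarrow> nat list \<Rightarrow> bool" where
  "normal_word P w \<longleftrightarrow> (\<exists>\<alpha>. (\<forall>i\<in>pc_gens P. \<alpha> i < expo P i) \<and>
     w = concat (map (\<lambda>i. replicate (\<alpha> i) i) [1..<Suc (ngens P)]))"

definition pc_presentation :: "pc_data \<Rightarrow> bool" where
  "pc_presentation P \<longleftrightarrow>
     (\<forall>i\<in>pc_gens P. expo P i > 0) \<and>
     (\<forall>i\<in>pc_gens P. \<forall>j\<in>pc_gens P. i \<le> j \<longrightarrow> set (rhs P i j) \<subseteq> {i + 1..ngens P}) \<and>
     (\<forall>(l, r)\<in>pc_rels P. normal_word P r)"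

definition pc_group :: "pc_data \<Rightarrow> (nat \<times> bool) list set monoid" where
  "pc_group P = presented_group (pc_gens P) (pc_rels P)"

definition presentation_of :: "pc_data \<Rightarrow> ('g, 'b) monoid_scheme \<Rightarrow> bool" where
  "presentation_of P G \<longleftrightarrow> pc_group P \<cong> G"

text \<open>An infinite group has \<open>order\<close> 0, which differs from the product since exponents are positive.\<close>

definition consistent :: "pc_data \<Rightarrow> bool" where
  "consistent P \<longleftrightarrow> order (pc_group P) = (\<Prod>i\<in>pc_gens P. expo P i)"

text \<open>
  A word in \<open>{a\<^sub>k, \<dots>, a\<^sub>m}\<close> for some \<open>k\<close> with \<open>\<delta> a\<^sub>k > \<delta> a\<^sub>i\<close> is, as \<open>\<delta>\<close> is non-decreasing, a word
  in letters of \<open>\<delta>\<close>-value greater than \<open>\<delta> a\<^sub>i\<close>. If there is no such \<open>k\<close>, only the empty word is left.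
\<close>

definition higher_word :: "pc_data \<Rightarrow> (nat \<Rightarrow> nat) \<Rightarrow> nat \<Rightarrow> nat list \<Rightarrow> bool" where
  "higher_word P \<delta> i w \<longleftrightarrow> normal_word P w \<and> (\<forall>x\<in>set w. \<delta> x > \<delta> i)"

definition favourable :: "pc_data \<Rightarrow> bool" where
  "favourable P \<longleftrightarrow> (\<exists>d>0. \<exists>\<delta>. mono_on (pc_gens P) \<delta> \<and> \<delta> ` pc_gens P = {1..d} \<and>
     (\<forall>i\<in>pc_gens P. rhs P i i = [i + 1] \<or> higher_word P \<delta> i (rhs P i i)) \<and>
     (\<forall>i\<in>pc_gens P. \<forall>j\<in>pc_gens P. i < j \<longrightarrow> normal_word P (rhs P i j) \<and>
        (\<exists>w. higher_word P \<delta> i w \<and> (rhs P i j = w \<or> rhs P i j = j # w))))"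

section \<open>Collection from the left\<close>

text \<open>
  When all exponents exceed 1, the left-hand sides of the relations are the minimal non-normal words.
  None of them is then a proper subword of another, so a left-most occurrence is unique.
\<close>

definition collect_left :: "pc_data \<Rightarrow> nat list \<Rightarrow> nat list \<Rightarrow> bool" where
  "collect_left P x y \<longleftrightarrow> (\<exists>s l r t. (l, r) \<in> pc_rels P \<and> x = s @ l @ t \<and> y = s @ r @ t \<and>
     (\<forall>s' l' r' t'. (l', r') \<in> pc_rels P \<and> x = s' @ l' @ t' \<longrightarrow> length s \<le> length s'))"

definition collects_left_within :: "pc_data \<Rightarrow> nat list \<Rightarrow> real \<Rightarrow> bool" where
  "collects_left_within P x N \<longleftrightarrow>
     (\<exists>n z. real n \<le> N \<and> (collect_left P ^^ n) x z \<and> normal_word P z)"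

end

theory Submission
  imports Defs "HOL-Library.Multiset" "HOL-Algebra.Group_Action" "HOL-Algebra.Generated_Groups"
    "HOL-Algebra.Multiplicative_Group"
begin

text \<open>
  Let \<open>|G| = p\<^sup>n\<close>, and number the lower central series so that \<open>\<gamma>\<^sub>1 = G\<close>. The generators are
  chosen along the subgroups \<open>N\<^sub>k = \<gamma>\<^sub>s\<close> with \<open>s = 2 ^ (k - 1)\<close>. Since \<open>[\<gamma>\<^sub>i, \<gamma>\<^sub>j]\<close> lies in
  \<open>\<gamma>\<^sub>i\<^sub>+\<^sub>j\<close> (\<open>cm_lcs\<close>), the sections of this series are abelian, and since \<open>\<gamma>\<^sub>s\<close> is trivial for
  \<open>s > n\<close> (\<open>lcs_p_group\<close>), the number \<open>d\<close> of its layers satisfies \<open>2 ^ (d - 1) \<le> n\<close>. The basis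
  theorem for finite abelian \<open>p\<close>-groups (\<open>p_group_basis_mod_subgroup\<close>) yields \<open>n\<close> generators of
  relative order \<open>p\<close> such that the \<open>p\<close>-th power of each is the next generator or lies in the next
  layer. There are \<open>p\<^sup>n\<close> normal words and they represent all elements of \<open>G\<close>; hence every
  element has a unique normal form, and these normal forms provide the right-hand sides of a
  favourable presentation of \<open>G\<close> with all exponents equal to \<open>p\<close>.

  For the number of steps, note that collection from the left keeps a normal prefix and inserts the
  following letters into it one at a time. Let \<open>x\<close> and \<open>y\<close> bound the number of letters of layer
  \<open>k\<close> and of higher layers in a normal word, and let \<open>T\<close> bound the cost of collecting a product of
  two normal words in the higher layers. A new letter of layer \<open>k\<close> moves to the left past the
  higher letters and past some letters \<open>b\<close> of its own layer. Each of these letters \<open>b\<close> now stands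
  behind higher letters and has to be inserted again, but it only has to move past at most \<open>y\<close>
  higher letters, as the letters of layer \<open>k\<close> remain sorted. Every pair of letters that changes
  places leaves behind at most one normal word in higher layers, to be collected at cost \<open>T\<close>. Hence
  the cost of a product of two normal words in layers \<open>\<ge> k\<close> is about \<open>x\<^sup>2 * y * T\<close>, and
  certainly less than \<open>(x + y)\<^sup>3 * (T + 1)\<close> if \<open>y > 0\<close> (\<open>concat_cost_step\<close>, \<open>step_bound_general\<close>).
  In the last layer, where \<open>y = 0\<close>, it is less than \<open>2 * x\<^sup>2\<close> (\<open>step_bound_last\<close>). With
  \<open>L = (p - 1) * n\<close>, the greatest length of a normal word, and \<open>d > 1\<close>, this adds up to less than
  \<open>L ^ (3 * d - 1)\<close> steps.

  The exponent allowed is \<open>3 * log 2 n + 1\<close>, which is at least \<open>3 * d - 2\<close> because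
  \<open>2 ^ (d - 1) \<le> n\<close>, and exceeds \<open>3 * d - 1\<close> if \<open>3 * 2 ^ (d - 2) \<le> n\<close>. In the remaining case
  \<open>\<gamma>\<^sub>s\<close> is trivial for \<open>s = 3 * 2 ^ (d - 2)\<close>, so the last two layers centralise each other.
  Letters of these two layers then change places without leaving anything behind, which saves one
  factor \<open>L\<close>. The case \<open>d = 1\<close> is treated separately.
\<close>

section \<open>Normal words\<close>

lemma count_concat_replicate:
  "count_list (concat (map (\<lambda>i. replicate (\<alpha> i) i) [a..<b])) j = (if a \<le> j \<and> j < b then \<alpha> j else 0)"
proof (induction b)
  case (Suc b)
  have "count_list (replicate m i) j = (if i = j then m else 0)" for m i
    by (induction m) auto
  then show ?case using Suc by auto
qed simp

lemma sorted_concat_replicate: "sorted (concat (map (\<lambda>i. replicate (\<alpha> i) i) [a..<b]))"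
  for \<alpha> :: "nat \<Rightarrow> nat"
  by (induction b) (auto simp: sorted_append)

lemma sorted_count_eqI:
  fixes xs ys :: "nat list"
  assumes "sorted xs" "sorted ys" "\<And>i. count_list xs i = count_list ys i"
  shows "xs = ys"
proof -
  have "mset xs = mset ys"
    by (rule multiset_eqI) (simp add: assms count_mset)
  then show ?thesis
    using assms properties_for_sort by metis
qed

text \<open>
  Sortedness and bounded multiplicities are easier to follow through a sequence of collection steps
  than the exponent vector in the definition.
\<close>
lemma normal_word_iff:
  "normal_word P w \<longleftrightarrow> sorted w \<and> set w \<subseteq> pc_gens P \<and> (\<forall>i\<in>pc_gens P. count_list w i < expo P i)"
proof
  assume "normal_word P w"
  then obtain \<alpha> where \<alpha>: "\<forall>i\<in>pc_gens P. \<alpha> i < expo P i"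
      and w: "w = concat (map (\<lambda>i. replicate (\<alpha> i) i) [1..<Suc (ngens P)])"
    by (auto simp: normal_word_def)
  have "set w \<subseteq> pc_gens P" by (auto simp: w pc_gens_def)
  moreover have "\<forall>i\<in>pc_gens P. count_list w i < expo P i"
    using \<alpha> unfolding w count_concat_replicate by (auto simp: pc_gens_def)
  ultimately show "sorted w \<and> set w \<subseteq> pc_gens P \<and> (\<forall>i\<in>pc_gens P. count_list w i < expo P i)"
    using sorted_concat_replicate[of \<alpha> 1 "Suc (ngens P)"] unfolding w[symmetric] by simp
next
  assume w: "sorted w \<and> set w \<subseteq> pc_gens P \<and> (\<forall>i\<in>pc_gens P. count_list w i < expo P i)"
  have "w = concat (map (\<lambda>i. replicate (count_list w i) i) [1..<Suc (ngens P)])"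
  proof (rule sorted_count_eqI)
    show "count_list w i = count_list (concat (map (\<lambda>i. replicate (count_list w i) i) [1..<Suc (ngens P)])) i" for i
      using w unfolding count_concat_replicate
      by (auto simp: pc_gens_def count_list_0_iff subset_iff)
  qed (use w sorted_concat_replicate[of "count_list w" 1 "Suc (ngens P)"] in \<open>simp_all only:\<close>)
  with w show "normal_word P w" unfolding normal_word_def
    by (intro exI[of _ "count_list w"]) auto
qed

lemma normal_word_appendD: "normal_word P (u @ w) \<Longrightarrow> normal_word P u \<and> normal_word P w"
  by (force simp: normal_word_iff sorted_append)

lemma pc_rels_cases:
  assumes "(l, r) \<in> pc_rels P"
  obtains (power) i where "i \<in> pc_gens P" "l = replicate (expo P i) i" "r = rhs P i i"
  | (swap) i j where "i \<in> pc_gens P" "j \<in> pc_gens P" "i < j" "l = [j, i]" "r = i # rhs P i j"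
  using assms unfolding pc_rels_def by blast

lemma not_normal_word_lhs:
  assumes "(l, r) \<in> pc_rels P"
  shows "\<not> normal_word P (s @ l @ t)"
  using assms
proof (cases rule: pc_rels_cases)
  case (power i)
  have "count_list (replicate m i) i = m" for m by (induction m) auto
  then show ?thesis using power by (force simp: normal_word_iff)
next
  case (swap i j)
  then show ?thesis by (auto simp: normal_word_iff sorted_append)
qed

text \<open>
  A left-hand side consists of equal letters or of two distinct ones, so it cannot properly contain
  another one. Leftmost occurrences are therefore not affected by what follows them.
\<close>
lemma lhs_not_proper_infix:
  assumes "(l, r) \<in> pc_rels P" "(m @ l @ m', r') \<in> pc_rels P" "m \<noteq> []"
    and e: "\<And>i. i \<in> pc_gens P \<Longrightarrow> 1 < expo P i"
  shows False
  using assms(2)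
proof (cases rule: pc_rels_cases)
  case outer: (power i)
  have all: "\<forall>x \<in> set l. x = i" and len: "length m + length l + length m' = expo P i"
    using outer(2) by (metis Un_iff in_set_replicate set_append, metis length_append length_replicate add.assoc)
  from assms(1) show ?thesis
  proof (cases rule: pc_rels_cases)
    case (power i')
    then have "i' = i" using all e[of i'] by auto
    then show ?thesis using power len \<open>m \<noteq> []\<close> by auto
  qed (use all in auto)
next
  case outer: (swap i j)
  then have len: "length m + length l + length m' = 2"
    by (metis length_append length_Cons list.size(3) add.assoc numeral_2_eq_2)
  have "length l \<ge> 2"
    using assms(1) by (cases rule: pc_rels_cases) (use e in fastforce)+
  then show ?thesis using len \<open>m \<noteq> []\<close> by (cases m) auto
qed

text \<open>
  While the prefix read so far is normal, the leftmost minimal non-normal subword can only end with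
  the next letter: an occurrence starting further to the left would lie inside the normal prefix or
  properly contain the one at hand.
\<close>
lemma collect_left_at_prefix_end:
  assumes u: "normal_word P u" and lr: "(l, r) \<in> pc_rels P" and eq: "u @ [y] = s @ l"
    and e: "\<And>i. i \<in> pc_gens P \<Longrightarrow> 1 < expo P i"
  shows "collect_left P (u @ y # t) (s @ r @ t)"
proof -
  have "length s \<le> length s'" if lr': "(l', r') \<in> pc_rels P" and eq': "u @ y # t = s' @ l' @ t'" for s' l' r' t'
  proof (rule ccontr)
    assume less: "\<not> length s \<le> length s'"
    have x: "s @ l @ t = s' @ l' @ t'" using eq eq' by (metis append.assoc append_Cons append_Nil)
    show False
    proof (cases "length (s' @ l') \<le> length u")
      case True
      have "u @ y # t = (s' @ l') @ t'" using eq' by simp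
      then have "take (length (s' @ l')) u = s' @ l'"
        using True by (metis append_eq_append_conv_if append_take_drop_id)
      then have "u = s' @ l' @ drop (length (s' @ l')) u" by (metis append.assoc append_take_drop_id)
      then show False using u not_normal_word_lhs[OF lr'] by metis
    next
      case False
      have "length (s @ l) = Suc (length u)" by (metis eq length_append_singleton)
      then have len: "length (s @ l) \<le> length (s' @ l')" using False by simp
      obtain m where m: "s = s' @ m" "m @ l @ t = l' @ t'"
        using x less by (auto simp: append_eq_append_conv2)
      obtain m' where "l' = m @ l @ m'"
        using m len by (auto simp: append_eq_append_conv2)
          
      then show False using lhs_not_proper_infix[OF lr _ _ e] lr' m less by auto
    qed
  qed
  moreover have "u @ y # t = s @ l @ t" using eq by (metis append.assoc append_Cons append_Nil)
  ultimately show ?thesis using lr unfolding collect_left_def by blast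
qed

section \<open>Collection with a normal prefix\<close>

text \<open>
  In \<open>run P u t n u' t'\<close> the word \<open>u @ t\<close> is split into a prefix \<open>u\<close> that is kept normal and the
  unread rest \<open>t\<close>; \<open>n\<close> counts collection steps, so reading a letter that fits (\<open>push\<close>) is free.
  After a step its right-hand side returns to the unread part, which makes a run depend only on the
  prefix and on the letters actually read. This is what allows costs to be added up.
\<close>
inductive run :: "pc_data \<Rightarrow> nat list \<Rightarrow> nat list \<Rightarrow> nat \<Rightarrow> nat list \<Rightarrow> nat list \<Rightarrow> bool" for P where
  stop: "run P u t 0 u t"
| push: "normal_word P (u @ [y]) \<Longrightarrow> run P (u @ [y]) t n u' t' \<Longrightarrow> run P u (y # t) n u' t'"
| swap: "i \<in> pc_gens P \<Longrightarrow> j \<in> pc_gens P \<Longrightarrow> i < j \<Longrightarrow> run P u (i # rhs P i j @ t) n u' t'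
    \<Longrightarrow> run P (u @ [j]) (i # t) (Suc n) u' t'"
| power: "i \<in> pc_gens P \<Longrightarrow> run P u (rhs P i i @ t) n u' t'
    \<Longrightarrow> run P (u @ replicate (expo P i - 1) i) (i # t) (Suc n) u' t'"

lemma run_trans:
  "run P u t n u' t' \<Longrightarrow> run P u' t' m u'' t'' \<Longrightarrow> run P u t (n + m) u'' t''"
  by (induction rule: run.induct) (auto intro: run.intros simp del: One_nat_def)

lemma run_append: "run P u t n u' t' \<Longrightarrow> run P u (t @ r) n u' (t' @ r)"
  by (induction rule: run.induct) (auto intro: run.intros simp del: One_nat_def)

lemma run_then:
  "run P u s n u' [] \<Longrightarrow> run P u' t m u'' t'' \<Longrightarrow> run P u (s @ t) (n + m) u'' t''"
  using run_append run_trans by fastforce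

lemma run_push_all: "normal_word P (u @ t) \<Longrightarrow> run P u t 0 (u @ t) []"
proof (induction t arbitrary: u)
  case (Cons y t)
  have "normal_word P (u @ [y])" using normal_word_appendD[of P "u @ [y]" t] Cons.prems by simp
  then show ?case using Cons.IH[of "u @ [y]"] Cons.prems by (auto intro!: run.push)
qed (auto intro: run.stop)

text \<open>
  Runs are collections from the left: by \<open>collect_left_at_prefix_end\<close>, the step at the end of a
  normal prefix is the one that collection from the left has to take.
\<close>
lemma run_collect_left:
  assumes "run P u t n u' t'" "normal_word P u"
    and e: "\<And>i. i \<in> pc_gens P \<Longrightarrow> 1 < expo P i"
  shows "normal_word P u' \<and> (collect_left P ^^ n) (u @ t) (u' @ t')"
  using assms(1,2)
proof (induction rule: run.induct)
  case (swap i j u t n u' t')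
  have "collect_left P ((u @ [j]) @ i # t) (u @ (i # rhs P i j) @ t)"
    by (rule collect_left_at_prefix_end[of _ _ "[j, i]"])
       (use swap e in \<open>auto simp: pc_rels_def\<close>)
  with swap normal_word_appendD show ?case
    by (metis append.assoc append_Cons relpowp_Suc_I2)
next
  case (power i u t n u' t')
  have "replicate (expo P i) i = replicate (expo P i - 1) i @ [i]"
    using e[OF power.hyps(1)] by (metis replicate_Suc replicate_append_same Suc_diff_1 less_imp_le_nat less_trans zero_less_one)
  then have "collect_left P ((u @ replicate (expo P i - 1) i) @ i # t) (u @ rhs P i i @ t)"
    by (intro collect_left_at_prefix_end[of _ _ "replicate (expo P i) i"])
       (use power e in \<open>auto simp: pc_rels_def\<close>)
  with power normal_word_appendD show ?case
    by (metis relpowp_Suc_I2)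
qed auto

section \<open>The cost of one layer\<close>

lemma sorted_filter_split:
  fixes xs :: "nat list"
  assumes "sorted xs" "\<And>x y. x \<in> set xs \<Longrightarrow> y \<in> set xs \<Longrightarrow> x \<le> y \<Longrightarrow> Q y \<Longrightarrow> Q x"
  shows "filter Q xs @ filter (\<lambda>x. \<not> Q x) xs = xs"
  using assms
proof (induction xs)
  case (Cons x xs)
  show ?case
  proof (cases "Q x")
    case True
    have "filter Q xs @ filter (\<lambda>x. \<not> Q x) xs = xs"
      using Cons.prems by (intro Cons.IH) auto
    then show ?thesis using True by simp
  next
    case False
    then have "\<not> Q y" if "y \<in> set (x # xs)" for y
      using Cons.prems(2)[of x y] Cons.prems(1) that by auto
    then have "filter Q (x # xs) = []" "filter (\<lambda>x. \<not> Q x) (x # xs) = x # xs"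
      by (simp_all add: filter_empty_conv)
    then show ?thesis by simp
  qed
qed simp

text \<open>
  This is a favourable presentation with all exponents equal to \<open>p\<close>, where in addition generators of
  the same layer commute modulo higher layers, so that a letter passed inside its layer survives.
\<close>
locale layered_presentation =
  fixes P :: pc_data and p :: nat and \<delta> :: "nat \<Rightarrow> nat"
  assumes p: "2 \<le> p"
    and expo: "i \<in> pc_gens P \<Longrightarrow> expo P i = p"
    and mono: "mono_on (pc_gens P) \<delta>"
    and rhs_power: "i \<in> pc_gens P \<Longrightarrow>
      i + 1 \<in> pc_gens P \<and> \<delta> (i + 1) = \<delta> i \<and> rhs P i i = [i + 1] \<or> higher_word P \<delta> i (rhs P i i)"
    and rhs_same: "i \<in> pc_gens P \<Longrightarrow> j \<in> pc_gens P \<Longrightarrow> i < j \<Longrightarrow> \<delta> i = \<delta> j \<Longrightarrow>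
      \<exists>w. higher_word P \<delta> i w \<and> rhs P i j = j # w"
    and rhs_higher: "i \<in> pc_gens P \<Longrightarrow> j \<in> pc_gens P \<Longrightarrow> \<delta> i < \<delta> j \<Longrightarrow> higher_word P \<delta> i (rhs P i j)"
begin

lemma less_of_layer: "i \<in> pc_gens P \<Longrightarrow> j \<in> pc_gens P \<Longrightarrow> \<delta> i < \<delta> j \<Longrightarrow> i < j"
  using mono_onD[OF mono, of j i] by (meson leD le_less_linear)

lemma normal_iff:
  "normal_word P w \<longleftrightarrow> sorted w \<and> set w \<subseteq> pc_gens P \<and> (\<forall>i. count_list w i < p)"
  using p expo unfolding normal_word_iff
  by (metis count_list_0_iff in_mono less_le_trans pos2)

lemma normal_Nil [simp]: "normal_word P []"
  using p by (simp add: normal_iff)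

lemma normal_single [simp]: "normal_word P [i] \<longleftrightarrow> i \<in> pc_gens P"
  using p by (auto simp: normal_iff)

lemma normal_append:
  assumes "normal_word P u" "normal_word P w" "\<forall>x\<in>set u. \<delta> x \<le> k" "\<forall>x\<in>set w. k < \<delta> x"
  shows "normal_word P (u @ w)"
proof -
  have "x < y" if "x \<in> set u" "y \<in> set w" for x y
    using that assms less_of_layer[of x y] by (force simp: normal_iff)
  moreover have "count_list u i = 0 \<or> count_list w i = 0" for i
    using assms by (metis count_list_0_iff leD)
  ultimately show ?thesis using assms
    by (auto simp: normal_iff sorted_append less_imp_le) (metis add_0 add_0_right)
qed

lemma normal_append_layer:
  assumes "normal_word P u" "normal_word P w" "\<forall>x\<in>set u. \<delta> x < k" "\<forall>x\<in>set w. k \<le> \<delta> x"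
  shows "normal_word P (u @ w)"
proof (cases k)
  case 0
  then show ?thesis using assms by auto
next
  case (Suc k')
  then show ?thesis using assms normal_append[of u w k'] by (auto simp: less_Suc_eq_le Suc_le_eq)
qed

lemma normal_filter: "normal_word P w \<Longrightarrow> normal_word P (filter Q w)"
proof -
  have "count_list (filter Q w) i \<le> count_list w i" for i
    by (induction w) auto
  then show "normal_word P w \<Longrightarrow> normal_word P (filter Q w)"
    by (auto simp: normal_iff sorted_wrt_filter intro: le_less_trans)
qed

lemma length_normal:
  assumes "normal_word P w" "set w \<subseteq> A" "finite A"
  shows "length w \<le> (p - 1) * card A"
proof -
  have "length w = (\<Sum>x\<in>A. count_list w x)"
    using assms(2,3) by (simp add: sum_count_set)
  also have "\<dots> \<le> (\<Sum>x\<in>A. p - 1)"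
    using assms(1) by (intro sum_mono) (metis Suc_pred' less_Suc_eq_le normal_iff p pos2 less_le_trans)
  finally show ?thesis by (simp add: mult.commute)
qed

text \<open>
  A normal word is cut at a layer \<open>k\<close> into the parts below, in and above that layer. Only the parts
  in and above change while letters of layers \<open>\<ge> k\<close> are inserted, which is why the costs below
  are stated with an arbitrary prefix \<open>v\<close> of lower letters that stays as it is.
\<close>
definition above :: "nat \<Rightarrow> nat list \<Rightarrow> bool" where
  "above k w \<longleftrightarrow> normal_word P w \<and> (\<forall>x\<in>set w. k < \<delta> x)"

definition in_layer :: "nat \<Rightarrow> nat list \<Rightarrow> bool" where
  "in_layer k w \<longleftrightarrow> set w \<subseteq> {i \<in> pc_gens P. \<delta> i = k}"

definition below :: "nat \<Rightarrow> nat list \<Rightarrow> bool" where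
  "below k w \<longleftrightarrow> normal_word P w \<and> (\<forall>x\<in>set w. \<delta> x < k)"

definition up_to :: "nat \<Rightarrow> nat list \<Rightarrow> bool" where
  "up_to k w \<longleftrightarrow> normal_word P w \<and> (\<forall>x\<in>set w. \<delta> x \<le> k)"

lemma above_Nil [simp]: "above k []" by (simp add: above_def)

lemma above_gens: "above k h \<Longrightarrow> b \<in> set h \<Longrightarrow> b \<in> pc_gens P \<and> k < \<delta> b"
  by (auto simp: above_def normal_iff)

lemma above_rhs_higher: "a \<in> pc_gens P \<Longrightarrow> b \<in> pc_gens P \<Longrightarrow> \<delta> a < \<delta> b \<Longrightarrow> above (\<delta> a) (rhs P a b)"
  using rhs_higher by (auto simp: above_def higher_word_def)

definition concat_cost :: "nat \<Rightarrow> nat \<Rightarrow> bool" where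
  "concat_cost k T \<longleftrightarrow> (\<forall>v h w. up_to k v \<and> above k h \<and> above k w \<longrightarrow>
     (\<exists>h' n. above k h' \<and> n \<le> T \<and> run P (v @ h) w n (v @ h') []))"

text \<open>
  When a letter \<open>a\<close> has moved past a normal word \<open>w\<close> in higher layers, the product of the right-hand
  sides \<open>rhs P a b\<close> for \<open>b\<close> in \<open>w\<close> remains to be collected. In the group this product represents the
  conjugate of \<open>w\<close> by \<open>a\<close>. Its cost is a parameter because it is much smaller when \<open>a\<close> commutes
  with all higher letters.
\<close>
definition conj_cost :: "nat \<Rightarrow> nat \<Rightarrow> bool" where
  "conj_cost k R \<longleftrightarrow> (\<forall>v h w a. up_to k v \<and> above k h \<and> above k w \<and> a \<in> pc_gens P \<and> \<delta> a = k \<longrightarrow>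
     (\<exists>h' n. above k h' \<and> n \<le> R \<and> run P (v @ h) (concat (map (rhs P a) w)) n (v @ h') []))"

lemma concat_costD:
  assumes "concat_cost k T" "up_to k v" "above k h" "above k w"
  shows "\<exists>h' n. above k h' \<and> n \<le> T \<and> run P (v @ h) w n (v @ h') []"
  using assms unfolding concat_cost_def by blast

lemma conj_costD:
  assumes "conj_cost k R" "up_to k v" "above k h" "above k w" "a \<in> pc_gens P" "\<delta> a = k"
  shows "\<exists>h' n. above k h' \<and> n \<le> R \<and> run P (v @ h) (concat (map (rhs P a) w)) n (v @ h') []"
  using assms unfolding conj_cost_def by blast

text \<open>A letter \<open>a\<close> moves to the left past larger ones, and the right-hand sides pile up behind it in order.\<close>
lemma pass:
  assumes "a \<in> pc_gens P" "\<forall>b\<in>set h. b \<in> pc_gens P \<and> a < b"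
  shows "run P (v @ h) (a # t) (length h) v (a # concat (map (rhs P a) h) @ t)"
  using assms(2)
proof (induction h arbitrary: t rule: rev_induct)
  case (snoc b h)
  have "run P (v @ h) (a # rhs P a b @ t) (length h) v (a # concat (map (rhs P a) h) @ rhs P a b @ t)"
    using snoc by auto
  then show ?case using snoc.prems assms(1) run.swap[of a P b "v @ h"] by fastforce
qed (auto intro: run.stop)

lemma concat_cost_list:
  assumes "concat_cost k T" "up_to k v" "above k h" "\<forall>w\<in>set ws. above k w"
  shows "\<exists>h' n. above k h' \<and> n \<le> length ws * T \<and> run P (v @ h) (concat ws) n (v @ h') []"
  using assms(3,4)
proof (induction ws arbitrary: h)
  case Nil
  then show ?case using run.stop by auto
next
  case (Cons w ws)
  obtain h1 n where 1: "above k h1" "n \<le> T" "run P (v @ h) w n (v @ h1) []"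
    using assms(1,2) Cons.prems unfolding concat_cost_def by (meson list.set_intros(1))
  obtain h2 m where 2: "above k h2" "m \<le> length ws * T" "run P (v @ h1) (concat ws) m (v @ h2) []"
    using Cons.IH[OF 1(1)] Cons.prems by auto
  then show ?case using run_then[OF 1(3) 2(3)] 1 by (intro exI[of _ h2] exI[of _ "n + m"]) auto
qed

lemma conj_cost_general:
  assumes "concat_cost k T" "\<And>h. above k h \<Longrightarrow> length h \<le> y"
  shows "conj_cost k (y * T)"
  unfolding conj_cost_def
proof (intro allI impI, elim conjE)
  fix v h w a assume A: "up_to k v" "above k h" "above k w" "a \<in> pc_gens P" "\<delta> a = k"
  obtain h' n where "above k h'" "n \<le> length w * T" "run P (v @ h) (concat (map (rhs P a) w)) n (v @ h') []"
    using concat_cost_list[OF assms(1) A(1,2), of "map (rhs P a) w"] above_gens[OF A(3)] above_rhs_higher A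
    by auto
  moreover have "length w * T \<le> y * T" using assms(2)[OF A(3)] by simp
  ultimately show "\<exists>h' n. above k h' \<and> n \<le> y * T \<and> run P (v @ h) (concat (map (rhs P a) w)) n (v @ h') []"
    by (meson order_trans)
qed

lemma conj_cost_commuting:
  assumes "concat_cost k T"
    and "\<And>a b. a \<in> pc_gens P \<Longrightarrow> b \<in> pc_gens P \<Longrightarrow> \<delta> a = k \<Longrightarrow> k < \<delta> b \<Longrightarrow> rhs P a b = [b]"
  shows "conj_cost k T"
  unfolding conj_cost_def
proof (intro allI impI, elim conjE)
  fix v h w a assume A: "up_to k v" "above k h" "above k w" "a \<in> pc_gens P" "\<delta> a = k"
  have "concat (map (rhs P a) w) = concat (map (\<lambda>b. [b]) w)"
    using assms(2) A above_gens[OF A(3)] by (intro arg_cong[where f = concat] map_cong) auto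
  then show "\<exists>h' n. above k h' \<and> n \<le> T \<and> run P (v @ h) (concat (map (rhs P a) w)) n (v @ h') []"
    using assms(1) A unfolding concat_cost_def by simp
qed

end

text \<open>
  The parameter \<open>s\<close> bounds the number of letters of layer \<open>k\<close> that can follow a given letter \<open>a\<close> of
  that layer in a normal word. It can be \<open>0\<close> if the layer has only one generator, which matters for
  groups of order \<open>p\<close>: there the bound of the theorem is attained for \<open>p = 2\<close>.
\<close>
locale layer_step = layered_presentation +
  fixes k T R x s y :: nat
  assumes T: "concat_cost k T" and R: "conj_cost k R"
    and y: "above k h \<Longrightarrow> length h \<le> y"
    and x: "normal_word P g \<Longrightarrow> in_layer k g \<Longrightarrow> length g \<le> x"
    and s: "normal_word P g \<Longrightarrow> in_layer k g \<Longrightarrow> a \<in> pc_gens P \<Longrightarrow> \<delta> a = k \<Longrightarrow> a \<notin> set g \<Longrightarrow> length g \<le> s"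
begin

text \<open>
  Let \<open>g\<close> be the letters of layer \<open>k\<close> in the normal prefix, and \<open>bs\<close> those that have been passed and
  have to be inserted again. Together they are sorted, and they form a normal word except that one
  letter may have the full multiplicity \<open>p\<close>. If so, that letter must be the last one of \<open>g\<close>.
  The exception accounts for a carry: applying \<open>a\<^sup>p = a'\<close> with \<open>a'\<close> the next generator adds one
  letter \<open>a'\<close>. The invariant says that a carry never leads to a second simultaneous one, and that
  each pending letter belongs at the end of \<open>g\<close>.
\<close>
definition pending :: "nat list \<Rightarrow> nat list \<Rightarrow> bool" where
  "pending g bs \<longleftrightarrow> normal_word P g \<and> in_layer k g \<and> in_layer k bs \<and> sorted (g @ bs) \<and>
     (\<forall>c. count_list (g @ bs) c \<le> p) \<and>
     (\<forall>c. count_list (g @ bs) c = p \<longrightarrow> g \<noteq> [] \<and> c = last g)"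

text \<open>
  A pending letter arriving at its place is either read for free or completes a \<open>p\<close>-th power. In the
  latter case no further copy of it is pending, and one step replaces the power by the next generator
  or by a word \<open>w\<close> in higher layers.
\<close>
lemma settle:
  assumes v: "below k v" and pend: "pending g (a # bs)"
  shows "\<exists>g' w n. pending g' bs \<and> above k w \<and> n \<le> 1 \<and>
    run P (v @ g) (a # t) n (v @ g') (w @ t)"
proof (cases "count_list g a < p - 1")
  case True
  then have n: "normal_word P (g @ [a])"
    using pend by (auto simp: pending_def normal_iff in_layer_def sorted_append)
  have "normal_word P (v @ g @ [a])"
    using v n pend by (intro normal_append_layer[of v "g @ [a]" k]) (auto simp: pending_def in_layer_def below_def)
  then have "run P (v @ g) (a # t) 0 (v @ g @ [a]) t"
    by (intro run.push) (auto intro: run.stop)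
  moreover have "pending (g @ [a]) bs"
  proof -
    have "c = a" if "count_list (g @ a # bs) c = p" for c
    proof -
      have "g \<noteq> []" "c = last g" using that pend by (auto simp: pending_def)
      then have "c \<in> set g" by simp
      show "c = a"
      proof (rule ccontr)
        assume "c \<noteq> a"
        have "c \<le> a" "\<forall>b\<in>set bs. a \<le> b" using pend \<open>c \<in> set g\<close> by (auto simp: pending_def sorted_append)
        then have "count_list bs c = 0" using \<open>c \<noteq> a\<close> by (auto simp: count_list_0_iff)
        then have "count_list g c = p" using that \<open>c \<noteq> a\<close> by simp
        then show False using pend by (auto simp: pending_def normal_iff)
      qed
    qed
    then show ?thesis using n pend by (auto simp: pending_def in_layer_def)
  qed
  ultimately show ?thesis by (intro exI[of _ "g @ [a]"] exI[of _ "[]"] exI[of _ 0]) auto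
next
  case False
  have a: "a \<in> pc_gens P" "\<delta> a = k" using pend by (auto simp: pending_def in_layer_def)
  have srt: "sorted g" "\<forall>b\<in>set g. b \<le> a" "\<forall>b\<in>set bs. a \<le> b" "sorted bs"
    using pend by (auto simp: pending_def sorted_append)
  have cnt: "count_list g a = p - 1" using False pend
    by (auto simp: pending_def normal_iff) (metis One_nat_def Suc_pred less_antisym p not_less_iff_gr_or_eq less_le_trans pos2)
  define g0 where "g0 = filter (\<lambda>b. b < a) g"
  have "filter (\<lambda>b. \<not> b < a) g = filter (\<lambda>b. a = b) g"
    using srt by (intro filter_cong) auto
  also have "\<dots> = replicate (p - 1) a"
    using cnt by (metis count_list_eq_length_filter replicate_length_filter)
  finally have g: "g = g0 @ replicate (p - 1) a"
    using sorted_filter_split[OF srt(1), of "\<lambda>b. b < a"] by (simp add: g0_def)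
  have na: "a \<notin> set bs"
  proof -
    have "count_list (g @ a # bs) a \<le> p" using pend unfolding pending_def by blast
    then have "count_list bs a = 0" using cnt p by simp
    then show ?thesis by (simp add: count_list_0_iff)
  qed
  have "last g = a" using p by (simp add: g)
  then have pc: "c = a" if "count_list (g @ a # bs) c = p" for c
    using that pend unfolding pending_def by blast
  have le: "count_list (g @ a # bs) c \<le> p" for c
    using pend unfolding pending_def by blast
  have pend0: "pending g0 bs"
  proof -
    have "count_list (g0 @ bs) c < p" for c
    proof -
      have c: "count_list (g0 @ bs) c \<le> count_list (g @ a # bs) c" by (simp add: g)
      have "count_list (g0 @ bs) a = 0" using na by (auto simp: count_list_0_iff g0_def)
      then have "c = a \<Longrightarrow> count_list (g0 @ bs) c = 0" by blast
      then show ?thesis using c pc[of c] le[of c] p by linarith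
    qed
    then show ?thesis using pend normal_filter[of g]
      by (auto simp: pending_def in_layer_def g0_def sorted_append sorted_wrt_filter less_le)
  qed
  have step: "run P (v @ g) (a # t) 1 (v @ g0) (rhs P a a @ t)"
    using run.power[OF a(1) run.stop[of P "v @ g0"]] by (simp add: g expo[OF a(1)])
  from rhs_power[OF a(1)] show ?thesis
  proof
    assume "higher_word P \<delta> a (rhs P a a)"
    then have "above k (rhs P a a)" using a by (simp add: above_def higher_word_def)
    then show ?thesis using pend0 step by blast
  next
    assume r: "a + 1 \<in> pc_gens P \<and> \<delta> (a + 1) = \<delta> a \<and> rhs P a a = [a + 1]"
    have notin: "a + 1 \<notin> set g" using srt by auto
    have n: "normal_word P (g0 @ [a + 1])"
    proof -
      have "count_list g0 (a + 1) = 0" using notin by (auto simp: g0_def count_list_0_iff)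
      then show ?thesis using pend0 r p by (auto simp: pending_def normal_iff sorted_append g0_def)
    qed
    have "normal_word P (v @ g0 @ [a + 1])"
      using v n pend0 r a by (intro normal_append_layer[of v "g0 @ [a + 1]" k]) (auto simp: pending_def in_layer_def below_def)
    then have "run P (v @ g0) (rhs P a a @ t) 0 (v @ g0 @ [a + 1]) t"
      using r by (auto intro!: run.push intro: run.stop)
    then have "run P (v @ g) (a # t) 1 (v @ g0 @ [a + 1]) t"
      using run_trans[OF step] by simp
    moreover have "pending (g0 @ [a + 1]) bs"
    proof -
      have b: "\<forall>b\<in>set bs. a + 1 \<le> b" using srt na by (metis Suc_eq_plus1 Suc_leI le_neq_implies_less)
      have c1: "count_list (g0 @ (a + 1) # bs) c \<le> p" for c
      proof (cases "c = a + 1")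
        case True
        have "count_list (g @ a # bs) (a + 1) < p"
          using pc[of "a + 1"] le[of "a + 1"] by linarith
        then show ?thesis using True by (simp add: g)
      next
        case False
        then show ?thesis using pend0 by (auto simp: pending_def)
      qed
      have c2: "c = a + 1" if c: "count_list (g0 @ (a + 1) # bs) c = p" for c
      proof (rule ccontr)
        assume n: "c \<noteq> a + 1"
        then have c': "count_list (g0 @ bs) c = p" using c by simp
        then have "c \<in> set g0" using pend0 by (auto simp: pending_def)
        then have "c < a" by (simp add: g0_def)
        then have "count_list bs c = 0" using srt by (auto simp: count_list_0_iff)
        then show False using c' pend0 by (auto simp: pending_def normal_iff)
      qed
      have "\<forall>x\<in>set g0. x \<le> a + 1" by (auto simp: g0_def)
      then show ?thesis using n pend0 r a b c1 c2
        by (auto simp: pending_def in_layer_def sorted_append)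
    qed
    ultimately show ?thesis by (intro exI[of _ "g0 @ [a + 1]"] exI[of _ "[]"] exI[of _ 1]) auto
  qed
qed

lemma up_to_above: "up_to k v \<Longrightarrow> above k w \<Longrightarrow> normal_word P (v @ w)"
  using normal_append[of v w k] by (auto simp: up_to_def above_def)

lemma up_to_append: "below k v \<Longrightarrow> normal_word P g \<Longrightarrow> in_layer k g \<Longrightarrow> up_to k (v @ g)"
  using normal_append_layer[of v g k] by (fastforce simp: below_def in_layer_def up_to_def)

text \<open>
  The cost of inserting the passed letters \<open>b\<close> again, each followed by the higher word \<open>w b\<close> left by
  the passage. For each \<open>b\<close> there are at most \<open>y\<close> steps to move past the higher letters of the
  prefix, one power relation, \<open>R\<close> steps for the conjugates of these higher letters, and \<open>T\<close> steps
  for \<open>w b\<close>. A higher word produced by the power relation is free: it is read when no other higher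
  letters are left in the prefix.
\<close>
lemma recollect:
  assumes v: "below k v" and pend: "pending g bs" and h: "above k h" and w: "\<forall>b\<in>set bs. above k (w b)"
  shows "\<exists>g' h' n. normal_word P g' \<and> in_layer k g' \<and> above k h' \<and> n \<le> length bs * (y + 1 + R + T) \<and>
    run P (v @ g @ h) (concat (map (\<lambda>b. b # w b) bs)) n (v @ g' @ h') []"
  using pend h w
proof (induction bs arbitrary: g h)
  case Nil
  then show ?case using run.stop[of P "v @ g @ h" "[]"] by (auto simp: pending_def)
next
  case (Cons b bs)
  let ?rest = "concat (map (\<lambda>b. b # w b) bs)"
  have b: "b \<in> pc_gens P" "\<delta> b = k" using Cons.prems by (auto simp: pending_def in_layer_def)
  have r1: "run P ((v @ g) @ h) (b # w b @ ?rest) (length h) (v @ g) (b # concat (map (rhs P b) h) @ w b @ ?rest)"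
    by (rule pass) (use b Cons.prems above_gens less_of_layer in auto)
  obtain g1 w0 n1 where 1: "pending g1 bs" "above k w0" "n1 \<le> 1"
      and r2: "run P (v @ g) (b # concat (map (rhs P b) h) @ w b @ ?rest) n1 (v @ g1) (w0 @ concat (map (rhs P b) h) @ w b @ ?rest)"
    using settle[OF v Cons.prems(1)] by blast
  have u: "up_to k (v @ g1)" using 1 up_to_append[OF v] by (auto simp: pending_def)
  have "normal_word P ((v @ g1) @ w0)" using u 1(2) by (rule up_to_above)
  then have r3: "run P (v @ g1) w0 0 ((v @ g1) @ w0) []" by (rule run_push_all)
  obtain h1 n2 where 2: "above k h1" "n2 \<le> R"
      and r4: "run P ((v @ g1) @ w0) (concat (map (rhs P b) h)) n2 ((v @ g1) @ h1) []"
    using conj_costD[OF R u 1(2) Cons.prems(2) b] by blast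
  obtain h2 n3 where 3: "above k h2" "n3 \<le> T"
      and r5: "run P ((v @ g1) @ h1) (w b) n3 ((v @ g1) @ h2) []"
    using T u 2 Cons.prems unfolding concat_cost_def by (meson list.set_intros(1))
  obtain g' h' n4 where 4: "normal_word P g'" "in_layer k g'" "above k h'" "n4 \<le> length bs * (y + 1 + R + T)"
      and r6: "run P ((v @ g1) @ h2) ?rest n4 (v @ g' @ h') []"
    using Cons.IH[OF 1(1) 3(1)] Cons.prems by auto
  have "run P (v @ g @ h) (b # w b @ ?rest) (length h + (n1 + (0 + (n2 + (n3 + n4))))) (v @ g' @ h') []"
    using run_trans[OF r1 run_trans[OF r2 run_then[OF r3 run_then[OF r4 run_then[OF r5 r6]]]]] by simp
  moreover have "length h + (n1 + (0 + (n2 + (n3 + n4)))) \<le> length (b # bs) * (y + 1 + R + T)"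
    using y[OF Cons.prems(2)] 1 2 3 4 by simp
  ultimately show ?case using 4 by (intro exI conjI) (assumption | simp)+
qed

abbreviation "insert_bound \<equiv> s + y + 1 + s * (y + 1 + R + T) + R"

text \<open>
  A new letter \<open>a\<close> first passes all higher letters \<open>h\<close> and the letters \<open>bs\<close> of its own layer that
  exceed \<open>a\<close>. Then \<open>a\<close> is settled, the letters \<open>bs\<close> are recollected, and the conjugate of \<open>h\<close> by \<open>a\<close>
  is collected last.
\<close>
lemma insert_letter:
  assumes v: "below k v" and g: "normal_word P g" "in_layer k g" and h: "above k h"
    and a: "a \<in> pc_gens P" "\<delta> a = k"
  shows "\<exists>g' h' n. normal_word P g' \<and> in_layer k g' \<and> above k h' \<and> n \<le> insert_bound \<and>
    run P (v @ g @ h) [a] n (v @ g' @ h') []"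
proof -
  define g1 where "g1 = filter (\<lambda>b. b \<le> a) g"
  define bs where "bs = filter (\<lambda>b. \<not> b \<le> a) g"
  define w where "w b = tl (rhs P a b)" for b
  have g12: "g = g1 @ bs"
    using sorted_filter_split[of g "\<lambda>b. b \<le> a"] g by (auto simp: g1_def bs_def normal_iff)
  have bs: "b \<in> pc_gens P" "\<delta> b = k" "a < b" if "b \<in> set bs" for b
    using that g by (auto simp: bs_def in_layer_def)
  have w: "above k (w b) \<and> rhs P a b = b # w b" if "b \<in> set bs" for b
    using rhs_same[of a b] bs[OF that] a by (auto simp: above_def w_def higher_word_def)
  have conc: "concat (map (rhs P a) bs) = concat (map (\<lambda>b. b # w b) bs)"
    using w by (intro arg_cong[where f = concat] map_cong) auto
  let ?C = "concat (map (\<lambda>b. b # w b) bs)"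
  have len: "length bs \<le> s"
  proof (rule s[OF _ _ a])
    show "normal_word P bs" unfolding bs_def by (rule normal_filter) fact
    show "in_layer k bs" using bs by (auto simp: in_layer_def)
  qed (auto simp: bs_def)
  have pend: "pending g1 (a # bs)"
  proof -
    have s: "sorted (g1 @ a # bs)"
      using g by (auto simp: normal_iff sorted_append g1_def bs_def sorted_wrt_filter)
    have lt: "count_list (g1 @ bs) c < p" for c
      using g g12 by (auto simp: normal_iff)
    have last: "g1 \<noteq> [] \<and> a = last g1" if "count_list (g1 @ a # bs) a = p"
    proof -
      have "count_list bs a = 0" by (auto simp: bs_def count_list_0_iff)
      then have "count_list g1 a \<noteq> 0" using that p by auto
      then have "a \<in> set g1" by (metis count_list_0_iff)
      moreover have "sorted g1" "\<forall>x\<in>set g1. x \<le> a"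
        using s by (auto simp: sorted_append)
      ultimately show ?thesis
        by (cases g1 rule: rev_cases) (auto simp: sorted_append intro: antisym)
    qed
    show ?thesis unfolding pending_def
    proof (intro conjI allI impI)
      show "normal_word P g1" unfolding g1_def by (rule normal_filter) fact
      show "in_layer k g1" using g by (auto simp: in_layer_def g1_def)
      show "in_layer k (a # bs)" using a bs by (auto simp: in_layer_def)
      show "sorted (g1 @ a # bs)" by fact
      show "count_list (g1 @ a # bs) c \<le> p" for c using lt[of c] by auto
      fix c assume c: "count_list (g1 @ a # bs) c = p"
      then have "c = a" using lt[of c] by (auto split: if_splits)
      then show "g1 \<noteq> []" "c = last g1" using last c by auto
    qed
  qed
  have r1: "run P ((v @ g1) @ (bs @ h)) (a # []) (length (bs @ h)) (v @ g1) (a # concat (map (rhs P a) (bs @ h)) @ [])"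
    by (rule pass) (use a bs h above_gens less_of_layer in auto)
  obtain g2 w0 n1 where 1: "pending g2 bs" "above k w0" "n1 \<le> 1"
      and r2: "run P (v @ g1) (a # ?C @ concat (map (rhs P a) h)) n1 (v @ g2) (w0 @ ?C @ concat (map (rhs P a) h))"
    using settle[OF v pend] by blast
  have u: "up_to k (v @ g2)" using 1 up_to_append[OF v] by (auto simp: pending_def)
  have "normal_word P ((v @ g2) @ w0)" using u 1(2) by (rule up_to_above)
  then have r3: "run P (v @ g2) w0 0 (v @ g2 @ w0) []" using run_push_all by fastforce
  obtain g3 h3 n2 where 2: "normal_word P g3" "in_layer k g3" "above k h3" "n2 \<le> length bs * (y + 1 + R + T)"
      and r4: "run P (v @ g2 @ w0) ?C n2 (v @ g3 @ h3) []"
    using recollect[OF v 1(1,2), of w] w by blast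
  have u3: "up_to k (v @ g3)" using 2 up_to_append[OF v] by auto
  obtain h4 n3 where 3: "above k h4" "n3 \<le> R"
      and r5: "run P ((v @ g3) @ h3) (concat (map (rhs P a) h)) n3 ((v @ g3) @ h4) []"
    using conj_costD[OF R u3 2(3) h a] by blast
  have r5': "run P (v @ g3 @ h3) (concat (map (rhs P a) h)) n3 (v @ g3 @ h4) []" using r5 by simp
  have r1': "run P (v @ g @ h) [a] (length bs + length h) (v @ g1) (a # ?C @ concat (map (rhs P a) h))"
    using r1 conc g12 by simp
  have "run P (v @ g @ h) [a] (length bs + length h + (n1 + (0 + (n2 + n3)))) (v @ g3 @ h4) []"
    using run_trans[OF r1' run_trans[OF r2 run_then[OF r3 run_then[OF r4 r5']]]] .
  moreover have "length bs + length h + (n1 + (0 + (n2 + n3))) \<le> insert_bound"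
  proof -
    have "length bs * (y + 1 + R + T) \<le> s * (y + 1 + R + T)" using len by (rule mult_right_mono) simp
    then show ?thesis using y[OF h] len 1 2 3 by linarith
  qed
  ultimately show ?thesis using 2 3 by blast
qed

lemma insert_letters:
  assumes v: "below k v" and "normal_word P g" "in_layer k g" "above k h" "in_layer k as"
  shows "\<exists>g' h' n. normal_word P g' \<and> in_layer k g' \<and> above k h' \<and> n \<le> length as * insert_bound \<and>
    run P (v @ g @ h) as n (v @ g' @ h') []"
  using assms(2-)
proof (induction as arbitrary: g h)
  case Nil
  then show ?case using run.stop[of P "v @ g @ h" "[]"] by auto
next
  case (Cons a as)
  then have a: "a \<in> pc_gens P" "\<delta> a = k" "in_layer k as" by (auto simp: in_layer_def)
  obtain g1 h1 n where 1: "normal_word P g1" "in_layer k g1" "above k h1" "n \<le> insert_bound"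
      "run P (v @ g @ h) [a] n (v @ g1 @ h1) []"
    using insert_letter[OF v Cons.prems(1-3) a(1,2)] by blast
  obtain g2 h2 m where 2: "normal_word P g2" "in_layer k g2" "above k h2" "m \<le> length as * insert_bound"
      "run P (v @ g1 @ h1) as m (v @ g2 @ h2) []"
    using Cons.IH[OF 1(1-3) a(3)] by blast
  have "run P (v @ g @ h) (a # as) (n + m) (v @ g2 @ h2) []" using run_then[OF 1(5) 2(5)] by simp
  moreover have "n + m \<le> length (a # as) * insert_bound" using 1(4) 2(4) by simp
  ultimately show ?case using 2 by blast
qed

lemma layer_split:
  assumes "normal_word P w" "\<forall>x\<in>set w. k \<le> \<delta> x"
  obtains g h where "w = g @ h" "normal_word P g" "in_layer k g" "above k h"
proof
  let ?g = "filter (\<lambda>x. \<delta> x \<le> k) w" and ?h = "filter (\<lambda>x. \<not> \<delta> x \<le> k) w"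
  show "w = ?g @ ?h"
    using assms mono_onD[OF mono]
    by (intro sorted_filter_split[symmetric]) (auto simp: normal_iff, meson order_trans subsetD)
  show "normal_word P ?g" "above k ?h" using assms normal_filter by (auto simp: above_def)
  show "in_layer k ?g" using assms by (auto simp: in_layer_def normal_iff)
qed

lemma concat_cost_step:
  assumes "k = Suc k'"
  shows "concat_cost k' (x * insert_bound + T)"
  unfolding concat_cost_def
proof (intro allI impI, elim conjE)
  fix v u w assume A: "up_to k' v" "above k' u" "above k' w"
  have v: "below k v" using A assms by (auto simp: up_to_def below_def less_Suc_eq_le)
  obtain g h where u: "u = g @ h" "normal_word P g" "in_layer k g" "above k h"
    using A assms layer_split[of u] by (auto simp: above_def Suc_le_eq)
  obtain as hw where w: "w = as @ hw" "normal_word P as" "in_layer k as" "above k hw"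
    using A assms layer_split[of w] by (auto simp: above_def Suc_le_eq)
  obtain g1 h1 n where 1: "normal_word P g1" "in_layer k g1" "above k h1" "n \<le> length as * insert_bound"
      and r1: "run P (v @ u) as n (v @ g1 @ h1) []"
    using insert_letters[OF v u(2-4) w(3)] u(1) by auto
  obtain h2 m where 2: "above k h2" "m \<le> T" and r2: "run P ((v @ g1) @ h1) hw m ((v @ g1) @ h2) []"
    using T up_to_append[OF v 1(1,2)] 1(3) w(4) unfolding concat_cost_def by meson
  have "run P (v @ u) w (n + m) (v @ (g1 @ h2)) []"
    using run_then[OF r1] r2 w(1) by simp
  moreover have "above k' (g1 @ h2)"
    using normal_append[of g1 h2 k] 1 2 assms by (fastforce simp: above_def in_layer_def)
  moreover have "n + m \<le> x * insert_bound + T"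
  proof -
    have "length as * insert_bound \<le> x * insert_bound" using x[OF w(2,3)] by (rule mult_right_mono) simp
    then show ?thesis using 1 2 by linarith
  qed
  ultimately show "\<exists>h' n. above k' h' \<and> n \<le> x * insert_bound + T \<and> run P (v @ u) w n (v @ h') []" by blast
qed

end

section \<open>The cost of all layers\<close>

text \<open>The bound of \<open>concat_cost_step\<close>, named so that its growth can be estimated apart from words.\<close>
definition step_bound :: "nat \<Rightarrow> nat \<Rightarrow> nat \<Rightarrow> nat \<Rightarrow> nat \<Rightarrow> nat" where
  "step_bound x s y R T = x * (s + y + 1 + s * (y + 1 + R + T) + R) + T"

lemma step_bound_mono: "s \<le> s' \<Longrightarrow> R \<le> R' \<Longrightarrow> T \<le> T' \<Longrightarrow> step_bound x s y R T \<le> step_bound x s' y R' T'"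
  unfolding step_bound_def by (intro add_mono mult_mono order_refl) auto

lemma step_bound_last: "s < x \<Longrightarrow> step_bound x s 0 0 0 < 2 * x\<^sup>2"
proof -
  assume "s < x"
  then have "step_bound x s 0 0 0 \<le> step_bound x (x - 1) 0 0 0" by (intro step_bound_mono) auto
  also have "\<dots> < 2 * x\<^sup>2" using \<open>s < x\<close>
    by (cases x) (auto simp: step_bound_def power2_eq_square algebra_simps)
  finally show ?thesis .
qed

lemma step_bound_general:
  assumes "s < x" "0 < y" "T < U"
  shows "step_bound x s y (y * T) T < (x + y) ^ 3 * U"
proof -
  have "step_bound x s y (y * T) T \<le> step_bound x (x - 1) y (y * T) T"
    using assms by (intro step_bound_mono) auto
  also have "\<dots> < (x + y) ^ 3 * (T + 1)" using assms(1,2)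
    by (cases x; cases y) (auto simp: step_bound_def power3_eq_cube algebra_simps)
  also have "\<dots> \<le> (x + y) ^ 3 * U" using assms(3) by (intro mult_left_mono) auto
  finally show ?thesis .
qed

text \<open>
  For the two bottom layers together. The first estimate is for the general situation, where
  conjugating \<open>y\<close> letters costs \<open>y * T\<close>, the second for layers that centralise each other. Both
  follow from \<open>16 * x\<^sup>2 * y\<^sup>2 \<le> (x + y) ^ 4\<close>.
\<close>
lemma step_bound_next_to_last:
  assumes "s < x" "0 < y" "T < 2 * y\<^sup>2"
  shows "step_bound x s y (y * T) T < (x + y) ^ 5"
    and "step_bound x s y T T < (x + y) ^ 4"
proof -
  have s: "s \<le> x - 1" and T: "T + 1 \<le> 2 * y\<^sup>2" using assms by auto
  have "(x + y)\<^sup>2 \<ge> 4 * x * y"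
  proof -
    have "int ((x + y)\<^sup>2) = int (4 * x * y) + (int x - int y)\<^sup>2"
      by (simp add: power2_eq_square algebra_simps)
    then show ?thesis by (metis le_add_same_cancel1 of_nat_le_iff zero_le_power2)
  qed
  then have "(4 * x * y)\<^sup>2 \<le> ((x + y)\<^sup>2)\<^sup>2" by (rule power_mono) simp
  then have 4: "16 * x\<^sup>2 * y\<^sup>2 \<le> (x + y) ^ 4" by (simp add: power_mult_distrib)
  have "step_bound x s y (y * T) T \<le> step_bound x (x - 1) y (y * T) T"
    using s by (intro step_bound_mono) auto
  also have "\<dots> < x\<^sup>2 * ((y + 2) * (T + 1))" using assms(1,2)
    by (cases x; cases y) (auto simp: step_bound_def power2_eq_square algebra_simps)
  also have "\<dots> \<le> x\<^sup>2 * ((y + 2) * (2 * y\<^sup>2))" using T by (intro mult_left_mono) auto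
  also have "\<dots> = x\<^sup>2 * y\<^sup>2 * (2 * y + 4)" by (simp add: algebra_simps)
  also have "\<dots> \<le> x\<^sup>2 * y\<^sup>2 * (16 * (x + y))" using assms(1,2) by (intro mult_left_mono) auto
  also have "\<dots> = (16 * x\<^sup>2 * y\<^sup>2) * (x + y)" by (simp add: algebra_simps)
  also have "\<dots> \<le> (x + y) ^ 4 * (x + y)" using 4 by (rule mult_right_mono) simp
  also have "\<dots> = (x + y) ^ 5" by (simp add: eval_nat_numeral)
  finally show "step_bound x s y (y * T) T < (x + y) ^ 5" .
  have "step_bound x s y T T \<le> step_bound x (x - 1) y T T"
    using s by (intro step_bound_mono) auto
  also have "\<dots> < x\<^sup>2 * (y + 2 * (T + 1) + 1)" using assms(1,2)
    by (cases x; cases y) (auto simp: step_bound_def power2_eq_square algebra_simps)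
  also have "\<dots> \<le> x\<^sup>2 * (16 * y\<^sup>2)"
  proof (rule mult_left_mono)
    have "y \<le> y\<^sup>2" using assms(2) by (auto simp: power2_eq_square Suc_le_eq)
    moreover obtain z where "y\<^sup>2 = z" by blast
    ultimately show "y + 2 * (T + 1) + 1 \<le> 16 * y\<^sup>2" using T assms(2) by simp
  qed simp
  also have "\<dots> \<le> (x + y) ^ 4" using 4 by (simp add: algebra_simps)
  finally show "step_bound x s y T T < (x + y) ^ 4" .
qed

context layered_presentation
begin

definition lsize :: "nat \<Rightarrow> nat" where
  "lsize k = (p - 1) * card {i \<in> pc_gens P. \<delta> i = k}"

definition hsize :: "nat \<Rightarrow> nat" where
  "hsize k = (p - 1) * card {i \<in> pc_gens P. k < \<delta> i}"

lemma finite_gens [simp]: "finite (pc_gens P)" by (simp add: pc_gens_def)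

lemma hsize_Suc: "hsize k = lsize (Suc k) + hsize (Suc k)"
proof -
  have "{i \<in> pc_gens P. k < \<delta> i} = {i \<in> pc_gens P. \<delta> i = Suc k} \<union> {i \<in> pc_gens P. Suc k < \<delta> i}"
    by auto
  then have "card {i \<in> pc_gens P. k < \<delta> i} = card {i \<in> pc_gens P. \<delta> i = Suc k} + card {i \<in> pc_gens P. Suc k < \<delta> i}"
    by (simp only:) (rule card_Un_disjoint, auto)
  then show ?thesis by (simp add: lsize_def hsize_def distrib_left)
qed

lemma length_above: "above k h \<Longrightarrow> length h \<le> hsize k"
  unfolding hsize_def above_def by (intro length_normal) (auto simp: normal_iff)

lemma hsize_top: "\<delta> ` pc_gens P = {1..d} \<Longrightarrow> hsize d = 0"
proof -
  assume "\<delta> ` pc_gens P = {1..d}"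
  then have "\<forall>i\<in>pc_gens P. \<delta> i \<le> d" by (metis atLeastAtMost_iff imageI)
  then have "{i \<in> pc_gens P. d < \<delta> i} = {}" by force
  then show ?thesis by (simp only: hsize_def) simp
qed

lemma concat_cost_pred:
  assumes "concat_cost (Suc k) T" "conj_cost (Suc k) R"
  shows "concat_cost k (step_bound (lsize (Suc k)) (lsize (Suc k) - (p - 1)) (hsize (Suc k)) R T)"
proof -
  interpret layer_step P p \<delta> "Suc k" T R "lsize (Suc k)" "lsize (Suc k) - (p - 1)" "hsize (Suc k)"
  proof unfold_locales
    show "length h \<le> hsize (Suc k)" if "above (Suc k) h" for h
      using that by (rule length_above)
    show "length g \<le> lsize (Suc k)" if "normal_word P g" "in_layer (Suc k) g" for g
      using that unfolding lsize_def in_layer_def by (intro length_normal) auto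
    fix g a assume A: "normal_word P g" "in_layer (Suc k) g" "a \<in> pc_gens P" "\<delta> a = Suc k" "a \<notin> set g"
    then have "length g \<le> (p - 1) * card ({i \<in> pc_gens P. \<delta> i = Suc k} - {a})"
      by (intro length_normal) (auto simp: in_layer_def)
    also have "\<dots> = lsize (Suc k) - (p - 1)" using A by (simp add: lsize_def card_Diff_singleton diff_mult_distrib2)
    finally show "length g \<le> lsize (Suc k) - (p - 1)" .
  qed (fact assms)+
  show ?thesis using concat_cost_step[of k] by (simp add: step_bound_def)
qed

lemma concat_cost_top:
  assumes "\<forall>i\<in>pc_gens P. \<delta> i \<le> d"
  shows "concat_cost d 0" "conj_cost d 0"
proof -
  have "h = []" if "above d h" for h
    using above_gens[OF that] assms by (cases h) force+
  then show "concat_cost d 0" "conj_cost d 0" unfolding concat_cost_def conj_cost_def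
    by (metis above_Nil append_Nil2 concat.simps(1) le_refl list.map(1) run.stop)+
qed

lemma concat_cost_mono_step:
  assumes "concat_cost (Suc k) T" "T < hsize (Suc k) ^ q" "0 < lsize (Suc k)" "0 < hsize (Suc k)"
  shows "\<exists>T'. concat_cost k T' \<and> T' < hsize k ^ (q + 3)"
proof (intro exI conjI)
  show "concat_cost k (step_bound (lsize (Suc k)) (lsize (Suc k) - (p - 1)) (hsize (Suc k)) (hsize (Suc k) * T) T)"
    using assms(1) length_above by (intro concat_cost_pred conj_cost_general)
  have "step_bound (lsize (Suc k)) (lsize (Suc k) - (p - 1)) (hsize (Suc k)) (hsize (Suc k) * T) T
      < (lsize (Suc k) + hsize (Suc k)) ^ 3 * hsize (Suc k) ^ q"
    using assms p by (intro step_bound_general) auto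
  also have "\<dots> \<le> hsize k ^ 3 * hsize k ^ q"
    unfolding hsize_Suc[of k] by (intro mult_left_mono power_mono) auto
  finally show "step_bound (lsize (Suc k)) (lsize (Suc k) - (p - 1)) (hsize (Suc k)) (hsize (Suc k) * T) T < hsize k ^ (q + 3)"
    by (simp add: power_add mult.commute)
qed

lemma lsize_pos: "\<delta> ` pc_gens P = {1..d} \<Longrightarrow> k \<in> {1..d} \<Longrightarrow> p - 1 \<le> lsize k \<and> 0 < lsize k"
proof -
  assume "\<delta> ` pc_gens P = {1..d}" "k \<in> {1..d}"
  then obtain i where "i \<in> pc_gens P" "\<delta> i = k" by (metis imageE)
  then have "card {i \<in> pc_gens P. \<delta> i = k} > 0" by (auto simp: card_gt_0_iff)
  then show ?thesis using p by (auto simp: lsize_def)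
qed

lemma hsize_pos: "\<delta> ` pc_gens P = {1..d} \<Longrightarrow> k < d \<Longrightarrow> 0 < hsize k"
  using lsize_pos[of d "Suc k"] hsize_Suc[of k] by auto

lemma hsize_0: "\<delta> ` pc_gens P = {1..d} \<Longrightarrow> hsize 0 = (p - 1) * ngens P"
proof -
  assume "\<delta> ` pc_gens P = {1..d}"
  then have "{i \<in> pc_gens P. 0 < \<delta> i} = {1..ngens P}" by (force simp: pc_gens_def)
  then show ?thesis by (simp add: hsize_def)
qed

lemma concat_cost_down:
  assumes d: "\<delta> ` pc_gens P = {1..d}" and "concat_cost k T" "T < hsize k ^ q" "k < d"
  shows "\<exists>T. concat_cost 0 T \<and> T < hsize 0 ^ (3 * k + q)"
  using assms(2-)
proof (induction k arbitrary: T q)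
  case (Suc k)
  obtain T' where "concat_cost k T'" "T' < hsize k ^ (q + 3)"
    using concat_cost_mono_step[OF Suc.prems(1,2)] lsize_pos[OF d, of "Suc k"] hsize_pos[OF d Suc.prems(3)] Suc.prems(3)
    by auto
  then show ?case using Suc.IH[of T' "q + 3"] Suc.prems by (simp add: algebra_simps)
qed auto

lemma last_layer_cost:
  assumes d: "\<delta> ` pc_gens P = {1..Suc d}"
  shows "concat_cost d (step_bound (lsize (Suc d)) (lsize (Suc d) - (p - 1)) 0 0 0)"
proof -
  have "\<forall>i\<in>pc_gens P. \<delta> i \<le> Suc d" using d by (metis atLeastAtMost_iff imageI)
  moreover have "hsize (Suc d) = 0" using d by (rule hsize_top)
  ultimately show ?thesis using concat_cost_pred[OF concat_cost_top[of "Suc d"]] by simp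
qed

text \<open>The group of order \<open>p\<close>: only the power relation can be applied, at most once for each new letter.\<close>
lemma one_generator_cost:
  assumes "\<delta> ` pc_gens P = {1..1}" "ngens P = 1"
  shows "concat_cost 0 (p - 1)"
proof -
  have "lsize 1 = p - 1" using hsize_0[OF assms(1)] hsize_Suc[of 0] assms
      hsize_top[OF assms(1)] by simp
  then show ?thesis using last_layer_cost[of 0] assms(1) by (simp add: step_bound_def)
qed

lemma one_layer_cost:
  assumes "\<delta> ` pc_gens P = {1..1}"
  shows "\<exists>T. concat_cost 0 T \<and> T < 2 * ((p - 1) * ngens P)\<^sup>2"
proof -
  have "hsize (Suc 0) = 0" using hsize_top[OF assms(1)] by simp
  then have "lsize 1 = (p - 1) * ngens P" using hsize_0[OF assms(1)] hsize_Suc[of 0] by simp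
  moreover have "lsize 1 - (p - 1) < lsize 1" using lsize_pos[OF assms, of 1] p by auto
  ultimately show ?thesis using last_layer_cost[of 0] step_bound_last[of "lsize 1 - (p - 1)" "lsize 1"] assms by auto
qed

text \<open>
  The last two of \<open>d + 2\<close> layers are bounded together, and each layer before them contributes a
  factor of at most \<open>L\<^sup>3\<close>, where \<open>L\<close> is the greatest length of a normal word.
\<close>
lemma many_layers_cost:
  assumes d: "\<delta> ` pc_gens P = {1..d + 2}"
  shows "\<exists>T. concat_cost 0 T \<and> T < ((p - 1) * ngens P) ^ (3 * d + 5)"
    and "(\<And>a b. a \<in> pc_gens P \<Longrightarrow> b \<in> pc_gens P \<Longrightarrow> \<delta> a = d + 1 \<Longrightarrow> d + 1 < \<delta> b \<Longrightarrow> rhs P a b = [b])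
      \<Longrightarrow> \<exists>T. concat_cost 0 T \<and> T < ((p - 1) * ngens P) ^ (3 * d + 4)"
proof -
  let ?x = "lsize (Suc d)" and ?y = "lsize (Suc (Suc d))"
  let ?s = "?x - (p - 1)"
  define T where "T = step_bound ?y (?y - (p - 1)) 0 0 0"
  have pos: "0 < ?x" "0 < ?y" "?s < ?x"
    using lsize_pos[OF d, of "Suc d"] lsize_pos[OF d, of "Suc (Suc d)"] p by auto
  have T: "concat_cost (Suc d) T" "T < 2 * ?y\<^sup>2"
    using last_layer_cost[of "Suc d"] d step_bound_last[of "?y - (p - 1)" ?y] pos(2) p by (simp_all add: T_def)
  have "hsize (Suc (Suc d)) = 0" using hsize_top[OF d] by simp
  then have y: "hsize (Suc d) = ?y" and h: "hsize d = ?x + ?y" 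
    using hsize_Suc[of "Suc d"] hsize_Suc[of d] by auto
  have len: "length h \<le> ?y" if "above (Suc d) h" for h
    using length_above[OF that] y by simp
  have "concat_cost d (step_bound ?x ?s ?y (?y * T) T)"
    using concat_cost_pred[OF T(1) conj_cost_general[OF T(1) len]] by (simp add: y)
  from concat_cost_down[OF d this, of 5]
  show "\<exists>T. concat_cost 0 T \<and> T < ((p - 1) * ngens P) ^ (3 * d + 5)"
    using step_bound_next_to_last(1)[OF pos(3,2) T(2)] hsize_0[OF d] by (simp add: h)
  assume "\<And>a b. a \<in> pc_gens P \<Longrightarrow> b \<in> pc_gens P \<Longrightarrow> \<delta> a = d + 1 \<Longrightarrow> d + 1 < \<delta> b \<Longrightarrow> rhs P a b = [b]"
  then have "concat_cost d (step_bound ?x ?s ?y T T)"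
    using concat_cost_pred[OF T(1) conj_cost_commuting[OF T(1)]] by (simp add: y)
  from concat_cost_down[OF d this, of 4]
  show "\<exists>T. concat_cost 0 T \<and> T < ((p - 1) * ngens P) ^ (3 * d + 4)"
    using step_bound_next_to_last(2)[OF pos(3,2) T(2)] hsize_0[OF d] by (simp add: h)
qed

lemma concat_cost_collects:
  assumes "concat_cost 0 T" "\<forall>i\<in>pc_gens P. 0 < \<delta> i" "normal_word P u" "normal_word P w" "real T \<le> B"
  shows "collects_left_within P (u @ w) B"
proof -
  have "above 0 u" "above 0 w" using assms by (auto simp: above_def normal_iff)
  then obtain h n where h: "above 0 h" "n \<le> T" "run P u w n h []"
    using concat_costD[OF assms(1), of "[]" u w] by (auto simp: up_to_def)
  have "(collect_left P ^^ n) (u @ w) h"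
    using run_collect_left[OF h(3) assms(3)] p expo by auto
  then show ?thesis using h assms(5) unfolding collects_left_within_def above_def
    by (meson of_nat_mono order_trans)
qed

end

section \<open>Commutators and the lower central series\<close>

context group
begin

lemma cancel_inv:
  "x \<in> carrier G \<Longrightarrow> y \<in> carrier G \<Longrightarrow> inv x \<otimes> (x \<otimes> y) = y"
  "x \<in> carrier G \<Longrightarrow> y \<in> carrier G \<Longrightarrow> x \<otimes> (inv x \<otimes> y) = y"
  by (simp_all add: m_assoc[symmetric])

text \<open>
  The commutator \<open>[g, z\<^sup>-\<^sup>1]\<close>, chosen so that conjugation by \<open>g\<close> multiplies \<open>z\<close> by \<open>cm z g\<close> on
  the left.
\<close>
definition cm :: "'a \<Rightarrow> 'a \<Rightarrow> 'a" where
  "cm z g = inv g \<otimes> z \<otimes> g \<otimes> inv z"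

lemma cm_closed [simp]: "z \<in> carrier G \<Longrightarrow> g \<in> carrier G \<Longrightarrow> cm z g \<in> carrier G"
  by (simp add: cm_def)

lemma conj_eq_cm: "z \<in> carrier G \<Longrightarrow> g \<in> carrier G \<Longrightarrow> inv g \<otimes> z \<otimes> g = cm z g \<otimes> z"
  by (simp add: cm_def m_assoc)

lemma conj_cm:
  assumes "h \<in> carrier G" "z \<in> carrier G" "g \<in> carrier G"
  shows "h \<otimes> cm z g \<otimes> inv h = cm (h \<otimes> z \<otimes> inv h) (h \<otimes> g \<otimes> inv h)"
  using assms by (simp add: cm_def m_assoc inv_mult_group cancel_inv)

lemma cm_eq_one: "z \<in> carrier G \<Longrightarrow> g \<in> carrier G \<Longrightarrow> cm z g = \<one> \<longleftrightarrow> z \<otimes> g = g \<otimes> z"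
  unfolding cm_def
  by (metis (no_types, opaque_lifting) cancel_inv(1) inv_closed inv_equality inv_inv m_assoc m_closed r_inv)

lemma commutes_inv:
  assumes "a \<in> carrier G" "b \<in> carrier G" "a \<otimes> b = b \<otimes> a"
  shows "a \<otimes> inv b = inv b \<otimes> a"
  using assms by (metis cancel_inv(1) inv_closed m_assoc m_closed r_inv r_one)

lemma commutes_mult:
  assumes "a \<in> carrier G" "b \<in> carrier G" "c \<in> carrier G" "a \<otimes> b = b \<otimes> a" "a \<otimes> c = c \<otimes> a"
  shows "a \<otimes> (b \<otimes> c) = (b \<otimes> c) \<otimes> a"
  using assms by (metis m_assoc)

text \<open>
  This plays the part of the three subgroups lemma. Conjugation by \<open>g\<close> fixes \<open>cm x z\<close>; on the other
  hand it maps \<open>x\<close> to \<open>k \<otimes> x\<close> with \<open>k = cm x g\<close> and \<open>z\<close> to \<open>zg\<close>, and as \<open>k\<close> commutes with \<open>zg\<close> and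
  with \<open>cm x zg\<close>, it maps \<open>cm x z\<close> to \<open>cm x zg\<close>. Thus \<open>z\<close> and \<open>zg\<close> conjugate \<open>x\<close> to the same element,
  so their quotient \<open>cm z g\<close> centralises \<open>x\<close>.
\<close>
lemma commutes_conj:
  assumes [simp]: "x \<in> carrier G" "g \<in> carrier G" "z \<in> carrier G"
    and 1: "cm (cm x g) (inv g \<otimes> z \<otimes> g) = \<one>"
    and 2: "cm (cm x z) g = \<one>"
    and 3: "cm (cm x (inv g \<otimes> z \<otimes> g)) (cm x g) = \<one>"
  shows "x \<otimes> cm z g = cm z g \<otimes> x"
proof -
  define zg where "zg = inv g \<otimes> z \<otimes> g"
  define k where "k = cm x g"
  have [simp]: "zg \<in> carrier G" "k \<in> carrier G" by (simp_all add: zg_def k_def)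
  have kzg: "inv zg \<otimes> k = k \<otimes> inv zg"
    using 1 cm_eq_one[of k zg] commutes_inv[of k zg] by (simp add: zg_def[symmetric] k_def[symmetric])
  have gxg: "inv g \<otimes> x \<otimes> g = k \<otimes> x" by (simp add: k_def conj_eq_cm)
  have "cm x z = inv g \<otimes> cm x z \<otimes> g"
    using 2 cm_eq_one[of "cm x z" g] by (simp add: m_assoc cancel_inv)
  also have "\<dots> = cm (inv g \<otimes> x \<otimes> g) zg"
    using conj_cm[of "inv g" x z] by (simp add: zg_def)
  also have "\<dots> = inv zg \<otimes> k \<otimes> x \<otimes> zg \<otimes> inv x \<otimes> inv k"
    by (simp add: gxg) (simp add: cm_def m_assoc inv_mult_group)
  also have "\<dots> = k \<otimes> cm x zg \<otimes> inv k"
    by (simp add: kzg cm_def m_assoc)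
  also have "\<dots> = cm x zg"
    using 3 cm_eq_one[of "cm x zg" k] by (simp add: zg_def[symmetric] k_def[symmetric])
      (metis m_assoc cm_closed inv_closed \<open>k \<in> carrier G\<close> \<open>zg \<in> carrier G\<close> assms(1) r_inv r_one)
  finally have "inv z \<otimes> x \<otimes> z = inv zg \<otimes> x \<otimes> zg"
    by (simp add: cm_def)
  then have "zg \<otimes> (inv z \<otimes> x \<otimes> z) \<otimes> inv z = zg \<otimes> (inv zg \<otimes> x \<otimes> zg) \<otimes> inv z" by simp
  then have "zg \<otimes> inv z \<otimes> x = x \<otimes> zg \<otimes> inv z"
    by (simp add: m_assoc cancel_inv)
  moreover have "cm z g = zg \<otimes> inv z" by (simp add: cm_def zg_def)
  ultimately show ?thesis by (simp add: m_assoc)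
qed

text \<open>The indices start at \<open>0\<close>: \<open>lcs k\<close> is \<open>\<gamma>\<^sub>k\<^sub>+\<^sub>1\<close> in the usual notation.\<close>
primrec lcs :: "nat \<Rightarrow> 'a set" where
  "lcs 0 = carrier G"
| "lcs (Suc k) = generate G {cm z g | z g. z \<in> lcs k \<and> g \<in> carrier G}"

declare lcs.simps(2) [simp del]

lemma lcs_normal: "lcs k \<lhd> G"
proof (induction k)
  case 0
  show ?case by (simp add: normal_invI subgroup_self)
next
  case (Suc k)
  interpret N: normal "lcs k" G by fact
  show ?case unfolding lcs.simps(2)
  proof (rule normal_generateI)
    fix h g assume "h \<in> {cm z g | z g. z \<in> lcs k \<and> g \<in> carrier G}" and g: "g \<in> carrier G"
    then obtain z a where "z \<in> lcs k" "a \<in> carrier G" "h = cm z a" by blast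
    then have "g \<otimes> h \<otimes> inv g = cm (g \<otimes> z \<otimes> inv g) (g \<otimes> a \<otimes> inv g)"
      using conj_cm g N.mem_carrier by blast
    moreover have "g \<otimes> z \<otimes> inv g \<in> lcs k" using N.inv_op_closed2 g \<open>z \<in> lcs k\<close> by blast
    moreover have "g \<otimes> a \<otimes> inv g \<in> carrier G" using g \<open>a \<in> carrier G\<close> by blast
    ultimately show "g \<otimes> h \<otimes> inv g \<in> {cm z g | z g. z \<in> lcs k \<and> g \<in> carrier G}"
      by blast
  qed (use N.mem_carrier in auto)
qed

lemma lcs_subset: "lcs k \<subseteq> carrier G"
  using lcs_normal normal_imp_subgroup subgroup.subset by blast

lemma lcs_closed: "x \<in> lcs k \<Longrightarrow> x \<in> carrier G"
  using lcs_subset by blast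

lemma cm_mem_lcs_Suc: "z \<in> lcs k \<Longrightarrow> g \<in> carrier G \<Longrightarrow> cm z g \<in> lcs (Suc k)"
  by (auto simp: lcs.simps(2) intro: generate.incl)

lemma cm_mem_normal:
  assumes "N \<lhd> G" "z \<in> N" "g \<in> carrier G"
  shows "cm z g \<in> N"
proof -
  interpret N: normal N G by fact
  show ?thesis unfolding cm_def
    using N.inv_op_closed1[OF assms(3,2)] N.m_inv_closed[OF assms(2)] by (rule N.m_closed)
qed

lemma lcs_Suc_subset: "lcs (Suc k) \<subseteq> lcs k"
  unfolding lcs.simps(2)
  by (rule generate_subgroup_incl) (use cm_mem_normal lcs_normal normal_imp_subgroup in blast)+

lemma lcs_antimono: "j \<le> k \<Longrightarrow> lcs k \<subseteq> lcs j"
  by (rule lift_Suc_antimono_le[of lcs, OF lcs_Suc_subset])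

end

lemma (in normal) quotient_hom: "group_hom G (G Mod H) (\<lambda>a. H #> a)"
  by (intro group_hom.intro group_hom_axioms.intro is_group factorgroup_is_group r_coset_hom_Mod)

lemma (in group_hom) hom_cm: "x \<in> carrier G \<Longrightarrow> y \<in> carrier G \<Longrightarrow> h (G.cm x y) = H.cm (h x) (h y)"
  by (simp add: G.cm_def H.cm_def)

lemma (in normal) coset_eq_one: "x \<in> carrier G \<Longrightarrow> H #> x = \<one>\<^bsub>G Mod H\<^esub> \<longleftrightarrow> x \<in> H"
  unfolding one_FactGroup
  using coset_join1[OF _ _ subgroup_axioms] coset_join2[OF _ subgroup_axioms] by blast

context group
begin

text \<open>
  Because of the shifted indices this says \<open>[\<gamma>\<^sub>i, \<gamma>\<^sub>j] \<subseteq> \<gamma>\<^sub>i\<^sub>+\<^sub>j\<close>. It is proved by induction on \<open>j\<close>.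
  Modulo the target subgroup, the induction hypothesis provides the premises of \<open>commutes_conj\<close> for
  each generator of \<open>\<gamma>\<^sub>j\<^sub>+\<^sub>1\<close>.
\<close>
lemma cm_lcs: "x \<in> lcs i \<Longrightarrow> y \<in> lcs j \<Longrightarrow> cm x y \<in> lcs (Suc (i + j))"
proof (induction j arbitrary: i x y)
  case 0
  then show ?case using cm_mem_lcs_Suc by simp
next
  case (Suc j)
  let ?M = "lcs (Suc (i + Suc j))"
  interpret M: normal ?M G by (rule lcs_normal)
  interpret q: group_hom G "G Mod ?M" "\<lambda>a. ?M #> a" by (rule M.quotient_hom)
  let ?\<pi> = "\<lambda>a. ?M #> a"
  have one: "q.H.cm (?\<pi> a) (?\<pi> b) = \<one>\<^bsub>G Mod ?M\<^esub> \<longleftrightarrow> cm a b \<in> ?M" if "a \<in> carrier G" "b \<in> carrier G" for a b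
    unfolding q.hom_cm[OF that, symmetric] by (rule M.coset_eq_one) (use that in simp)
  have x: "x \<in> carrier G" using Suc.prems(1) by (rule lcs_closed)
  have *: "?\<pi> x \<otimes>\<^bsub>G Mod ?M\<^esub> ?\<pi> (cm z g) = ?\<pi> (cm z g) \<otimes>\<^bsub>G Mod ?M\<^esub> ?\<pi> x"
    if z: "z \<in> lcs j" and g: "g \<in> carrier G" for z g
  proof -
    have zc: "z \<in> carrier G" using z by (rule lcs_closed)
    have zg: "inv g \<otimes> z \<otimes> g \<in> lcs j"
      using normal.inv_op_closed1[OF lcs_normal g z] .
    have zgc: "inv g \<otimes> z \<otimes> g \<in> carrier G" using zc g by simp
    have k: "cm x g \<in> lcs (Suc i)" using Suc.prems g cm_mem_lcs_Suc by blast
    have 1: "cm (cm x g) (inv g \<otimes> z \<otimes> g) \<in> ?M" using Suc.IH[OF k zg] by simp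
    have 2: "cm (cm x z) g \<in> ?M" using cm_mem_lcs_Suc[OF Suc.IH[OF Suc.prems(1) z] g] by simp
    have 3: "cm (cm x (inv g \<otimes> z \<otimes> g)) (cm x g) \<in> ?M"
      using cm_mem_lcs_Suc[OF Suc.IH[OF Suc.prems(1) zg], of "cm x g"] x g by simp
    have pizg: "?\<pi> (inv g \<otimes> z \<otimes> g) = inv\<^bsub>G Mod ?M\<^esub> ?\<pi> g \<otimes>\<^bsub>G Mod ?M\<^esub> ?\<pi> z \<otimes>\<^bsub>G Mod ?M\<^esub> ?\<pi> g"
      unfolding q.hom_mult[OF m_closed[OF inv_closed[OF g] zc] g] q.hom_mult[OF inv_closed[OF g] zc] q.hom_inv[OF g] ..
    show ?thesis unfolding q.hom_cm[OF zc g]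
    proof (rule q.H.commutes_conj)
      show "?\<pi> x \<in> carrier (G Mod ?M)" "?\<pi> g \<in> carrier (G Mod ?M)" "?\<pi> z \<in> carrier (G Mod ?M)"
        using x g zc by (blast intro: q.hom_closed)+
      show "q.H.cm (q.H.cm (?\<pi> x) (?\<pi> g)) (inv\<^bsub>G Mod ?M\<^esub> ?\<pi> g \<otimes>\<^bsub>G Mod ?M\<^esub> ?\<pi> z \<otimes>\<^bsub>G Mod ?M\<^esub> ?\<pi> g)
          = \<one>\<^bsub>G Mod ?M\<^esub>"
        unfolding pizg[symmetric] q.hom_cm[OF x g, symmetric]
        using one[OF cm_closed[OF x g] zgc] 1 by (rule iffD2)
      show "q.H.cm (q.H.cm (?\<pi> x) (?\<pi> z)) (?\<pi> g) = \<one>\<^bsub>G Mod ?M\<^esub>"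
        unfolding q.hom_cm[OF x zc, symmetric]
        using one[OF cm_closed[OF x zc] g] 2 by (rule iffD2)
      show "q.H.cm (q.H.cm (?\<pi> x) (inv\<^bsub>G Mod ?M\<^esub> ?\<pi> g \<otimes>\<^bsub>G Mod ?M\<^esub> ?\<pi> z \<otimes>\<^bsub>G Mod ?M\<^esub> ?\<pi> g))
          (q.H.cm (?\<pi> x) (?\<pi> g)) = \<one>\<^bsub>G Mod ?M\<^esub>"
        unfolding pizg[symmetric] q.hom_cm[OF x g, symmetric] q.hom_cm[OF x zgc, symmetric]
        using one[OF cm_closed[OF x zgc] cm_closed[OF x g]] 3 by (rule iffD2)
    qed
  qed
  have "?\<pi> x \<otimes>\<^bsub>G Mod ?M\<^esub> ?\<pi> y = ?\<pi> y \<otimes>\<^bsub>G Mod ?M\<^esub> ?\<pi> x"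
  proof -
    let ?C = "{c \<in> carrier G. ?\<pi> x \<otimes>\<^bsub>G Mod ?M\<^esub> ?\<pi> c = ?\<pi> c \<otimes>\<^bsub>G Mod ?M\<^esub> ?\<pi> x}"
    have px: "?\<pi> x \<in> carrier (G Mod ?M)" using x by (rule q.hom_closed)
    have "subgroup ?C G"
    proof (rule subgroupI)
      show "?C \<noteq> {}" using q.H.l_one[OF px] q.H.r_one[OF px] q.hom_one by (force simp only:)
    next
      fix a assume "a \<in> ?C"
      then have a: "a \<in> carrier G" "?\<pi> x \<otimes>\<^bsub>G Mod ?M\<^esub> ?\<pi> a = ?\<pi> a \<otimes>\<^bsub>G Mod ?M\<^esub> ?\<pi> x" by auto
      then show "inv a \<in> ?C"
        using q.H.commutes_inv[OF px q.hom_closed[OF a(1)] a(2)] by (simp only: mem_Collect_eq q.hom_inv inv_closed)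
    next
      fix a b assume "a \<in> ?C" "b \<in> ?C"
      then have a: "a \<in> carrier G" "?\<pi> x \<otimes>\<^bsub>G Mod ?M\<^esub> ?\<pi> a = ?\<pi> a \<otimes>\<^bsub>G Mod ?M\<^esub> ?\<pi> x"
        and b: "b \<in> carrier G" "?\<pi> x \<otimes>\<^bsub>G Mod ?M\<^esub> ?\<pi> b = ?\<pi> b \<otimes>\<^bsub>G Mod ?M\<^esub> ?\<pi> x" by auto
      show "a \<otimes> b \<in> ?C"
        using q.H.commutes_mult[OF px q.hom_closed[OF a(1)] q.hom_closed[OF b(1)] a(2) b(2)] a(1) b(1)
        by (simp only: mem_Collect_eq q.hom_mult m_closed)
    qed auto
    then have "generate G {cm z g | z g. z \<in> lcs j \<and> g \<in> carrier G} \<subseteq> ?C"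
    proof (rule generate_subgroup_incl[rotated], intro subsetI)
      fix c assume "c \<in> {cm z g | z g. z \<in> lcs j \<and> g \<in> carrier G}"
      then obtain z g where "z \<in> lcs j" "g \<in> carrier G" "c = cm z g" by blast
      then show "c \<in> ?C" using *[of z g] cm_closed[OF lcs_closed] by (simp only: mem_Collect_eq)
    qed
    then show ?thesis using Suc.prems(2) unfolding lcs.simps(2) by blast
  qed
  then have "q.H.cm (?\<pi> x) (?\<pi> y) = \<one>\<^bsub>G Mod ?M\<^esub>"
    using q.H.cm_eq_one[OF q.hom_closed[OF x] q.hom_closed[OF lcs_closed[OF Suc.prems(2)]]] by blast
  then show ?case using one[OF x lcs_closed[OF Suc.prems(2)]] by blast
qed

section \<open>Nilpotency of finite p-groups\<close>

text \<open>
  The class equation: without central elements other than \<open>\<one>\<close>, all conjugacy classes but that of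
  \<open>\<one>\<close> would have a size divisible by \<open>p\<close>.
\<close>
lemma p_group_nontrivial_centre:
  assumes "finite (carrier G)" "prime p" "order G = p ^ n" "0 < n"
  shows "\<exists>x\<in>carrier G. x \<noteq> \<one> \<and> (\<forall>g\<in>carrier G. x \<otimes> g = g \<otimes> x)"
proof (rule ccontr)
  assume no: "\<not> ?thesis"
  define \<phi> where "\<phi> = (\<lambda>g. \<lambda>h\<in>carrier G. g \<otimes> h \<otimes> inv g)"
  interpret a: group_action G "carrier G" \<phi>
    unfolding \<phi>_def by (rule action_by_conjugation)
  have orb1: "orbit G \<phi> \<one> = {\<one>}"
    by (auto simp: orbit_def \<phi>_def intro!: exI[of _ \<one>])
  have orb: "p dvd card (orbit G \<phi> x)" if x: "x \<in> carrier G" "x \<noteq> \<one>" for x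
  proof -
    obtain g where g: "g \<in> carrier G" "x \<otimes> g \<noteq> g \<otimes> x" using no x by blast
    have "card (orbit G \<phi> x) dvd p ^ n"
      using a.orbit_stabilizer_theorem[OF x(1)] assms(3) by (metis dvd_triv_left)
    then obtain k where k: "card (orbit G \<phi> x) = p ^ k" using assms(2) by (metis divides_primepow_nat)
    have "card (orbit G \<phi> x) \<noteq> 1"
    proof
      assume "card (orbit G \<phi> x) = 1"
      then obtain y where y: "orbit G \<phi> x = {y}" by (metis card_1_singletonE)
      have "\<phi> g x \<in> orbit G \<phi> x" "\<phi> \<one> x \<in> orbit G \<phi> x" using g by (auto simp: orbit_def)
      then have "g \<otimes> x \<otimes> inv g = x" using y x g by (simp add: \<phi>_def)
      then have "g \<otimes> x = x \<otimes> g" using x g by (metis inv_closed inv_inv inv_solve_right m_closed)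
      then show False using g by simp
    qed
    then show ?thesis using k by (cases k) auto
  qed
  have "{\<one>} \<in> orbits G (carrier G) \<phi>" using orb1 by (auto simp: orbits_def)
  have fin: "finite (orbits G (carrier G) \<phi>)" using assms(1) by (simp add: orbits_def)
  have "p ^ n = (\<Sum>x\<in>carrier G. 1)" using assms(3) by (simp add: order_def)
  also have "\<dots> = (\<Sum>orb\<in>orbits G (carrier G) \<phi>. \<Sum>x\<in>orb. 1)"
    by (rule a.disjoint_sum[OF assms(1), symmetric])
  also have "\<dots> = (\<Sum>orb\<in>orbits G (carrier G) \<phi>. card orb)" by simp
  also have "\<dots> = card {\<one>} + (\<Sum>orb\<in>orbits G (carrier G) \<phi> - {{\<one>}}. card orb)"
    using sum.remove[OF fin \<open>{\<one>} \<in> orbits G (carrier G) \<phi>\<close>, of card] .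
  finally have eq: "p ^ n = 1 + (\<Sum>orb\<in>orbits G (carrier G) \<phi> - {{\<one>}}. card orb)" by simp
  have "p dvd (\<Sum>orb\<in>orbits G (carrier G) \<phi> - {{\<one>}}. card orb)"
  proof (rule dvd_sum)
    fix b assume b: "b \<in> orbits G (carrier G) \<phi> - {{\<one>}}"
    then obtain x where x: "x \<in> carrier G" "b = orbit G \<phi> x" by (auto simp: orbits_def)
    then have "x \<noteq> \<one>" using b orb1 by auto
    then show "p dvd card b" using orb x by simp
  qed
  moreover have "p dvd p ^ n" using assms(4) by simp
  ultimately have "p dvd 1" unfolding eq by (metis dvd_add_left_iff)
  then show False using assms(2) by auto
qed

lemma p_group_subgroup_order:
  assumes "finite (carrier G)" "prime p" "order G = p ^ n" "subgroup H G"
  shows "\<exists>k\<le>n. card H = p ^ k"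
  using lagrange[OF assms(4)] assms(2,3) by (metis divides_primepow_nat dvd_triv_right)

lemma p_group_central_extension:
  assumes "finite (carrier G)" "prime p" "order G = p ^ n" "N \<lhd> G" "N \<noteq> carrier G"
  shows "\<exists>x\<in>carrier G - N. \<forall>g\<in>carrier G. cm x g \<in> N"
proof -
  interpret N: normal N G by fact
  interpret q: group_hom G "G Mod N" "\<lambda>a. N #> a" by (rule N.quotient_hom)
  have l: "card (rcosets N) * card N = p ^ n" using lagrange[OF N.subgroup_axioms] assms(3) by simp
  then obtain k where k: "card (rcosets N) = p ^ k"
    using assms(2) by (metis divides_primepow_nat dvd_triv_left)
  have "card N < p ^ n"
    using assms(1,3,5) N.subset by (metis order_def psubsetI psubset_card_mono)
  then have "k \<noteq> 0" using l k by (cases k) auto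
  moreover have "order (G Mod N) = p ^ k" using k by (simp add: order_def FactGroup_def)
  moreover have "finite (carrier (G Mod N))" using assms(1) by (simp add: carrier_FactGroup)
  ultimately obtain X where X: "X \<in> carrier (G Mod N)" "X \<noteq> \<one>\<^bsub>G Mod N\<^esub>"
      "\<forall>Y\<in>carrier (G Mod N). X \<otimes>\<^bsub>G Mod N\<^esub> Y = Y \<otimes>\<^bsub>G Mod N\<^esub> X"
    using q.H.p_group_nontrivial_centre[OF _ assms(2)] by blast
  then obtain x where x: "x \<in> carrier G" "X = N #> x" by (auto simp: carrier_FactGroup)
  have "cm x g \<in> N" if g: "g \<in> carrier G" for g
  proof -
    have "q.H.cm (N #> x) (N #> g) = \<one>\<^bsub>G Mod N\<^esub>"
      using q.H.cm_eq_one[OF q.hom_closed[OF x(1)] q.hom_closed[OF g]] X(3) x q.hom_closed[OF g] by blast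
    then show ?thesis using q.hom_cm[OF x(1) g] N.coset_eq_one[OF cm_closed[OF x(1) g]] by simp
  qed
  moreover have "x \<notin> N" using X(2) x N.coset_eq_one by blast
  ultimately show ?thesis using x by blast
qed

text \<open>
  The upper central series grows by a factor of at least \<open>p\<close> until it reaches the whole group. As
  the lower central series descends at least as fast, \<open>lcs n\<close> is trivial.
\<close>
primrec ucs :: "nat \<Rightarrow> 'a set" where
  "ucs 0 = {\<one>}"
| "ucs (Suc k) = {x \<in> carrier G. \<forall>g\<in>carrier G. cm x g \<in> ucs k}"

declare ucs.simps(2) [simp del]

lemma central_mod_normal:
  assumes "N \<lhd> G"
  shows "{x \<in> carrier G. \<forall>g\<in>carrier G. cm x g \<in> N} \<lhd> G" (is "?Z \<lhd> G")
proof -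
  interpret N: normal N G by fact
  have sub: "subgroup ?Z G"
  proof (rule subgroupI)
    show "?Z \<noteq> {}" by (auto simp: cm_def intro!: exI[of _ \<one>])
  next
    fix a assume "a \<in> ?Z"
    then have a: "a \<in> carrier G" "\<And>g. g \<in> carrier G \<Longrightarrow> cm a g \<in> N" by auto
    have "cm (inv a) g \<in> N" if g: "g \<in> carrier G" for g
    proof -
      have "cm (inv a) g = inv a \<otimes> inv (cm a g) \<otimes> inv (inv a)"
        using a(1) g by (simp add: cm_def m_assoc inv_mult_group cancel_inv)
      then show ?thesis
        using N.inv_op_closed2[OF inv_closed[OF a(1)] N.m_inv_closed[OF a(2)[OF g]]] by simp
    qed
    then show "inv a \<in> ?Z" using a by simp
  next
    fix a b assume "a \<in> ?Z" "b \<in> ?Z"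
    then have a: "a \<in> carrier G" "\<And>g. g \<in> carrier G \<Longrightarrow> cm a g \<in> N"
      and b: "b \<in> carrier G" "\<And>g. g \<in> carrier G \<Longrightarrow> cm b g \<in> N" by auto
    have "cm (a \<otimes> b) g \<in> N" if g: "g \<in> carrier G" for g
    proof -
      have "cm (a \<otimes> b) g = cm a g \<otimes> (a \<otimes> cm b g \<otimes> inv a)"
        using a(1) b(1) g by (simp add: cm_def m_assoc inv_mult_group cancel_inv)
      then show ?thesis
        using N.m_closed[OF a(2)[OF g] N.inv_op_closed2[OF a(1) b(2)[OF g]]] by simp
    qed
    then show "a \<otimes> b \<in> ?Z" using a b by simp
  qed auto
  show ?thesis
  proof (rule normal_invI[OF sub])
    fix h x assume h: "h \<in> carrier G" and "x \<in> ?Z"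
    then have x: "x \<in> carrier G" "\<And>g. g \<in> carrier G \<Longrightarrow> cm x g \<in> N" by auto
    have "cm (h \<otimes> x \<otimes> inv h) g \<in> N" if g: "g \<in> carrier G" for g
    proof -
      have "cm (h \<otimes> x \<otimes> inv h) g = h \<otimes> cm x (inv h \<otimes> g \<otimes> h) \<otimes> inv h"
        using h x g by (subst conj_cm) (simp_all add: m_assoc cancel_inv)
      then show ?thesis using N.inv_op_closed2[OF h x(2)] h g by simp
    qed
    then show "h \<otimes> x \<otimes> inv h \<in> ?Z" using h x by simp
  qed
qed

lemma ucs_normal: "ucs k \<lhd> G"
proof (induction k)
  case 0
  show ?case unfolding ucs.simps(1) by (rule normal_invI[OF triv_subgroup]) auto
qed (simp add: central_mod_normal ucs.simps(2))

lemma p_group_ucs: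
  assumes "finite (carrier G)" "prime p" "order G = p ^ n"
  shows "ucs n = carrier G"
proof -
  have "ucs k = carrier G \<or> p ^ k \<le> card (ucs k)" for k
  proof (induction k)
    case (Suc k)
    show ?case
    proof (cases "ucs k = carrier G")
      case True
      have "ucs (Suc k) = carrier G" unfolding ucs.simps(2) True using cm_closed by blast
      then show ?thesis ..
    next
      case False
      interpret N: normal "ucs k" G by (rule ucs_normal)
      have sub: "ucs k \<subseteq> ucs (Suc k)" unfolding ucs.simps(2) using cm_mem_normal[OF ucs_normal] N.subset by blast
      have "ucs k \<noteq> ucs (Suc k)" unfolding ucs.simps(2) using p_group_central_extension[OF assms ucs_normal False] by blast
      then have "card (ucs k) < card (ucs (Suc k))"
        using sub finite_subset[OF subgroup.subset[OF normal_imp_subgroup[OF ucs_normal]] assms(1)]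
        by (intro psubset_card_mono) auto
      moreover obtain i where i: "card (ucs k) = p ^ i"
        using p_group_subgroup_order[OF assms normal_imp_subgroup[OF ucs_normal]] by blast
      moreover obtain j where j: "card (ucs (Suc k)) = p ^ j"
        using p_group_subgroup_order[OF assms normal_imp_subgroup[OF ucs_normal]] by blast
      ultimately have "i < j" using prime_gt_1_nat[OF assms(2)] by simp
      moreover have "k \<le> i" using Suc.IH False i prime_gt_1_nat[OF assms(2)] by simp
      ultimately have "p ^ Suc k \<le> p ^ j"
        using prime_gt_0_nat[OF assms(2)] by (intro power_increasing) auto
      then show ?thesis using j by simp
    qed
  qed auto
  from this[of n] show ?thesis
    using card_seteq[OF assms(1) normal.axioms(1)[OF ucs_normal[of n], THEN subgroup.subset]] assms(3)
    by (auto simp: order_def)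
qed

lemma lcs_p_group:
  assumes "finite (carrier G)" "prime p" "order G = p ^ n"
  shows "lcs n = {\<one>}"
proof -
  have "lcs k \<subseteq> ucs (n - k)" if "k \<le> n" for k
    using that
  proof (induction k)
    case (Suc k)
    then have "lcs k \<subseteq> ucs (Suc (n - Suc k))" by (simp add: Suc_diff_Suc)
    then show ?case unfolding lcs.simps(2)
      by (intro generate_subgroup_incl normal_imp_subgroup[OF ucs_normal]) (auto simp: ucs.simps(2))
  qed (simp add: p_group_ucs[OF assms])
  from this[of n] show ?thesis
    using subgroup.one_closed[OF normal_imp_subgroup[OF lcs_normal, of n]] by auto
qed

lemma lcs_strict:
  assumes "lcs n = {\<one>}" "lcs k \<noteq> {\<one>}"
  shows "lcs (Suc k) \<noteq> lcs k"
proof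
  assume eq: "lcs (Suc k) = lcs k"
  have "lcs (k + j) = lcs k" for j
    by (induction j) (use eq in \<open>auto simp: lcs.simps(2)\<close>)
  then have "lcs (k + n) = lcs k" .
  moreover have "lcs (k + n) \<subseteq> lcs n" by (rule lcs_antimono) simp
  ultimately show False
    using assms subgroup.one_closed[OF normal_imp_subgroup[OF lcs_normal, of k]] by auto
qed

end

section \<open>Bases of finite abelian p-groups\<close>

text \<open>
  The elements \<open>b\<^sub>1\<^sup>i \<otimes> b\<^sub>2\<^sup>j \<otimes> \<dots> \<otimes> s\<close> with \<open>s\<close> in \<open>S\<close>, where the exponent of a
  generator paired with \<open>f\<close> is less than \<open>p ^ f\<close>.
\<close>
primrec (in monoid) mixed_span :: "nat \<Rightarrow> ('a \<times> nat) list \<Rightarrow> 'a set \<Rightarrow> 'a set" where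
  "mixed_span p [] S = S"
| "mixed_span p (bf # bs) S = {fst bf [^] i \<otimes> y | i y. i < p ^ snd bf \<and> y \<in> mixed_span p bs S}"

context comm_group
begin

lemma pow_mem_subgroup_iff_dvd:
  assumes "finite (carrier G)" "prime p" "order G = p ^ n" "subgroup N G" "x \<in> carrier G"
  shows "\<exists>f. \<forall>m::nat. x [^] m \<in> N \<longleftrightarrow> p ^ f dvd m"
proof -
  interpret N: normal N G using assms(4) by (simp add: normal_iff_subgroup)
  interpret q: group_hom G "G Mod N" "\<lambda>a. N #> a" by (rule N.quotient_hom)
  have *: "x [^] m \<in> N \<longleftrightarrow> q.H.ord (N #> x) dvd m" for m :: nat
    using N.coset_eq_one[of "x [^] m"] q.H.pow_eq_id[of "N #> x" m] assms(5)
      N.FactGroup_pow[of x m] q.hom_closed[OF assms(5)] by auto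
  have "x [^] (p ^ n) \<in> N"
    using pow_order_eq_1[OF assms(5)] assms(3) N.one_closed by simp
  then have "q.H.ord (N #> x) dvd p ^ n" using * by blast
  then obtain f where "q.H.ord (N #> x) = p ^ f" using assms(2) by (metis divides_primepow_nat)
  then show ?thesis using * by auto
qed

lemma mixed_span_append: "mixed_span p (bs @ cs) S = mixed_span p bs (mixed_span p cs S)"
  by (induction bs) auto

lemma mixed_span_closed:
  assumes "\<forall>bf\<in>set bs. fst bf \<in> carrier G" "S \<subseteq> carrier G"
  shows "mixed_span p bs S \<subseteq> carrier G"
  using assms by (induction bs) auto

lemma mixed_span_mult:
  assumes "\<forall>bf\<in>set bs. fst bf \<in> carrier G" "subgroup S G" "s \<in> S" "x \<in> mixed_span p bs S"
  shows "s \<otimes> x \<in> mixed_span p bs S"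
  using assms(1,4)
proof (induction bs arbitrary: x)
  case Nil
  then show ?case using assms subgroup.m_closed by auto
next
  case (Cons bf bs)
  then obtain i y where iy: "i < p ^ snd bf" "y \<in> mixed_span p bs S" "x = fst bf [^] i \<otimes> y" by auto
  have "y \<in> carrier G" "s \<in> carrier G"
    using iy(2) mixed_span_closed[of bs S p] Cons.prems(1) assms(2,3) subgroup.subset by auto
  then have "s \<otimes> x = fst bf [^] i \<otimes> (s \<otimes> y)" using iy Cons.prems(1) by (simp add: m_lcomm)
  moreover have "s \<otimes> y \<in> mixed_span p bs S" using Cons iy by auto
  ultimately show ?case using iy(1) by auto
qed

lemma mixed_span_modify:
  assumes "subgroup S G" "\<forall>bf\<in>set bs. fst bf \<in> carrier G \<and> z bf \<in> S"
  shows "mixed_span p bs S \<subseteq> mixed_span p (map (\<lambda>bf. (fst bf \<otimes> inv (z bf), snd bf)) bs) S"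
  using assms(2)
proof (induction bs)
  case (Cons bf bs)
  interpret S: subgroup S G by fact
  let ?m = "map (\<lambda>bf. (fst bf \<otimes> inv (z bf), snd bf))"
  show ?case
  proof
    fix x assume "x \<in> mixed_span p (bf # bs) S"
    then obtain i y where iy: "i < p ^ snd bf" "y \<in> mixed_span p bs S" "x = fst bf [^] i \<otimes> y" by auto
    have y: "y \<in> mixed_span p (?m bs) S" using Cons iy by auto
    have c: "\<forall>bf\<in>set (?m bs). fst bf \<in> carrier G" using Cons.prems by auto
    have zi: "z bf [^] i \<in> S"
      using Cons.prems by (induction i) auto
    have yc: "y \<in> carrier G" using y mixed_span_closed[OF c S.subset] by blast
    have "(fst bf \<otimes> inv (z bf)) [^] i = fst bf [^] i \<otimes> inv (z bf [^] i)"
      using Cons.prems by (simp add: pow_mult_distrib[OF m_comm] nat_pow_inv)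
    then have "x = (fst bf \<otimes> inv (z bf)) [^] i \<otimes> (z bf [^] i \<otimes> y)"
      using iy(3) Cons.prems yc by (simp add: m_assoc cancel_inv)
    moreover have "z bf [^] i \<otimes> y \<in> mixed_span p (?m bs) S"
      by (rule mixed_span_mult[OF c assms(1) zi y])
    ultimately show "x \<in> mixed_span p (?m (bf # bs)) S" using iy(1) by auto
  qed
qed simp

text \<open>The subgroup generated by \<open>N\<close> and \<open>b\<close>, where \<open>b\<close> has order \<open>q\<close> modulo \<open>N\<close>.\<close>
lemma adjoin_power:
  assumes N: "subgroup N G" and b: "b \<in> carrier G" and q: "0 < q"
    and iff: "\<forall>m::nat. b [^] m \<in> N \<longleftrightarrow> q dvd m"
  defines "N2 \<equiv> {b [^] i \<otimes> y | i y. i < q \<and> y \<in> N}"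
  shows "subgroup N2 G" "N \<subseteq> N2" "card N2 = q * card N" "\<And>t::nat. b [^] t \<in> N2"
proof -
  interpret N: subgroup N G by fact
  have N2: "b [^] t \<otimes> y \<in> N2" if "y \<in> N" for t :: nat and y
  proof -
    have "b [^] t = b [^] (t mod q) \<otimes> b [^] (q * (t div q))"
      using b by (simp add: nat_pow_mult)
    moreover have "b [^] (q * (t div q)) \<in> N" using iff by simp
    ultimately show ?thesis unfolding N2_def using that q b
      by (auto simp: m_assoc intro!: exI[of _ "t mod q"] exI[of _ "b [^] (q * (t div q)) \<otimes> y"])
  qed
  show "b [^] t \<in> N2" for t :: nat using N2[OF N.one_closed] b by simp
  show "N \<subseteq> N2" using N2[of _ 0] N.subset by auto
  have N2': "x \<in> N2 \<Longrightarrow> \<exists>t::nat. \<exists>y\<in>N. x = b [^] t \<otimes> y" for x by (auto simp: N2_def)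
  show "subgroup N2 G"
  proof (rule subgroupI)
    show "N2 \<subseteq> carrier G" using b by (auto simp: N2_def)
    show "N2 \<noteq> {}" using \<open>N \<subseteq> N2\<close> N.one_closed by blast
  next
    fix x assume "x \<in> N2"
    then obtain i y where iy: "i < q" "y \<in> N" "x = b [^] i \<otimes> y" by (auto simp: N2_def)
    have "b [^] i \<otimes> b [^] (q - i) = b [^] q" using iy(1) b by (simp add: nat_pow_mult)
    moreover have "b [^] (q - i) \<otimes> inv (b [^] i \<otimes> b [^] (q - i)) = inv (b [^] i)"
      using b m_lcomm[of "b [^] (q - i)" "inv (b [^] i)" "inv (b [^] (q - i))"] by (simp add: inv_mult)
    ultimately have "inv (b [^] i) = b [^] (q - i) \<otimes> inv (b [^] q)" by simp
    then have "inv x = b [^] (q - i) \<otimes> (inv (b [^] q) \<otimes> inv y)"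
      using iy b by (simp add: inv_mult m_assoc)
    moreover have "b [^] q \<in> N" using iff by simp
    ultimately show "inv x \<in> N2" using N2 iy by simp
  next
    fix x y assume "x \<in> N2" "y \<in> N2"
    then obtain i j u v where "u \<in> N" "v \<in> N" "x = b [^] (i::nat) \<otimes> u" "y = b [^] (j::nat) \<otimes> v"
      using N2' by metis
    moreover from this have "x \<otimes> y = b [^] (i + j) \<otimes> (u \<otimes> v)"
      using b by (simp add: nat_pow_mult[symmetric] m_ac)
    ultimately show "x \<otimes> y \<in> N2" using N2 by simp
  qed
  have inj: "inj_on (\<lambda>(i, y). b [^] i \<otimes> y) ({..<q} \<times> N)"
  proof -
    have le: "i = j" if "b [^] i \<otimes> u = b [^] j \<otimes> v" "i < q" "j < q" "i \<le> j" "u \<in> N" "v \<in> N" for i j :: nat and u v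
    proof -
      have "b [^] j = b [^] i \<otimes> b [^] (j - i)" using that b by (simp add: nat_pow_mult)
      then have "b [^] i \<otimes> u = b [^] i \<otimes> (b [^] (j - i) \<otimes> v)" using that b by (simp add: m_assoc)
      then have "u = b [^] (j - i) \<otimes> v" using that b by simp
      then have "b [^] (j - i) = u \<otimes> inv v" using that b by (simp add: inv_solve_right)
      then have "b [^] (j - i) \<in> N" using that by simp
      then have "q dvd j - i" using iff by blast
      then show "i = j" using that by (metis diff_less_mono2 dvd_imp_le le_neq_implies_less less_imp_diff_less linorder_not_less zero_less_diff)
    qed
    show ?thesis
    proof (rule inj_onI, clarsimp)
      fix i u j v assume A: "i < q" "u \<in> N" "j < q" "v \<in> N" "b [^] i \<otimes> u = b [^] j \<otimes> v"
      then have "i = j" using le[of i u j v] le[of j v i u] by (metis nat_le_linear)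
      then show "i = j \<and> u = v" using A b by simp
    qed
  qed
  have "N2 = (\<lambda>(i, y). b [^] i \<otimes> y) ` ({..<q} \<times> N)" by (force simp: N2_def)
  then show "card N2 = q * card N" using card_image[OF inj] by (simp add: card_cartesian_product)
qed

text \<open>
  The basis theorem for the quotient by \<open>N\<close>, by induction on its order. Let \<open>b\<close> have the greatest
  order modulo \<open>N\<close>, and take a basis modulo the larger subgroup generated by \<open>N\<close> and \<open>b\<close>. Because of
  the choice of \<open>b\<close>, each basis element can be multiplied by a power of \<open>b\<close> such that its order modulo
  \<open>N\<close> becomes its order modulo the larger subgroup. Adding \<open>b\<close> then gives a basis modulo \<open>N\<close>.
\<close>
theorem p_group_basis_mod_subgroup:
  assumes fin: "finite (carrier G)" and p: "prime p" and ord: "order G = p ^ n" and "subgroup N G"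
  shows "\<exists>bs. (\<forall>bf\<in>set bs. fst bf \<in> carrier G \<and> (\<forall>m::nat. fst bf [^] m \<in> N \<longleftrightarrow> p ^ snd bf dvd m)) \<and>
    carrier G \<subseteq> mixed_span p bs N \<and> order G = p ^ sum_list (map snd bs) * card N"
  using assms(4)
proof (induction "order G - card N" arbitrary: N rule: less_induct)
  case less
  interpret N: subgroup N G by fact
  show ?case
  proof (cases "N = carrier G")
    case True
    then show ?thesis by (intro exI[of _ "[]"]) (simp add: order_def)
  next
    case False
    have "\<exists>e. \<forall>x\<in>carrier G. \<forall>m::nat. x [^] m \<in> N \<longleftrightarrow> p ^ e x dvd m"
      using pow_mem_subgroup_iff_dvd[OF fin p ord less.prems] by metis
    then obtain e where e: "\<And>x m. x \<in> carrier G \<Longrightarrow> x [^] m \<in> N \<longleftrightarrow> p ^ e x dvd (m::nat)" by blast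
    obtain b where b: "b \<in> carrier G" "\<And>x. x \<in> carrier G \<Longrightarrow> e x \<le> e b"
    proof -
      have "finite (e ` carrier G)" "e ` carrier G \<noteq> {}" using fin one_closed by auto
      then obtain m where "m \<in> e ` carrier G" "\<forall>x\<in>e ` carrier G. x \<le> m" using Max_in Max_ge by metis
      then show ?thesis using that by auto
    qed
    obtain x where "x \<in> carrier G" "x \<notin> N" using False N.subset by blast
    then have "e x \<noteq> 0" using e[of x 1] by (metis nat_pow_eone dvd_refl power_0)
    then have e0: "0 < e b" using b(2)[OF \<open>x \<in> carrier G\<close>] by simp
    define N2 where "N2 = {b [^] i \<otimes> y | i y. i < p ^ e b \<and> y \<in> N}"
    have pe: "0 < p ^ e b" using prime_gt_0_nat[OF p] by simp
    note N2 = adjoin_power[OF less.prems b(1) pe, folded N2_def]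
    have bN: "\<forall>m::nat. b [^] m \<in> N \<longleftrightarrow> p ^ e b dvd m" using e b by blast
    have cN: "0 < card N" using N.one_closed finite_subset[OF N.subset fin] card_gt_0_iff by blast
    have "1 < p ^ e b" using prime_gt_1_nat[OF p] e0 by (intro one_less_power) auto
    then have "card N < card N2" using N2(3)[OF bN] cN by simp
    moreover have "card N2 \<le> order G"
      using card_mono[OF fin subgroup.subset[OF N2(1)[OF bN]]] by (simp add: order_def)
    ultimately obtain cs where cs: "\<And>c. c \<in> set cs \<Longrightarrow> fst c \<in> carrier G"
        "\<And>c m. c \<in> set cs \<Longrightarrow> fst c [^] (m::nat) \<in> N2 \<longleftrightarrow> p ^ snd c dvd m"
        "carrier G \<subseteq> mixed_span p cs N2" "order G = p ^ sum_list (map snd cs) * card N2"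
      using less.hyps[OF _ N2(1)[OF bN]] by (metis diff_less_mono2 less_le_trans)
    have ex: "\<exists>s::nat. (fst c \<otimes> inv (b [^] s)) [^] (p ^ snd c) \<in> N" if c: "c \<in> set cs" for c
    proof -
      let ?c = "fst c" and ?f = "snd c"
      have "?c [^] (p ^ ?f) \<in> N2" using cs(2)[OF c] by simp
      then obtain t y where t: "?c [^] (p ^ ?f) = b [^] (t::nat) \<otimes> y" "y \<in> N" by (auto simp: N2_def)
      have "?c [^] (p ^ e b) \<in> N" using e[OF cs(1)[OF c]] b(2)[OF cs(1)[OF c]] by (simp add: le_imp_power_dvd)
      then have "p ^ ?f dvd p ^ e b" using cs(2)[OF c] N2(2)[OF bN] by blast
      then have fe: "?f \<le> e b" using prime_gt_1_nat[OF p] by (simp add: dvd_power_iff_le)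
      have "p ^ ?f * p ^ (e b - ?f) = p ^ e b" using fe by (simp add: power_add[symmetric])
      then have "(b [^] t \<otimes> y) [^] (p ^ (e b - ?f)) \<in> N"
        using \<open>?c [^] (p ^ e b) \<in> N\<close> cs(1)[OF c] by (simp add: t(1)[symmetric] nat_pow_pow)
      then have "b [^] (t * p ^ (e b - ?f)) \<otimes> y [^] (p ^ (e b - ?f)) \<in> N"
        using b t by (simp add: pow_mult_distrib m_comm nat_pow_pow)
      note 1 = this
      have ypow: "y [^] k \<in> N" for k :: nat using t(2) by (induction k) auto
      have "b [^] (t * p ^ (e b - ?f)) \<otimes> y [^] (p ^ (e b - ?f)) \<otimes> inv (y [^] (p ^ (e b - ?f))) \<in> N"
        by (rule N.m_closed[OF 1 N.m_inv_closed[OF ypow]])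
      then have "b [^] (t * p ^ (e b - ?f)) \<in> N" using b t by (simp add: m_assoc)
      then have "p ^ ?f * p ^ (e b - ?f) dvd t * p ^ (e b - ?f)"
        using e[OF b(1)] \<open>p ^ ?f * p ^ (e b - ?f) = p ^ e b\<close> by simp
      then have "p ^ ?f dvd t" using prime_gt_0_nat[OF p] by simp
      then obtain s where s: "t = p ^ ?f * s" by blast
      (* dividing by b^s cancels the component b^t in the power of c *)
      have "(?c \<otimes> inv (b [^] s)) [^] (p ^ ?f) = b [^] t \<otimes> y \<otimes> inv (b [^] t)"
        using b cs(1)[OF c] t(2) by (simp add: pow_mult_distrib m_comm nat_pow_inv[symmetric] nat_pow_pow t(1) s mult.commute)
      also have "\<dots> = y" using b t(2) by (simp add: m_comm[of "b [^] t" y] m_assoc)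
      finally show ?thesis using t(2) by auto
    qed
    then obtain s where s: "\<And>c. c \<in> set cs \<Longrightarrow> (fst c \<otimes> inv (b [^] (s c :: nat))) [^] (p ^ snd c) \<in> N" by metis
    let ?m = "\<lambda>c. (fst c \<otimes> inv (b [^] s c), snd c)"
    show ?thesis
    proof (intro exI[of _ "map ?m cs @ [(b, e b)]"] conjI)
      show "\<forall>bf\<in>set (map ?m cs @ [(b, e b)]).
          fst bf \<in> carrier G \<and> (\<forall>m::nat. fst bf [^] m \<in> N \<longleftrightarrow> p ^ snd bf dvd m)"
      proof
        fix bf assume "bf \<in> set (map ?m cs @ [(b, e b)])"
        then consider "bf = (b, e b)" | c where "c \<in> set cs" "bf = ?m c" by auto
        then show "fst bf \<in> carrier G \<and> (\<forall>m::nat. fst bf [^] m \<in> N \<longleftrightarrow> p ^ snd bf dvd m)"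
        proof cases
          case 1
          then show ?thesis using b e by simp
        next
          case (2 c)
          let ?c' = "fst c \<otimes> inv (b [^] s c)"
          have c': "?c' \<in> carrier G" using b cs(1)[OF 2(1)] by simp
          have "?c' [^] m \<in> N \<longleftrightarrow> p ^ snd c dvd m" for m :: nat
          proof
            assume "p ^ snd c dvd m"
            then obtain k where "m = p ^ snd c * k" by blast
            then have "?c' [^] m = (?c' [^] (p ^ snd c)) [^] k" using c' by (simp add: nat_pow_pow)
            moreover have "(?c' [^] (p ^ snd c)) [^] k \<in> N" using s[OF 2(1)] by (induction k) auto
            ultimately show "?c' [^] m \<in> N" by simp
          next
            assume "?c' [^] m \<in> N"
            then have "?c' [^] m \<in> N2" using N2(2)[OF bN] by blast
            moreover have "b [^] (s c * m) \<in> N2" by (rule N2(4)[OF bN])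
            ultimately have "?c' [^] m \<otimes> b [^] (s c * m) \<in> N2" using subgroup.m_closed[OF N2(1)[OF bN]] by blast
            moreover have "?c' [^] m \<otimes> b [^] (s c * m) = fst c [^] m"
              using b cs(1)[OF 2(1)] by (simp add: pow_mult_distrib[OF m_comm] nat_pow_inv nat_pow_pow m_assoc)
            ultimately show "p ^ snd c dvd m" using cs(2)[OF 2(1)] by simp
          qed
          then show ?thesis using 2 c' by simp
        qed
      qed
    next
      have "mixed_span p cs N2 \<subseteq> mixed_span p (map ?m cs) N2"
        using mixed_span_modify[OF N2(1)[OF bN], of cs "\<lambda>c. b [^] s c"] cs(1) N2(4)[OF bN] by auto
      moreover have "N2 = mixed_span p [(b, e b)] N" by (simp add: N2_def)
      ultimately show "carrier G \<subseteq> mixed_span p (map ?m cs @ [(b, e b)]) N"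
        unfolding mixed_span_append using cs(3) by auto
      have "map snd (map ?m cs) = map snd cs" by simp
      then show "order G = p ^ sum_list (map snd (map ?m cs @ [(b, e b)])) * card N"
        using cs(4) N2(3)[OF bN] by (simp add: power_add comp_def)
    qed
  qed
qed

end

context group
begin

text \<open>
  Writing exponents below \<open>p ^ f\<close> in base \<open>p\<close>, one generator of order \<open>p ^ f\<close> is replaced by the chain
  of its powers \<open>b, b\<^sup>p, \<dots>\<close>, each with exponents below \<open>p\<close>. In this chain the \<open>p\<close>-th power of an
  element is the next element, as a favourable presentation requires.
\<close>
primrec digit_span :: "nat \<Rightarrow> 'a list \<Rightarrow> 'a set \<Rightarrow> 'a set" where
  "digit_span p [] S = S"
| "digit_span p (a # as) S = {a [^] i \<otimes> y | i y. i < p \<and> y \<in> digit_span p as S}"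

definition power_chain :: "nat \<Rightarrow> 'a \<Rightarrow> nat \<Rightarrow> 'a list" where
  "power_chain p b f = map (\<lambda>j. b [^] (p ^ j)) [0..<f]"

lemma power_chain_Suc:
  "b \<in> carrier G \<Longrightarrow> power_chain p b (Suc f) = b # power_chain p (b [^] p) f"
  by (simp add: power_chain_def upt_conv_Cons map_Suc_upt[symmetric] nat_pow_pow del: upt_Suc)

lemma digit_span_append: "digit_span p (as @ bs) S = digit_span p as (digit_span p bs S)"
  by (induction as) auto

lemma digit_span_mono: "S \<subseteq> T \<Longrightarrow> digit_span p as S \<subseteq> digit_span p as T"
  by (induction as) auto

lemma power_in_digit_span:
  assumes "b \<in> carrier G" "S \<subseteq> carrier G" "i < p ^ f" "y \<in> S"
  shows "b [^] i \<otimes> y \<in> digit_span p (power_chain p b f) S"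
  using assms(1,3)
proof (induction f arbitrary: b i)
  case 0
  then show ?case using assms by (auto simp: power_chain_def)
next
  case (Suc f)
  have "p > 0" using Suc.prems(2) by (cases p) auto
  have "i div p < p ^ f" using Suc.prems(2) by (simp add: less_mult_imp_div_less mult.commute)
  then have "(b [^] p) [^] (i div p) \<otimes> y \<in> digit_span p (power_chain p (b [^] p) f) S"
    using Suc.IH Suc.prems(1) by simp
  moreover have "b [^] i \<otimes> y = b [^] (i mod p) \<otimes> ((b [^] p) [^] (i div p) \<otimes> y)"
    using Suc.prems(1) assms(2,4) by (simp add: m_assoc[symmetric] nat_pow_pow nat_pow_mult subset_iff)
  ultimately show ?case using \<open>p > 0\<close> Suc.prems(1) unfolding power_chain_Suc[OF Suc.prems(1)] digit_span.simps
    by (auto intro!: exI[of _ "i mod p"])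
qed

lemma mixed_span_subset_digit_span:
  assumes "\<forall>bf\<in>set bs. fst bf \<in> carrier G" "S \<subseteq> carrier G"
  shows "mixed_span p bs S \<subseteq> digit_span p (concat (map (\<lambda>bf. power_chain p (fst bf) (snd bf)) bs)) S"
  using assms(1)
proof (induction bs)
  case (Cons bf bs)
  have sub: "mixed_span p bs S \<subseteq> carrier G"
    using Cons.prems assms(2) by (induction bs) auto
  show ?case
  proof
    fix x assume "x \<in> mixed_span p (bf # bs) S"
    then obtain i y where iy: "i < p ^ snd bf" "y \<in> mixed_span p bs S" "x = fst bf [^] i \<otimes> y" by auto
    then have "x \<in> digit_span p (power_chain p (fst bf) (snd bf)) (mixed_span p bs S)"
      using power_in_digit_span[OF _ sub iy(1,2)] Cons.prems by simp
    then show "x \<in> digit_span p (concat (map (\<lambda>bf. power_chain p (fst bf) (snd bf)) (bf # bs))) S"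
      using digit_span_mono[OF Cons.IH] Cons.prems by (auto simp: digit_span_append)
  qed
qed simp

definition chained :: "nat \<Rightarrow> 'a set \<Rightarrow> 'a list \<Rightarrow> bool" where
  "chained p M as \<longleftrightarrow> (\<forall>i<length as. (as ! i) [^] p \<in> M \<or> Suc i < length as \<and> as ! Suc i = (as ! i) [^] p)"

lemma chained_append:
  assumes "chained p M as" "chained p M bs" shows "chained p M (as @ bs)"
  unfolding chained_def
proof (intro allI impI)
  fix i assume i: "i < length (as @ bs)"
  show "(as @ bs) ! i [^] p \<in> M \<or> Suc i < length (as @ bs) \<and> (as @ bs) ! Suc i = (as @ bs) ! i [^] p"
  proof (cases "i < length as")
    case True
    then show ?thesis using assms(1) unfolding chained_def by (auto simp: nth_append)
  next
    case False
    then have "i - length as < length bs" "Suc i - length as = Suc (i - length as)" using i by auto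
    then show ?thesis using assms(2) False unfolding chained_def by (auto simp: nth_append)
  qed
qed

lemma chained_power_chain:
  assumes "b \<in> carrier G" "b [^] (p ^ f) \<in> M"
  shows "chained p M (power_chain p b f)"
  unfolding chained_def power_chain_def
proof (intro allI impI)
  fix i assume i: "i < length (map (\<lambda>j. b [^] p ^ j) [0..<f])"
  have "(b [^] p ^ i) [^] p = b [^] (p ^ Suc i)" using assms(1) by (simp add: nat_pow_pow mult.commute)
  then show "map (\<lambda>j. b [^] p ^ j) [0..<f] ! i [^] p \<in> M \<or>
      Suc i < length (map (\<lambda>j. b [^] p ^ j) [0..<f]) \<and>
      map (\<lambda>j. b [^] p ^ j) [0..<f] ! Suc i = map (\<lambda>j. b [^] p ^ j) [0..<f] ! i [^] p"
    using i assms(2) by (cases "Suc i = f") auto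
qed

lemma abelian_layer_generators:
  assumes fin: "finite (carrier G)" and p: "prime p" and ord: "order G = p ^ n"
    and M: "M \<lhd> G" and ab: "\<And>x y. x \<in> carrier G \<Longrightarrow> y \<in> carrier G \<Longrightarrow> cm x y \<in> M"
  shows "\<exists>as. set as \<subseteq> carrier G \<and> chained p M as \<and> carrier G \<subseteq> digit_span p as M \<and>
    order G = p ^ length as * card M"
proof -
  interpret M: normal M G by fact
  interpret q: group_hom G "G Mod M" "\<lambda>a. M #> a" by (rule M.quotient_hom)
  have comm: "comm_group (G Mod M)"
  proof (rule q.H.group_comm_groupI)
    fix X Y assume "X \<in> carrier (G Mod M)" "Y \<in> carrier (G Mod M)"
    then obtain x y where xy: "x \<in> carrier G" "y \<in> carrier G" "X = M #> x" "Y = M #> y"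
      by (auto simp: carrier_FactGroup)
    have "q.H.cm (M #> x) (M #> y) = \<one>\<^bsub>G Mod M\<^esub>"
      unfolding q.hom_cm[OF xy(1,2), symmetric] using ab xy M.coset_eq_one by simp
    then show "X \<otimes>\<^bsub>G Mod M\<^esub> Y = Y \<otimes>\<^bsub>G Mod M\<^esub> X"
      unfolding xy(3,4) using q.H.cm_eq_one[OF q.hom_closed[OF xy(1)] q.hom_closed[OF xy(2)]] by blast
  qed
  interpret Q: comm_group "G Mod M" by (rule comm)
  have lag: "order (G Mod M) * card M = p ^ n"
    using lagrange[OF M.subgroup_axioms] ord by (simp add: order_def FactGroup_def)
  then obtain k where k: "order (G Mod M) = p ^ k" using p by (metis divides_primepow_nat dvd_triv_left)
  have finQ: "finite (carrier (G Mod M))" using fin by (simp add: carrier_FactGroup)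
  have onesub: "subgroup {\<one>\<^bsub>G Mod M\<^esub>} (G Mod M)" by (rule q.H.triv_subgroup)
  obtain Bs where Bs: "\<And>Bf. Bf \<in> set Bs \<Longrightarrow> fst Bf \<in> carrier (G Mod M) \<and>
        (\<forall>m::nat. fst Bf [^]\<^bsub>G Mod M\<^esub> m \<in> {\<one>\<^bsub>G Mod M\<^esub>} \<longleftrightarrow> p ^ snd Bf dvd m)"
      "carrier (G Mod M) \<subseteq> q.H.mixed_span p Bs {\<one>\<^bsub>G Mod M\<^esub>}"
      "order (G Mod M) = p ^ sum_list (map snd Bs) * card {\<one>\<^bsub>G Mod M\<^esub>}"
    using Q.p_group_basis_mod_subgroup[OF finQ p k onesub] by blast
  have "\<exists>\<beta>. \<forall>Bf\<in>set Bs. \<beta> Bf \<in> carrier G \<and> fst Bf = M #> \<beta> Bf"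
  proof (rule bchoice, rule ballI)
    fix Bf assume "Bf \<in> set Bs"
    then have "fst Bf \<in> (\<lambda>a. M #> a) ` carrier G" using Bs(1) unfolding carrier_FactGroup by blast
    then show "\<exists>y. y \<in> carrier G \<and> fst Bf = M #> y" by blast
  qed
  then obtain \<beta> where \<beta>: "\<And>Bf. Bf \<in> set Bs \<Longrightarrow> \<beta> Bf \<in> carrier G" "\<And>Bf. Bf \<in> set Bs \<Longrightarrow> fst Bf = M #> \<beta> Bf"
    by blast
  define bs where "bs = map (\<lambda>Bf. (\<beta> Bf, snd Bf)) Bs"
  have bsc: "\<forall>bf\<in>set bs. fst bf \<in> carrier G" using \<beta> by (auto simp: bs_def)
  let ?as = "concat (map (\<lambda>bf. power_chain p (fst bf) (snd bf)) bs)"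
  have bsM: "b [^] (p ^ f) \<in> M" if "(b, f) \<in> set bs" for b f
  proof -
    have "(b, f) \<in> (\<lambda>Bf. (\<beta> Bf, snd Bf)) ` set Bs" using that by (simp add: bs_def)
    then obtain Bf where "Bf \<in> set Bs" "(b, f) = (\<beta> Bf, snd Bf)" by blast
    then have Bf: "Bf \<in> set Bs" "b = \<beta> Bf" "f = snd Bf" by auto
    have "M #> (b [^] (p ^ f)) = \<one>\<^bsub>G Mod M\<^esub>"
    proof -
      have "fst Bf [^]\<^bsub>G Mod M\<^esub> (p ^ f) \<in> {\<one>\<^bsub>G Mod M\<^esub>}" 
        using Bs(1)[OF Bf(1), THEN conjunct2, THEN spec, of "p ^ f"] unfolding Bf(3) by (rule iffD2) simp
      then have "fst Bf [^]\<^bsub>G Mod M\<^esub> (p ^ f) = \<one>\<^bsub>G Mod M\<^esub>" by (rule singletonD)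
      then show ?thesis
        unfolding \<beta>(2)[OF Bf(1)] M.FactGroup_pow[OF \<beta>(1)[OF Bf(1)]] Bf(2) .
    qed
    moreover have "b [^] (p ^ f) \<in> carrier G" using \<beta>(1)[OF Bf(1)] Bf(2) by simp
    ultimately show ?thesis using M.coset_eq_one by blast
  qed
  have "chained p M ?as"
    using bsc bsM
  proof (induction bs)
    case (Cons bf bs)
    then show ?case using chained_append chained_power_chain[of "fst bf" p "snd bf" M] by auto
  qed (simp add: chained_def)
  moreover have "set ?as \<subseteq> carrier G" using bsc by (auto simp: power_chain_def)
  moreover have "carrier G \<subseteq> digit_span p ?as M"
  proof -
    have "x \<in> mixed_span p (map (\<lambda>Bf. (\<beta> Bf, snd Bf)) Cs) M"
      if "set Cs \<subseteq> set Bs" "x \<in> carrier G" "M #> x \<in> q.H.mixed_span p Cs {\<one>\<^bsub>G Mod M\<^esub>}" for x Cs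
      using that
    proof (induction Cs arbitrary: x)
      case Nil
      then show ?case using M.coset_eq_one[of x] by (metis list.map(1) mixed_span.simps(1) q.H.mixed_span.simps(1) singletonD)
    next
      case (Cons C Cs)
      obtain i Y where iY: "i < p ^ snd C" "Y \<in> q.H.mixed_span p Cs {\<one>\<^bsub>G Mod M\<^esub>}"
          "M #> x = fst C [^]\<^bsub>G Mod M\<^esub> i \<otimes>\<^bsub>G Mod M\<^esub> Y"
        using Cons.prems(3) by auto
      have C: "\<beta> C \<in> carrier G" "fst C = M #> \<beta> C" "fst C \<in> carrier (G Mod M)"
        using Cons.prems(1) \<beta> Bs(1) by auto
      have "\<forall>bf\<in>set Cs. fst bf \<in> carrier (G Mod M)"
        using Bs(1)[THEN conjunct1] set_mp[OF Cons.prems(1)] by simp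
      then have "Y \<in> carrier (G Mod M)"
        using subsetD[OF Q.mixed_span_closed iY(2)] subgroup.subset[OF onesub] by blast
      define y where "y = inv (\<beta> C [^] i) \<otimes> x"
      have y: "y \<in> carrier G" using C(1) Cons.prems(2) by (simp add: y_def)
      have "M #> y = inv\<^bsub>G Mod M\<^esub> (fst C [^]\<^bsub>G Mod M\<^esub> i) \<otimes>\<^bsub>G Mod M\<^esub> (M #> x)"
        unfolding y_def C(2) M.FactGroup_pow[OF C(1)] using C(1) Cons.prems(2)
        by (simp only: q.hom_mult q.hom_inv inv_closed nat_pow_closed)
      also have "\<dots> = Y" unfolding iY(3)
        using q.H.cancel_inv(1)[OF q.H.nat_pow_closed[OF C(3)] \<open>Y \<in> carrier (G Mod M)\<close>] .
      finally have "y \<in> mixed_span p (map (\<lambda>Bf. (\<beta> Bf, snd Bf)) Cs) M"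
        using Cons.IH[OF _ y] Cons.prems(1) iY(2) by simp
      moreover have "x = \<beta> C [^] i \<otimes> y" using C(1) Cons.prems(2) by (simp add: y_def cancel_inv)
      ultimately show ?case using iY(1) by auto
    qed
    then have "carrier G \<subseteq> mixed_span p bs M"
      using Bs(2) q.hom_closed unfolding bs_def by blast
    then show ?thesis using mixed_span_subset_digit_span[OF bsc M.subset, of p] by blast
  qed
  moreover have "order G = p ^ length ?as * card M"
  proof -
    have "length ?as = sum_list (map snd Bs)"
      by (simp add: length_concat bs_def comp_def power_chain_def)
    then show ?thesis using lag Bs(3) ord by simp
  qed
  ultimately show ?thesis by blast
qed

end

lemma (in group) subgroup_cm:
  assumes "subgroup H G" "x \<in> H" "y \<in> H"
  shows "group.cm (G\<lparr>carrier := H\<rparr>) x y = cm x y"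
proof -
  interpret H: group "G\<lparr>carrier := H\<rparr>" by (rule subgroup_imp_group[OF assms(1)])
  show ?thesis unfolding H.cm_def cm_def using m_inv_consistent[OF assms(1)] assms by simp
qed

lemma (in group) subgroup_digit_span:
  "group.digit_span (G\<lparr>carrier := H\<rparr>) p as S = digit_span p as S" if "subgroup H G"
proof -
  interpret H: group "G\<lparr>carrier := H\<rparr>" by (rule subgroup_imp_group[OF that])
  show ?thesis by (induction as) (auto simp: nat_pow_consistent[symmetric])
qed

text \<open>The layer \<open>H / M\<close> of a \<open>p\<close>-group: its basis, lifted to \<open>H\<close> and spread out into power chains.\<close>
lemma (in group) abelian_section_generators:
  assumes fin: "finite (carrier G)" and p: "prime p" and ord: "order G = p ^ n"
    and H: "subgroup H G" and M: "M \<lhd> G" "M \<subseteq> H"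
    and ab: "\<And>x y. x \<in> H \<Longrightarrow> y \<in> H \<Longrightarrow> cm x y \<in> M"
  shows "\<exists>as. set as \<subseteq> H \<and> chained p M as \<and> H \<subseteq> digit_span p as M \<and> card H = p ^ length as * card M"
proof -
  let ?H = "G\<lparr>carrier := H\<rparr>"
  interpret H: group ?H by (rule subgroup_imp_group[OF H])
  obtain k where "card H = p ^ k" using p_group_subgroup_order[OF fin p ord H] by blast
  moreover have "finite H" using finite_subset[OF subgroup.subset[OF H] fin] .
  moreover have "M \<lhd> ?H" using normal_restrict_supergroup[OF H M] .
  ultimately obtain as where "set as \<subseteq> H" "H.chained p M as" "H \<subseteq> H.digit_span p as M" "card H = p ^ length as * card M"
    using H.abelian_layer_generators[of p k M] p ab by (auto simp: order_def subgroup_cm[OF H])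
  then show ?thesis
    unfolding subgroup_digit_span[OF H] H.chained_def chained_def by (auto simp: nat_pow_consistent[symmetric])
qed

section \<open>The presentation attached to a polycyclic sequence\<close>

lemma pos_word_simps [simp]: "pos_word [] = []" "pos_word (x # w) = (x, True) # pos_word w"
  "pos_word (u @ w) = pos_word u @ pos_word w"
  by (simp_all add: pos_word_def)

lemma pres_eq_context: "pres_eq S R u w \<Longrightarrow> pres_eq S R (s @ u @ t) (s @ w @ t)"
proof (induction rule: pres_eq.induct)
  case (cancel x s' b t')
  then show ?case using pres_eq.cancel[of x S R "s @ s'" b "t' @ t"] by simp
next
  case (rel l r s' t')
  then show ?case using pres_eq.rel[of l r R S "s @ s'" "t' @ t"] by simp
qed (blast intro: pres_eq.intros)+

lemma pres_eq_append: "pres_eq S R u u' \<Longrightarrow> pres_eq S R w w' \<Longrightarrow> pres_eq S R (u @ w) (u' @ w')"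
  using pres_eq_context[of S R u u' "[]" w] pres_eq_context[of S R w w' u' "[]"]
  by (auto intro: pres_eq.trans)

lemma equiv_pres_rel: "equiv (lists (S \<times> UNIV)) (pres_rel S R)"
  by (auto simp: equiv_def refl_on_def sym_def trans_def pres_rel_def intro: pres_eq.intros)

lemma collect_left_pres_eq:
  "collect_left P x y \<Longrightarrow> pres_eq (pc_gens P) (pc_rels P) (pos_word x) (pos_word y)"
  unfolding collect_left_def using pres_eq.rel by (metis pos_word_simps(3))

lemma collect_left_pow_pres_eq:
  "(collect_left P ^^ n) x y \<Longrightarrow> pres_eq (pc_gens P) (pc_rels P) (pos_word x) (pos_word y)"
proof (induction n arbitrary: y)
  case (Suc n)
  then show ?case using collect_left_pres_eq pres_eq.trans by (metis relpowp_Suc_E)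
qed (auto intro: pres_eq.refl)

text \<open>
  The elements \<open>a 1, \<dots>, a n\<close> refine the series \<open>N 1 \<supseteq> N 2 \<supseteq> \<dots>\<close>, with \<open>\<delta> i\<close> the layer to which
  \<open>a i\<close> belongs, and every element of \<open>N k\<close> is represented by a normal word in layers \<open>\<ge> k\<close>.
\<close>
locale pc_sequence = group G for G (structure) +
  fixes p n d :: nat and a :: "nat \<Rightarrow> 'a" and \<delta> :: "nat \<Rightarrow> nat" and N :: "nat \<Rightarrow> 'a set"
  assumes prime: "prime p" and order: "order G = p ^ n"
    and a_closed [simp]: "a i \<in> carrier G"
    and N_normal: "N k \<lhd> G" and N_antimono: "i \<le> j \<Longrightarrow> N j \<subseteq> N i"
    and N_first: "N 1 = carrier G"
    and N_cm: "x \<in> N k \<Longrightarrow> y \<in> N k \<Longrightarrow> cm x y \<in> N (Suc k)"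
    and \<delta>_mono: "mono_on {1..n} \<delta>" and \<delta>_image: "\<delta> ` {1..n} = {1..d}"
    and a_mem: "i \<in> {1..n} \<Longrightarrow> a i \<in> N (\<delta> i)"
    and a_power: "i \<in> {1..n} \<Longrightarrow> a i [^] p \<in> N (Suc (\<delta> i)) \<or>
      Suc i \<in> {1..n} \<and> \<delta> (Suc i) = \<delta> i \<and> a (Suc i) = a i [^] p"
    and span: "k \<in> {1..Suc d} \<Longrightarrow> g \<in> N k \<Longrightarrow> \<exists>w. sorted w \<and> set w \<subseteq> {i \<in> {1..n}. k \<le> \<delta> i} \<and>
      (\<forall>i. count_list w i < p) \<and> foldr (\<lambda>i x. a i \<otimes> x) w \<one> = g"
begin

definition ev :: "nat list \<Rightarrow> 'a" where
  "ev w = foldr (\<lambda>i x. a i \<otimes> x) w \<one>"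

lemma ev_simps [simp]: "ev [] = \<one>" "ev (i # w) = a i \<otimes> ev w" by (simp_all add: ev_def)

lemma ev_closed [simp]: "ev w \<in> carrier G" by (induction w) auto

lemma ev_replicate: "ev (replicate m i) = a i [^] m"
  by (induction m) (simp, metis a_closed ev_simps(2) nat_pow_Suc2 replicate_Suc)

definition nform :: "nat list \<Rightarrow> bool" where
  "nform w \<longleftrightarrow> sorted w \<and> set w \<subseteq> {1..n} \<and> (\<forall>i. count_list w i < p)"

lemma nform_exists: "k \<in> {1..Suc d} \<Longrightarrow> g \<in> N k \<Longrightarrow> \<exists>w. nform w \<and> (\<forall>x\<in>set w. k \<le> \<delta> x) \<and> ev w = g"
  using span[of k g] unfolding nform_def ev_def by blast

text \<open>There are at most \<open>p\<^sup>n\<close> normal words, and they represent all \<open>p\<^sup>n\<close> elements of the group.\<close>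
lemma ev_inj: "inj_on ev {w. nform w}"
proof -
  let ?f = "\<lambda>\<alpha>. concat (map (\<lambda>i. replicate (\<alpha> i) i) [1..<Suc n])"
  let ?A = "{1..n} \<rightarrow>\<^sub>E {..<p}"
  have sub: "{w. nform w} \<subseteq> ?f ` ?A"
  proof
    fix w assume w: "w \<in> {w. nform w}"
    let ?\<alpha> = "restrict (count_list w) {1..n}"
    have "w = ?f ?\<alpha>"
    proof (rule sorted_count_eqI)
      show "sorted w" using w by (simp add: nform_def)
      show "count_list w i = count_list (?f ?\<alpha>) i" for i
        using w unfolding count_concat_replicate by (auto simp: nform_def count_list_0_iff subset_iff)
    qed (rule sorted_concat_replicate)
    moreover have "?\<alpha> \<in> ?A" using w by (auto simp: nform_def)
    ultimately show "w \<in> ?f ` ?A" by (rule image_eqI)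
  qed
  have finA: "finite ?A" by (simp add: finite_PiE)
  then have fin: "finite {w. nform w}" using finite_subset[OF sub] by simp
  have "card {w. nform w} \<le> card (?f ` ?A)" by (rule card_mono) (use finA sub in auto)
  also have "\<dots> \<le> card ?A" by (rule card_image_le[OF finA])
  also have "\<dots> = p ^ n" by (simp add: card_PiE)
  finally have "card {w. nform w} \<le> p ^ n" .
  moreover have "ev ` {w. nform w} = carrier G"
    using nform_exists[of 1] N_first by auto
  then have "card (ev ` {w. nform w}) = p ^ n" using order by (simp add: order_def)
  ultimately have "card (ev ` {w. nform w}) = card {w. nform w}"
    using card_image_le[OF fin, of ev] by simp
  then show ?thesis by (rule eq_card_imp_inj_on[OF fin])
qed

lemma ev_eqD: "nform u \<Longrightarrow> nform w \<Longrightarrow> ev u = ev w \<Longrightarrow> u = w"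
  using ev_inj by (simp add: inj_on_def)

definition nf :: "'a \<Rightarrow> nat list" where
  "nf g = (SOME w. nform w \<and> ev w = g)"

lemma nf:
  assumes "k \<in> {1..Suc d}" "g \<in> N k"
  shows "nform (nf g)" "ev (nf g) = g" "\<forall>x\<in>set (nf g). k \<le> \<delta> x"
proof -
  obtain w where w: "nform w" "\<forall>x\<in>set w. k \<le> \<delta> x" "ev w = g" using nform_exists[OF assms] by blast
  have "nform (nf g) \<and> ev (nf g) = g" unfolding nf_def by (rule someI[of _ w]) (use w in simp)
  then show "nform (nf g)" "ev (nf g) = g" by auto
  then have "nf g = w" using ev_eqD w by simp
  then show "\<forall>x\<in>set (nf g). k \<le> \<delta> x" using w by simp
qed

text \<open>
  The relations \<open>a\<^sub>j a\<^sub>i = a\<^sub>i v\<close> are read off from the normal form of the conjugate of \<open>a\<^sub>j\<close> by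
  \<open>a\<^sub>i\<close>. If both belong to the same layer, the conjugate differs from \<open>a\<^sub>j\<close> by an element of the next
  term of the series, so that its normal form starts with \<open>a\<^sub>j\<close>.
\<close>
definition pres :: pc_data where
  "pres = \<lparr>ngens = n, expo = \<lambda>_. p, rhs = \<lambda>i j.
     if i = j then (if a i [^] p \<in> N (Suc (\<delta> i)) then nf (a i [^] p) else [Suc i])
     else if \<delta> i = \<delta> j then j # nf (inv (a j) \<otimes> (inv (a i) \<otimes> a j \<otimes> a i))
     else nf (inv (a i) \<otimes> a j \<otimes> a i)\<rparr>"

lemma gens: "pc_gens pres = {1..n}" by (simp add: pc_gens_def pres_def)

lemma ngens_pres [simp]: "ngens pres = n" by (simp add: pres_def)

lemma expo_pres [simp]: "expo pres i = p" by (simp add: pres_def)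

lemma normal_word_pres: "normal_word pres w \<longleftrightarrow> nform w"
  unfolding normal_word_iff nform_def gens
  using prime_gt_0_nat[OF prime] by simp (metis count_list_0_iff subsetD)

lemma \<delta>_range: "i \<in> {1..n} \<Longrightarrow> \<delta> i \<in> {1..d}"
  using \<delta>_image by blast

lemma higher_nf:
  assumes "i \<in> {1..n}" "g \<in> N (Suc (\<delta> i))"
  shows "higher_word pres \<delta> i (nf g)" "ev (nf g) = g"
proof -
  have "Suc (\<delta> i) \<in> {1..Suc d}" using \<delta>_range[OF assms(1)] by auto
  from nf[OF this assms(2)] show "higher_word pres \<delta> i (nf g)" "ev (nf g) = g"
    by (auto simp: higher_word_def normal_word_pres Suc_le_eq)
qed

lemma rhs_power_cases:
  assumes "i \<in> {1..n}"
  obtains "a i [^] p \<in> N (Suc (\<delta> i))" "rhs pres i i = nf (a i [^] p)"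
  | "Suc i \<in> {1..n}" "\<delta> (Suc i) = \<delta> i" "a (Suc i) = a i [^] p" "rhs pres i i = [Suc i]"
proof (cases "a i [^] p \<in> N (Suc (\<delta> i))")
  case True
  then show thesis using that(1) by (simp add: pres_def)
next
  case False
  then show thesis using that(2) a_power[OF assms] by (simp add: pres_def)
qed

lemma cm_layer:
  assumes "i \<in> {1..n}" "j \<in> {1..n}" "\<delta> i = \<delta> j"
  shows "inv (a j) \<otimes> (inv (a i) \<otimes> a j \<otimes> a i) \<in> N (Suc (\<delta> i))"
proof -
  interpret M: normal "N (Suc (\<delta> i))" G by (rule N_normal)
  have "cm (a j) (a i) \<in> N (Suc (\<delta> i))" using N_cm a_mem assms by metis
  then have "inv (a j) \<otimes> cm (a j) (a i) \<otimes> a j \<in> N (Suc (\<delta> i))" by (rule M.inv_op_closed1[OF a_closed])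
  then show ?thesis by (simp add: cm_def m_assoc)
qed

lemma rhs_same_eq:
  "i \<noteq> j \<Longrightarrow> \<delta> i = \<delta> j \<Longrightarrow> rhs pres i j = j # nf (inv (a j) \<otimes> (inv (a i) \<otimes> a j \<otimes> a i))"
  by (simp add: pres_def)

lemma rhs_higher_eq: "\<delta> i < \<delta> j \<Longrightarrow> rhs pres i j = nf (inv (a i) \<otimes> a j \<otimes> a i)"
  by (auto simp: pres_def)

lemma conj_layer:
  assumes "i \<in> {1..n}" "j \<in> {1..n}" "\<delta> i < \<delta> j"
  shows "inv (a i) \<otimes> a j \<otimes> a i \<in> N (Suc (\<delta> i))"
proof -
  interpret M: normal "N (\<delta> j)" G by (rule N_normal)
  have "inv (a i) \<otimes> a j \<otimes> a i \<in> N (\<delta> j)" using M.inv_op_closed1 a_mem assms by simp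
  then show ?thesis using N_antimono[of "Suc (\<delta> i)" "\<delta> j"] assms by auto
qed

sublocale layered_presentation pres p \<delta>
proof unfold_locales
  show "2 \<le> p" using prime_ge_2_nat[OF prime] .
  show "mono_on (pc_gens pres) \<delta>" using \<delta>_mono by (simp add: gens)
next
  fix i assume "i \<in> pc_gens pres"
  then have i: "i \<in> {1..n}" by (simp add: gens)
  then show "i + 1 \<in> pc_gens pres \<and> \<delta> (i + 1) = \<delta> i \<and> rhs pres i i = [i + 1] \<or> higher_word pres \<delta> i (rhs pres i i)"
    using higher_nf[OF i] by (cases rule: rhs_power_cases) (auto simp: gens)
next
  fix i j assume "i \<in> pc_gens pres" "j \<in> pc_gens pres" "i < j" "\<delta> i = \<delta> j"
  then show "\<exists>w. higher_word pres \<delta> i w \<and> rhs pres i j = j # w"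
    using cm_layer[of i j] higher_nf[of i] by (simp add: rhs_same_eq gens)
next
  fix i j assume "i \<in> pc_gens pres" "j \<in> pc_gens pres" "\<delta> i < \<delta> j"
  then show "higher_word pres \<delta> i (rhs pres i j)"
    using conj_layer[of i j] higher_nf[of i] by (simp add: rhs_higher_eq gens)
qed simp

lemma layer_cases:
  assumes "i \<in> {1..n}" "j \<in> {1..n}" "i < j"
  shows "\<delta> i = \<delta> j \<or> \<delta> i < \<delta> j"
  using mono_onD[OF \<delta>_mono assms(1,2)] assms(3) by auto

lemma ev_rhs_swap:
  assumes "i \<in> {1..n}" "j \<in> {1..n}" "i < j"
  shows "ev (rhs pres i j) = inv (a i) \<otimes> a j \<otimes> a i"
  using layer_cases[OF assms]
proof
  assume e: "\<delta> i = \<delta> j"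
  then show ?thesis
    using assms higher_nf(2)[OF assms(1) cm_layer[OF assms(1,2) e]] rhs_same_eq[of i j] by (simp add: cancel_inv)
next
  assume l: "\<delta> i < \<delta> j"
  then show ?thesis
    using higher_nf(2)[OF assms(1) conj_layer[OF assms(1,2) l]] rhs_higher_eq[of i j] by simp
qed

lemma ev_rel: "(l, r) \<in> pc_rels pres \<Longrightarrow> ev l = ev r"
proof (erule pc_rels_cases)
  fix i assume "i \<in> pc_gens pres" and l: "l = replicate (expo pres i) i" and r: "r = rhs pres i i"
  then have i: "i \<in> {1..n}" by (simp add: gens)
  then show "ev l = ev r"
    using higher_nf(2)[OF i] by (cases rule: rhs_power_cases) (simp_all add: l r ev_replicate)
next
  fix i j assume "i \<in> pc_gens pres" "j \<in> pc_gens pres" "i < j" "l = [j, i]" "r = i # rhs pres i j"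
  then show "ev l = ev r" by (simp add: ev_rhs_swap gens m_assoc cancel_inv)
qed

lemma rhs_letters:
  assumes "i \<in> {1..n}" "j \<in> {1..n}" "i \<le> j"
  shows "normal_word pres (rhs pres i j) \<and> set (rhs pres i j) \<subseteq> {i + 1..n}"
proof -
  have high: "normal_word pres w \<and> set w \<subseteq> {i + 1..n}" if "higher_word pres \<delta> i w" for w
  proof -
    have w: "set w \<subseteq> {1..n}" "\<forall>x\<in>set w. \<delta> i < \<delta> x" "normal_word pres w"
      using that by (auto simp: higher_word_def normal_word_pres nform_def)
    have "i < x" if "x \<in> set w" for x using w that assms(1) less_of_layer[of i x] by (auto simp: gens)
    then show ?thesis using w by fastforce
  qed
  consider "i = j" | "i < j" "\<delta> i = \<delta> j" | "i < j" "\<delta> i < \<delta> j" using layer_cases[of i j] assms by linarith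
  then show ?thesis
  proof cases
    case 1
    then show ?thesis using rhs_power[of i] high assms by (auto simp: gens)
  next
    case 2
    then obtain w where w: "higher_word pres \<delta> i w" "rhs pres i j = j # w" using rhs_same[of i j] assms by (auto simp: gens)
    have "normal_word pres ([j] @ w)"
      by (rule normal_append[of _ _ "\<delta> i"]) (use w 2 assms in \<open>auto simp: higher_word_def gens\<close>)
    then show ?thesis using w high[OF w(1)] 2 assms by auto
  next
    case 3
    then show ?thesis using rhs_higher[of i j] high assms by (auto simp: gens)
  qed
qed

lemma pc_presentation_pres: "pc_presentation pres"
  unfolding pc_presentation_def
proof (intro conjI ballI impI)
  show "0 < expo pres i" for i using prime_gt_0_nat[OF prime] by simp
  show "set (rhs pres i j) \<subseteq> {i + 1..ngens pres}"
    if "i \<in> pc_gens pres" "j \<in> pc_gens pres" "i \<le> j" for i j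
    using rhs_letters[of i j] that by (simp add: gens)
  fix lr assume lr: "lr \<in> pc_rels pres"
  obtain l r where "lr = (l, r)" by (cases lr)
  with lr have "(l, r) \<in> pc_rels pres" by simp
  then have "normal_word pres r"
  proof (cases rule: pc_rels_cases)
    case (power i)
    then show ?thesis using rhs_letters[of i i] by (simp add: gens)
  next
    case (swap i j)
    then have "nform (rhs pres i j)" "set (rhs pres i j) \<subseteq> {i + 1..n}" using rhs_letters[of i j] by (auto simp: gens normal_word_pres)
    moreover from this have "count_list (rhs pres i j) i = 0" by (auto simp: count_list_0_iff)
    ultimately show ?thesis using swap prime_gt_1_nat[OF prime]
      by (fastforce simp: normal_word_pres nform_def gens)
  qed
  then show "case lr of (l, r) \<Rightarrow> normal_word pres r" using \<open>lr = (l, r)\<close> by simp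
qed

lemma favourable_pres:
  assumes "0 < d" shows "favourable pres"
  unfolding favourable_def
proof (intro exI[of _ d] exI[of _ \<delta>] conjI ballI impI)
  show "0 < d" by fact
  show "mono_on (pc_gens pres) \<delta>" "\<delta> ` pc_gens pres = {1..d}" using \<delta>_mono \<delta>_image by (simp_all add: gens)
  show "rhs pres i i = [i + 1] \<or> higher_word pres \<delta> i (rhs pres i i)" if "i \<in> pc_gens pres" for i
    using rhs_power[OF that] by blast
  fix i j assume ij: "i \<in> pc_gens pres" "j \<in> pc_gens pres" "i < j"
  show "normal_word pres (rhs pres i j)" using rhs_letters[of i j] ij by (simp add: gens)
  show "\<exists>w. higher_word pres \<delta> i w \<and> (rhs pres i j = w \<or> rhs pres i j = j # w)"
    using layer_cases[of i j] rhs_same[of i j] rhs_higher[of i j] ij by (auto simp: gens)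
qed

lemma collects:
  assumes "0 < d" "normal_word pres u" "normal_word pres w"
  shows "\<exists>k z. (collect_left pres ^^ k) (u @ w) z \<and> normal_word pres z"
proof -
  have im: "\<delta> ` pc_gens pres = {1..d}" using \<delta>_image by (simp add: gens)
  have "\<exists>T. concat_cost 0 T"
  proof (cases "d = 1")
    case True
    then show ?thesis using one_layer_cost im by auto
  next
    case False
    then have "d = d - 2 + 2" using assms(1) by simp
    then show ?thesis using many_layers_cost(1)[of "d - 2"] im by auto
  qed
  then obtain T where "concat_cost 0 T" ..
  moreover have "\<forall>i\<in>pc_gens pres. 0 < \<delta> i" using \<delta>_range by (force simp: gens)
  ultimately show ?thesis
    using concat_cost_collects[of T u w "real T"] assms unfolding collects_left_within_def by blast
qed

text \<open>Collection terminates, and its steps respect the relations.\<close>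
lemma pos_word_normal:
  assumes "0 < d" "set w \<subseteq> {1..n}"
  shows "\<exists>z. normal_word pres z \<and> pres_eq (pc_gens pres) (pc_rels pres) (pos_word w) (pos_word z)"
  using assms(2)
proof (induction w)
  case Nil
  then show ?case by (auto intro!: exI[of _ "[]"] pres_eq.refl)
next
  case (Cons i w)
  then obtain z where z: "normal_word pres z" "pres_eq (pc_gens pres) (pc_rels pres) (pos_word w) (pos_word z)" by auto
  have "normal_word pres [i]" using Cons.prems by (simp add: gens)
  then obtain k y where y: "(collect_left pres ^^ k) ([i] @ z) y" "normal_word pres y"
    using collects[OF assms(1) _ z(1)] by blast
  have "pres_eq (pc_gens pres) (pc_rels pres) (pos_word (i # w)) (pos_word ([i] @ z))"
    using pres_eq_context[OF z(2), of "[(i, True)]" "[]"] by simp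
  then show ?case using collect_left_pow_pres_eq[OF y(1)] y(2) pres_eq.trans by blast
qed

primrec sev :: "(nat \<times> bool) list \<Rightarrow> 'a" where
  "sev [] = \<one>"
| "sev (x # w) = (if snd x then a (fst x) else inv (a (fst x))) \<otimes> sev w"

lemma sev_closed [simp]: "sev w \<in> carrier G" by (induction w) auto

lemma sev_append [simp]: "sev (u @ w) = sev u \<otimes> sev w" by (induction u) (auto simp: m_assoc)

lemma sev_pos_word [simp]: "sev (pos_word w) = ev w" by (induction w) auto

lemma sev_pres_eq: "pres_eq (pc_gens pres) (pc_rels pres) u w \<Longrightarrow> sev u = sev w"
proof (induction rule: pres_eq.induct)
  case (cancel x s b t)
  then show ?case by (cases b) (simp_all add: cancel_inv)
qed (simp_all add: ev_rel)

text \<open>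
  Let \<open>w\<close> be the normal form of the inverse of \<open>a i\<close>. The word \<open>i # w\<close> collects to a normal word that
  represents \<open>\<one>\<close>, and by uniqueness this word is empty. So \<open>w\<close> is inverse to \<open>i\<close> in the presented
  group as well.
\<close>
lemma inverse_letter:
  assumes "0 < d" "i \<in> {1..n}"
  shows "\<exists>w. set w \<subseteq> {1..n} \<and> pres_eq (pc_gens pres) (pc_rels pres) [(i, False)] (pos_word w)"
proof -
  let ?eq = "pres_eq (pc_gens pres) (pc_rels pres)"
  define w where "w = nf (inv (a i))"
  have w: "nform w" "ev w = inv (a i)" using nf[of 1 "inv (a i)"] N_first by (auto simp: w_def)
  then have sw: "set w \<subseteq> {1..n}" by (simp add: nform_def)
  obtain z where z: "normal_word pres z" "?eq (pos_word (i # w)) (pos_word z)"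
    using pos_word_normal[OF assms(1), of "i # w"] sw assms(2) by auto
  have "ev z = \<one>" using sev_pres_eq[OF z(2)] w by simp
  then have "z = []" using ev_eqD[of z "[]"] z(1) prime_gt_0_nat[OF prime] by (simp add: normal_word_pres nform_def)
  then have "?eq ([(i, False)] @ pos_word (i # w) @ []) ([(i, False)] @ [] @ [])"
    using pres_eq_context[OF z(2)] by (metis pos_word_simps(1))
  moreover have "?eq ([] @ [(i, False), (i, \<not> False)] @ pos_word w) ([] @ pos_word w)"
    by (rule pres_eq.cancel) (use assms in \<open>simp add: gens\<close>)
  ultimately have "?eq [(i, False)] (pos_word w)"
    by simp (meson pres_eq.sym pres_eq.trans)
  then show ?thesis using sw by blast
qed

lemma signed_word_normal:
  assumes "0 < d" "u \<in> lists ({1..n} \<times> UNIV)"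
  shows "\<exists>z. normal_word pres z \<and> pres_eq (pc_gens pres) (pc_rels pres) u (pos_word z)"
proof -
  let ?eq = "pres_eq (pc_gens pres) (pc_rels pres)"
  have "\<exists>w. set w \<subseteq> {1..n} \<and> ?eq u (pos_word w)" using assms(2)
  proof (induction u)
    case Nil
    then show ?case by (auto intro!: exI[of _ "[]"] pres_eq.refl)
  next
    case (Cons x u)
    then obtain w where w: "set w \<subseteq> {1..n}" "?eq u (pos_word w)" by auto
    obtain i b where x: "x = (i, b)" "i \<in> {1..n}" using Cons by (cases x) auto
    have "\<exists>v. set v \<subseteq> {1..n} \<and> ?eq [x] (pos_word v)"
    proof (cases b)
      case True
      then show ?thesis using x by (intro exI[of _ "[i]"]) (auto intro: pres_eq.refl)
    next
      case False
      then show ?thesis using inverse_letter[OF assms(1) x(2)] x by simp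
    qed
    then obtain v where v: "set v \<subseteq> {1..n}" "?eq [x] (pos_word v)" by blast
    then show ?case using pres_eq_append[OF v(2) w(2)] w(1) by (intro exI[of _ "v @ w"]) simp
  qed
  then obtain w where w: "set w \<subseteq> {1..n}" "?eq u (pos_word w)" by blast
  then show ?thesis using pos_word_normal[OF assms(1) w(1)] pres_eq.trans by blast
qed

text \<open>
  Evaluation in \<open>G\<close> is a homomorphism from the presented group. It is injective because every class
  contains a normal word, and distinct normal words have distinct values.
\<close>
lemma presentation_of_pres:
  assumes "0 < d"
  shows "presentation_of pres G"
proof -
  let ?S = "lists (pc_gens pres \<times> UNIV)" and ?r = "pres_rel (pc_gens pres) (pc_rels pres)"
  define \<phi> where "\<phi> X = sev (SOME u. u \<in> X)" for X
  have carr: "carrier (pc_group pres) = ?S // ?r"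
    by (simp add: pc_group_def presented_group_def)
  have equiv: "equiv ?S ?r" by (rule equiv_pres_rel)
  have \<phi>: "\<phi> (?r `` {u}) = sev u" if "u \<in> ?S" for u
  proof -
    define w where "w = (SOME w. w \<in> ?r `` {u})"
    have "w \<in> ?r `` {u}"
      unfolding w_def using equiv_class_self[OF equiv that] by (rule someI)
    then have "pres_eq (pc_gens pres) (pc_rels pres) u w" by (simp add: pres_rel_def)
    from sev_pres_eq[OF this] show ?thesis by (simp add: \<phi>_def w_def)
  qed
  have mult: "?r `` {u} \<otimes>\<^bsub>pc_group pres\<^esub> ?r `` {w} = ?r `` {u @ w}" if "u \<in> ?S" "w \<in> ?S" for u w
  proof -
    have "?r `` {u' @ w'} = ?r `` {u @ w}" if "u' \<in> ?r `` {u}" "w' \<in> ?r `` {w}" for u' w'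
    proof -
      have "(u @ w, u' @ w') \<in> ?r"
        using that pres_eq_append by (auto simp: pres_rel_def)
      then show ?thesis using equiv_class_eq[OF equiv] by metis
    qed
    then have "(\<Union>u'\<in>?r `` {u}. \<Union>w'\<in>?r `` {w}. ?r `` {u' @ w'}) = ?r `` {u @ w}"
      using equiv_class_self[OF equiv] that by blast
    then show ?thesis by (simp add: pc_group_def presented_group_def)
  qed
  have "\<phi> \<in> iso (pc_group pres) G"
  proof (rule isoI)
    show "\<phi> \<in> hom (pc_group pres) G"
    proof (rule homI)
      fix X assume "X \<in> carrier (pc_group pres)"
      then show "\<phi> X \<in> carrier G" by (simp add: \<phi>_def)
    next
      fix X Y assume "X \<in> carrier (pc_group pres)" "Y \<in> carrier (pc_group pres)"
      then obtain u w where uw: "u \<in> ?S" "w \<in> ?S" "X = ?r `` {u}" "Y = ?r `` {w}"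
        unfolding carr by (metis quotientE)
      then have "u @ w \<in> ?S" by simp
      then show "\<phi> (X \<otimes>\<^bsub>pc_group pres\<^esub> Y) = \<phi> X \<otimes> \<phi> Y"
        using uw \<phi> mult by simp
    qed
    show "bij_betw \<phi> (carrier (pc_group pres)) (carrier G)"
    proof (rule bij_betwI')
      fix X Y assume "X \<in> carrier (pc_group pres)" "Y \<in> carrier (pc_group pres)"
      then obtain u w where uw: "u \<in> ?S" "w \<in> ?S" "X = ?r `` {u}" "Y = ?r `` {w}"
        unfolding carr by (metis quotientE)
      show "(\<phi> X = \<phi> Y) = (X = Y)"
      proof
        assume "\<phi> X = \<phi> Y"
        then have e: "sev u = sev w" using \<phi> uw by simp
        obtain y z where y: "normal_word pres y" "pres_eq (pc_gens pres) (pc_rels pres) u (pos_word y)"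
          and z: "normal_word pres z" "pres_eq (pc_gens pres) (pc_rels pres) w (pos_word z)"
          using signed_word_normal[OF assms] uw(1,2) unfolding gens by metis
        have "ev y = ev z" using sev_pres_eq[OF y(2)] sev_pres_eq[OF z(2)] e by simp
        then have "y = z" using ev_eqD y z normal_word_pres by blast
        then have "(u, w) \<in> ?r"
          using uw(1,2) y(2) z(2) by (auto simp: pres_rel_def intro: pres_eq.sym pres_eq.trans)
        then show "X = Y" using uw equiv_class_eq[OF equiv] by metis
      qed simp
    next
      show "\<phi> X \<in> carrier G" for X by (simp add: \<phi>_def)
    next
      fix g assume "g \<in> carrier G"
      then have w: "nform (nf g)" "ev (nf g) = g" using nf[of 1 g] N_first by auto
      then have "pos_word (nf g) \<in> ?S" by (auto simp: gens nform_def pos_word_def)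
      then show "\<exists>X\<in>carrier (pc_group pres). g = \<phi> X"
        using \<phi>[of "pos_word (nf g)"] w unfolding carr by (metis quotientI sev_pos_word)
    qed
  qed
  then show ?thesis by (auto simp: presentation_of_def is_iso_def)
qed

lemma consistent_pres:
  assumes "0 < d"
  shows "consistent pres"
proof -
  obtain h where "h \<in> iso (pc_group pres) G" using presentation_of_pres[OF assms] by (auto simp: presentation_of_def is_iso_def)
  then have "order (pc_group pres) = p ^ n"
    using order bij_betw_same_card[of h] by (auto simp: iso_def order_def)
  then show ?thesis by (simp add: consistent_def gens)
qed

lemma commuting_rhs:
  assumes "i \<in> {1..n}" "j \<in> {1..n}" "\<delta> i < \<delta> j" "cm (a j) (a i) = \<one>"
  shows "rhs pres i j = [j]"
proof -
  have "inv (a i) \<otimes> a j \<otimes> a i = ev [j]" using assms(4) conj_eq_cm[of "a j" "a i"] by simp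
  moreover have "nform [j]" using assms(2) normal_word_pres[of "[j]"] by (simp add: gens)
  moreover have "ev [j] \<in> N 1" using N_first by simp
  ultimately show ?thesis
    using nf(1,2)[of 1 "ev [j]"] ev_eqD rhs_higher_eq[OF assms(3)] by simp
qed

end

section \<open>Choosing the sequence\<close>

context group
begin

lemma word_of_digit_span:
  fixes a :: "nat \<Rightarrow> 'a"
  assumes ac: "\<And>i. a i \<in> carrier G"
    and "g \<in> digit_span p (map a is) {\<one>}" "sorted is" "distinct is" "0 < p"
  shows "\<exists>w. sorted w \<and> set w \<subseteq> set is \<and> (\<forall>i. count_list w i < p) \<and> foldr (\<lambda>i x. a i \<otimes> x) w \<one> = g"
  using assms(2-)
proof (induction "is" arbitrary: g)
  case Nil
  then show ?case by (auto intro!: exI[of _ "[]"])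
next
  case (Cons i "is")
  then obtain m y where m: "m < p" "y \<in> digit_span p (map a is) {\<one>}" "g = a i [^] m \<otimes> y" by auto
  then obtain w where w: "sorted w" "set w \<subseteq> set is" "\<forall>i. count_list w i < p" "foldr (\<lambda>i x. a i \<otimes> x) w \<one> = y"
    using Cons.IH[of y] Cons.prems by auto
  have wc: "foldr (\<lambda>i x. a i \<otimes> x) w \<one> \<in> carrier G" using ac by (induction w) auto
  have cr: "count_list (replicate m i) j = (if i = j then m else 0)" for j by (induction m) auto
  have "i \<notin> set w" using w(2) Cons.prems(3) by auto
  then have "count_list w i = 0" by (simp add: count_list_0_iff)
  then have "\<forall>j. count_list (replicate m i @ w) j < p" using w(3) m(1) cr by auto
  moreover have "sorted (replicate m i @ w)" using w(1,2) Cons.prems(2) by (auto simp: sorted_append subset_iff)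
  moreover have "foldr (\<lambda>i x. a i \<otimes> x) (replicate k i @ w) \<one> = a i [^] k \<otimes> y" for k
  proof (induction k)
    case 0
    then show ?case using w(4) wc by auto
  next
    case (Suc k)
    then show ?case using ac w(4) wc nat_pow_Suc2[of "a i" k] by (simp add: m_assoc del: nat_pow_Suc)
  qed
  ultimately show ?case using m w(2) by (intro exI[of _ "replicate m i @ w"]) auto
qed

text \<open>
  The generators of the layers \<open>k, \<dots>, d\<close>, each paired with its layer. Towers are extended from the
  bottom of the series to the top.
\<close>
definition tower :: "nat \<Rightarrow> nat \<Rightarrow> (nat \<Rightarrow> 'a set) \<Rightarrow> nat \<Rightarrow> ('a \<times> nat) list \<Rightarrow> bool" where
  "tower p d N k zs \<longleftrightarrow> sorted (map snd zs) \<and> snd ` set zs = {k..d} \<and> (\<forall>z\<in>set zs. fst z \<in> N (snd z)) \<and>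
    (\<forall>i<length zs. fst (zs ! i) [^] p \<in> N (Suc (snd (zs ! i))) \<or>
      Suc i < length zs \<and> snd (zs ! Suc i) = snd (zs ! i) \<and> fst (zs ! Suc i) = fst (zs ! i) [^] p) \<and>
    (\<forall>j\<in>{k..Suc d}. N j \<subseteq> digit_span p (map fst (filter (\<lambda>z. j \<le> snd z) zs)) {\<one>}) \<and>
    card (N k) = p ^ length zs"

lemma tower_step:
  assumes fin: "finite (carrier G)" and p: "prime p" and ord: "order G = p ^ n"
    and N: "\<And>k. N k \<lhd> G" "N (Suc k) \<subseteq> N k" "N (Suc k) \<noteq> N k"
    and cm: "\<And>x y. x \<in> N k \<Longrightarrow> y \<in> N k \<Longrightarrow> cm x y \<in> N (Suc k)"
    and k: "k \<le> d" and zs: "tower p d N (Suc k) zs"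
  shows "\<exists>zs. tower p d N k zs"
proof -
  obtain as where as: "set as \<subseteq> N k" "chained p (N (Suc k)) as" "N k \<subseteq> digit_span p as (N (Suc k))"
      "card (N k) = p ^ length as * card (N (Suc k))"
    using abelian_section_generators[OF fin p ord normal_imp_subgroup[OF N(1)] N(1) N(2) cm] by blast
  have "as \<noteq> []" using as(3) N(2,3) by auto
  let ?zs = "map (\<lambda>a. (a, k)) as @ zs"
  have snds: "snd ` set zs = {Suc k..d}" "sorted (map snd zs)" using zs by (auto simp: tower_def)
  have snd_ge: "Suc k \<le> snd z" if "z \<in> set zs" for z
  proof -
    have "snd z \<in> {Suc k..d}" using that snds(1) by blast
    then show ?thesis by simp
  qed
  have "tower p d N k ?zs" unfolding tower_def
  proof (intro conjI ballI allI impI)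
    have "sorted (map snd (map (\<lambda>a. (a, k)) as))" by (induction as) auto
    moreover have "\<forall>y\<in>set zs. k \<le> snd y" using snd_ge by fastforce
    ultimately show "sorted (map snd ?zs)" using snds(2) by (auto simp: sorted_append)
    have "snd ` set ?zs = {k} \<union> snd ` set zs"
      using \<open>as \<noteq> []\<close> by (simp add: image_Un image_image image_constant_conv)
    then have "snd ` set ?zs = {k} \<union> {Suc k..d}" unfolding snds(1) .
    then show "snd ` set ?zs = {k..d}" using k by auto
    show "fst z \<in> N (snd z)" if "z \<in> set ?zs" for z
      using that as(1) zs by (auto simp: tower_def)
    show "card (N k) = p ^ length ?zs" using as(4) zs by (simp add: tower_def power_add)
    fix i assume i: "i < length ?zs"
    show "fst (?zs ! i) [^] p \<in> N (Suc (snd (?zs ! i))) \<or>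
      Suc i < length ?zs \<and> snd (?zs ! Suc i) = snd (?zs ! i) \<and> fst (?zs ! Suc i) = fst (?zs ! i) [^] p"
    proof (cases "i < length as")
      case True
      then show ?thesis using as(2) unfolding chained_def by (auto simp: nth_append)
    next
      case False
      then have "i - length as < length zs" "Suc i - length as = Suc (i - length as)" using i by auto
      moreover have "\<forall>i<length zs. fst (zs ! i) [^] p \<in> N (Suc (snd (zs ! i))) \<or>
          Suc i < length zs \<and> snd (zs ! Suc i) = snd (zs ! i) \<and> fst (zs ! Suc i) = fst (zs ! i) [^] p"
        using zs unfolding tower_def by blast
      ultimately show ?thesis using False by (auto simp: nth_append)
    qed
  next
    fix j assume j: "j \<in> {k..Suc d}"
    have sp: "\<forall>j\<in>{Suc k..Suc d}. N j \<subseteq> digit_span p (map fst (filter (\<lambda>z. j \<le> snd z) zs)) {\<one>}"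
      using zs unfolding tower_def by blast
    have all: "filter (\<lambda>z. i \<le> snd z) zs = zs" if "i \<le> Suc k" for i
      using snd_ge that by (fastforce simp: filter_id_conv)
    show "N j \<subseteq> digit_span p (map fst (filter (\<lambda>z. j \<le> snd z) ?zs)) {\<one>}"
    proof (cases "j = k")
      case True
      have "N (Suc k) \<subseteq> digit_span p (map fst zs) {\<one>}" using sp k all[of "Suc k"] by force
      then have "N k \<subseteq> digit_span p as (digit_span p (map fst zs) {\<one>})"
        using as(3) digit_span_mono by blast
      then show ?thesis using True all[of k] by (simp add: digit_span_append comp_def filter_map)
    next
      case False
      then have "j \<in> {Suc k..Suc d}" "filter (\<lambda>z. j \<le> snd z) (map (\<lambda>a. (a, k)) as) = []"
        using j by (auto simp: filter_empty_conv)
      then show ?thesis using sp by simp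
    qed
  qed
  then show ?thesis ..
qed

lemma tower_exists:
  assumes fin: "finite (carrier G)" and p: "prime p" and ord: "order G = p ^ n"
    and N: "\<And>k. N k \<lhd> G" "\<And>k. N (Suc k) \<subseteq> N k" "\<And>k. k \<in> {1..d} \<Longrightarrow> N (Suc k) \<noteq> N k"
    and top: "N (Suc d) = {\<one>}"
    and cm: "\<And>k x y. x \<in> N k \<Longrightarrow> y \<in> N k \<Longrightarrow> cm x y \<in> N (Suc k)"
  shows "\<exists>zs. tower p d N 1 zs"
proof -
  have "\<exists>zs. tower p d N k zs" if "1 \<le> k" "k \<le> Suc d" for k
    using that(2,1)
  proof (induction rule: inc_induct)
    case base
    show ?case using top by (intro exI[of _ "[]"]) (simp add: tower_def)
  next
    case (step k)
    then obtain zs where zs: "tower p d N (Suc k) zs" by auto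
    have "N (Suc k) \<noteq> N k" using N(3) step by simp
    then show ?case using tower_step[OF fin p ord, of N k d zs] N(1,2) cm step zs by auto
  qed
  then show ?thesis by simp
qed

lemma pc_sequence_exists:
  assumes fin: "finite (carrier G)" and p: "prime p" and ord: "order G = p ^ n"
    and N: "\<And>k. N k \<lhd> G" "\<And>k. N (Suc k) \<subseteq> N k" "\<And>k. k \<in> {1..d} \<Longrightarrow> N (Suc k) \<noteq> N k"
    and top: "N (Suc d) = {\<one>}" and bot: "N 1 = carrier G"
    and cm: "\<And>k x y. x \<in> N k \<Longrightarrow> y \<in> N k \<Longrightarrow> cm x y \<in> N (Suc k)"
  shows "\<exists>a \<delta>. pc_sequence G p n d a \<delta> N"
proof -
  obtain zs where zs: "tower p d N 1 zs" using tower_exists[OF fin p ord N top cm] by blast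
  define a where "a i = (if i \<in> {1..n} then fst (zs ! (i - 1)) else \<one>)" for i
  define \<delta> where "\<delta> i = snd (zs ! (i - 1))" for i
  have "p ^ length zs = p ^ n" using zs bot ord by (simp add: tower_def order_def)
  then have len: "length zs = n" using prime_gt_1_nat[OF p] by simp
  have nth: "zs ! (i - 1) \<in> set zs" if "i \<in> {1..n}" for i using that len by auto
  have zs_eq: "map (\<lambda>i. (a i, \<delta> i)) [1..<Suc n] = zs"
    by (rule nth_equalityI) (simp_all add: len a_def \<delta>_def del: upt_Suc)
  have mem: "a i \<in> N (\<delta> i)" if "i \<in> {1..n}" for i
    using zs nth[OF that] that by (simp add: tower_def a_def \<delta>_def)
  have ac: "a i \<in> carrier G" for i
  proof (cases "i \<in> {1..n}")
    case True
    then show ?thesis using mem[OF True] subgroup.subset[OF normal_imp_subgroup[OF N(1)]] by blast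
  qed (auto simp: a_def)
  have "pc_sequence G p n d a \<delta> N"
  proof (intro pc_sequence.intro pc_sequence_axioms.intro is_group)
    show "prime p" "order G = p ^ n" "N 1 = carrier G" by fact+
    show "a i \<in> carrier G" for i by (rule ac)
    show "N k \<lhd> G" for k by (rule N(1))
    show "i \<le> j \<Longrightarrow> N j \<subseteq> N i" for i j by (rule lift_Suc_antimono_le[of N, OF N(2)])
    show "cm x y \<in> N (Suc k)" if "x \<in> N k" "y \<in> N k" for x y k using cm that .
    show "mono_on {1..n} \<delta>"
    proof (rule mono_onI)
      fix i j assume "i \<in> {1..n}" "j \<in> {1..n}" "i \<le> j"
      then show "\<delta> i \<le> \<delta> j"
        using zs len sorted_nth_mono[of "map snd zs" "i - 1" "j - 1"] by (simp add: tower_def \<delta>_def)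
    qed
    have "\<delta> ` {1..n} = set (map snd (map (\<lambda>i. (a i, \<delta> i)) [1..<Suc n]))"
      by (simp add: atLeastLessThanSuc_atLeastAtMost image_image del: upt_Suc)
    also have "\<dots> = {1..d}" unfolding zs_eq using zs by (simp add: tower_def)
    finally show "\<delta> ` {1..n} = {1..d}" .
    show "a i \<in> N (\<delta> i)" if "i \<in> {1..n}" for i by (rule mem[OF that])
    show "a i [^] p \<in> N (Suc (\<delta> i)) \<or> Suc i \<in> {1..n} \<and> \<delta> (Suc i) = \<delta> i \<and> a (Suc i) = a i [^] p"
      if i: "i \<in> {1..n}" for i
    proof -
      have "i - 1 < length zs" "Suc (i - 1) = i" using i len by auto
      moreover have "\<forall>i<length zs. fst (zs ! i) [^] p \<in> N (Suc (snd (zs ! i))) \<or>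
          Suc i < length zs \<and> snd (zs ! Suc i) = snd (zs ! i) \<and> fst (zs ! Suc i) = fst (zs ! i) [^] p"
        using zs unfolding tower_def by blast
      ultimately have "fst (zs ! (i - 1)) [^] p \<in> N (Suc (snd (zs ! (i - 1)))) \<or>
          i < length zs \<and> snd (zs ! i) = snd (zs ! (i - 1)) \<and> fst (zs ! i) = fst (zs ! (i - 1)) [^] p"
        by metis
      then show ?thesis using i len by (auto simp: a_def \<delta>_def)
    qed
    fix k g assume k: "k \<in> {1..Suc d}" and g: "g \<in> N k"
    let ?is = "filter (\<lambda>i. k \<le> \<delta> i) [1..<Suc n]"
    have "map fst (filter (\<lambda>z. k \<le> snd z) zs) = map a ?is"
      unfolding zs_eq[symmetric] by (simp add: filter_map comp_def del: upt_Suc)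
    then have mem: "g \<in> digit_span p (map a ?is) {\<one>}" using zs k g unfolding tower_def by fastforce
    have "sorted ?is" "distinct ?is" by (simp_all add: sorted_wrt_filter del: upt_Suc)
    then have "\<exists>w. sorted w \<and> set w \<subseteq> set ?is \<and> (\<forall>i. count_list w i < p) \<and> foldr (\<lambda>i x. a i \<otimes> x) w \<one> = g"
      using word_of_digit_span[where a = a, OF ac mem] prime_gt_0_nat[OF p] by blast
    moreover have "set ?is = {i \<in> {1..n}. k \<le> \<delta> i}" by auto
    ultimately show "\<exists>w. sorted w \<and> set w \<subseteq> {i \<in> {1..n}. k \<le> \<delta> i} \<and> (\<forall>i. count_list w i < p) \<and>
        foldr (\<lambda>i x. a i \<otimes> x) w \<one> = g" by simp
  qed
  then show ?thesis by blast
qed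

end

lemma power_le_powr_log:
  assumes "0 < L" "m \<le> 3 * log 2 (real n) + 1"
  shows "real (L ^ m) \<le> real L powr (3 * log 2 (real n) + 1)"
proof -
  have "real (L ^ m) = real L powr real m" using assms(1) by (simp add: powr_realpow)
  also have "\<dots> \<le> real L powr (3 * log 2 (real n) + 1)" using assms by (intro powr_mono) auto
  finally show ?thesis .
qed

lemma log2_ge: "2 ^ e \<le> n \<Longrightarrow> real e \<le> log 2 (real n)"
proof -
  assume *: "2 ^ e \<le> n"
  then have "(2::real) ^ e \<le> real n" by (metis numeral_power_le_of_nat_cancel_iff)
  moreover have "0 < n" using * by (cases n) auto
  ultimately show ?thesis by (subst le_log_iff) (auto simp: powr_realpow)
qed

text \<open>This is \<open>3 * log 2 3 \<ge> 4\<close>, which holds because of \<open>2 ^ 4 \<le> 3 ^ 3\<close>.\<close>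
lemma log2_three_mult_ge:
  assumes "3 * 2 ^ e \<le> n"
  shows "3 * real e + 4 \<le> 3 * log 2 (real n)"
proof -
  have "(3 * 2 ^ e) ^ 3 \<le> n ^ 3" using assms by (rule power_mono) simp
  moreover have "(2::nat) ^ (3 * e + 4) \<le> (3 * 2 ^ e) ^ 3"
    by (simp add: power_mult_distrib power_add power_mult[symmetric] mult.commute)
  ultimately have "2 ^ (3 * e + 4) \<le> n ^ 3" by linarith
  from log2_ge[OF this] have "real (3 * e + 4) \<le> log 2 (real n ^ 3)" by simp
  moreover have "0 < n" using assms by (cases n) auto
  ultimately show ?thesis by (simp add: log_nat_power)
qed

lemma (in pc_sequence) collects_within:
  assumes "concat_cost 0 T" "normal_word pres u" "normal_word pres w" "real T \<le> B"
  shows "collects_left_within pres (u @ w) B"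
  using concat_cost_collects[OF assms(1) _ assms(2-4)] \<delta>_range by (force simp: gens)

theorem corollary5:
  fixes G :: "('g, 'b) monoid_scheme" and p :: nat
  assumes "prime p"
    and "group G"
    and "finite (carrier G)"
    and "\<exists>k. order G = p ^ k"
    and "carrier G \<noteq> {\<one>\<^bsub>G\<^esub>}"
  shows "\<exists>P. pc_presentation P \<and> (\<forall>i\<in>pc_gens P. expo P i > 1) \<and> consistent P \<and>
           favourable P \<and> presentation_of P G \<and>
           (\<forall>u w. normal_word P u \<and> normal_word P w \<longrightarrow>
              collects_left_within P (u @ w)
                (((real p - 1) * log (real p) (real (order G)))
                   powr (3 * log 2 (log (real p) (real (order G))) + 1)))"
proof -
  interpret group G by fact
  obtain n where ord: "order G = p ^ n" using assms(4) by blast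
  have p1: "1 < p" using prime_gt_1_nat[OF assms(1)] .
  have n: "0 < n"
  proof (rule ccontr)
    assume "\<not> 0 < n"
    then have "card (carrier G) = 1" using ord by (simp add: order_def)
    then show False using assms(5) one_closed by (metis card_1_singletonE singletonD)
  qed
  have trivial: "lcs j = {\<one>\<^bsub>G\<^esub>}" if "n \<le> j" for j
    using lcs_antimono[OF that] lcs_p_group[OF assms(3,1) ord] subgroup.one_closed[OF normal_imp_subgroup[OF lcs_normal, of j]]
    by auto
  define d where "d = (LEAST d. lcs (2 ^ d - 1) = {\<one>\<^bsub>G\<^esub>})"
  have "n \<le> 2 ^ n - 1" using less_exp[of n] by linarith
  then have d: "lcs (2 ^ d - 1) = {\<one>\<^bsub>G\<^esub>}" unfolding d_def by (rule LeastI[of _ n, OF trivial])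
  have less: "lcs (2 ^ k - 1) \<noteq> {\<one>\<^bsub>G\<^esub>}" if "k < d" for k using not_less_Least that unfolding d_def by blast
  have d0: "0 < d" using d assms(5) by (cases d) auto
  (* N k is the lower central term numbered 2 ^ (k - 1) when the numbering starts at 1 *)
  define N where "N k = lcs (2 ^ (k - 1) - 1)" for k
  have N_Suc: "N (Suc k) = lcs (2 ^ k - 1)" for k by (simp add: N_def)
  have N_cm: "cm x y \<in> N (Suc k)" if "x \<in> N k" "y \<in> N k" for x y k
  proof (cases k)
    case 0
    then show ?thesis using that by (simp add: N_def)
  next
    case (Suc j)
    obtain t where "2 ^ j = Suc t" by (metis Suc_pred' zero_less_power pos2)
    then have "Suc (2 ^ j - 1 + (2 ^ j - 1)) = 2 ^ k - (1::nat)" using Suc by simp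
    then show ?thesis using cm_lcs[of x "2 ^ j - 1" y "2 ^ j - 1"] that Suc by (simp add: N_Suc)
  qed
  have N_dec: "N (Suc k) \<subseteq> N k" for k
    unfolding N_def by (intro lcs_antimono diff_le_mono power_increasing) auto
  have N_strict: "N (Suc k) \<noteq> N k" if k: "k \<in> {1..d}" for k
  proof
    assume eq: "N (Suc k) = N k"
    obtain j where j: "k = Suc j" "j < d" using k by (cases k) auto
    have "Suc (2 ^ j - 1) \<le> 2 ^ k - (1::nat)" using j one_le_power[of "2::nat" j] by simp
    then have "lcs (2 ^ k - 1) \<subseteq> lcs (Suc (2 ^ j - 1))" by (rule lcs_antimono)
    then have "lcs (Suc (2 ^ j - 1)) = lcs (2 ^ j - 1)"
      using eq lcs_Suc_subset[of "2 ^ j - 1"] j by (simp add: N_Suc)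
    then show False using lcs_strict[OF trivial[OF order_refl] less[OF j(2)]] by simp
  qed
  obtain a \<delta> where "pc_sequence G p n d a \<delta> N"
    using pc_sequence_exists[OF assms(3,1) ord, of N d] lcs_normal N_dec N_strict d N_cm by (force simp: N_def)
  then interpret s: pc_sequence G p n d a \<delta> N .
  have log: "log (real p) (real (order G)) = real n" using ord p1 by (simp add: log_nat_power)
  let ?L = "(p - 1) * n"
  have L: "(real p - 1) * real n = real ?L" using p1 by (simp add: of_nat_diff)
  have L0: "0 < ?L" using p1 n by simp
  have im: "\<delta> ` pc_gens s.pres = {1..d}" using s.\<delta>_image by (simp add: s.gens)
  have big: "2 ^ (d - 1) \<le> n"
  proof (rule ccontr)
    assume "\<not> 2 ^ (d - 1) \<le> n"
    then have "lcs (2 ^ (d - 1) - 1) = {\<one>\<^bsub>G\<^esub>}" by (intro trivial) simp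
    then show False using less[of "d - 1"] d0 by simp
  qed
  have "\<exists>T. s.concat_cost 0 T \<and> real T \<le> real ?L powr (3 * log 2 (real n) + 1)"
  proof (cases "d = 1")
    case d1: True
    show ?thesis
    proof (cases "n = 1")
      case True
      then have "s.concat_cost 0 (p - 1)" using s.one_generator_cost im d1 s.ngens_pres by metis
      moreover have "real (p - 1) \<le> real ?L powr (3 * log 2 (real n) + 1)" using True p1 by simp
      ultimately show ?thesis by blast
    next
      case False
      obtain T where T: "s.concat_cost 0 T" "T < 2 * ?L\<^sup>2"
        using s.one_layer_cost im d1 by auto
      have n2: "2 \<le> n" using False n by simp
      have "n \<le> ?L" using p1 by (cases "p - 1") auto
      with n2 have "2 \<le> ?L" by (rule order_trans)
      then have "2 * ?L\<^sup>2 \<le> ?L * ?L\<^sup>2" by (rule mult_right_mono) simp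
      then have "T \<le> ?L * ?L\<^sup>2" using T(2) by linarith
      also have "\<dots> = ?L ^ 3" by (simp only: power3_eq_cube power2_eq_square mult.assoc)
      finally have "real T \<le> real (?L ^ 3)" by (rule of_nat_mono)
      also have "\<dots> \<le> real ?L powr (3 * log 2 (real n) + 1)"
      proof (rule power_le_powr_log[OF L0])
        have "real 1 \<le> log 2 (real n)" by (rule log2_ge) (use n2 in simp)
        then show "real 3 \<le> 3 * log 2 (real n) + 1" by linarith
      qed
      finally show ?thesis using T(1) by blast
    qed
  next
    case False
    define e where "e = d - 2"
    have e: "d = e + 2" using False d0 by (simp add: e_def)
    obtain T m where T: "s.concat_cost 0 T" "T < ?L ^ m" "m \<le> 3 * log 2 (real n) + 1"
    proof (cases "3 * 2 ^ e \<le> n")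
      case True
      then show ?thesis using s.many_layers_cost(1)[of e] im e that[of _ "3 * e + 5"] log2_three_mult_ge[OF True] by auto
    next
      case False
      have "rhs s.pres i j = [j]"
        if ij: "i \<in> pc_gens s.pres" "j \<in> pc_gens s.pres" "\<delta> i = e + 1" "e + 1 < \<delta> j" for i j
      proof -
        have \<delta>: "\<delta> j = Suc (e + 1)" using ij s.\<delta>_range[of j] e by (auto simp: s.gens)
        (* in the usual numbering these weights add up to 3 * 2 ^ e > n, so the commutator is trivial *)
        have "a j \<in> lcs (2 ^ (e + 1) - 1)" "a i \<in> lcs (2 ^ e - 1)"
          using s.a_mem[of i] s.a_mem[of j] ij \<delta> by (simp_all add: s.gens N_def)
        then have "cm (a j) (a i) \<in> lcs (Suc (2 ^ (e + 1) - 1 + (2 ^ e - 1)))" by (rule cm_lcs)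
        moreover have "n \<le> Suc (2 ^ (e + 1) - 1 + (2 ^ e - 1))"
          using False one_le_power[of "2::nat" e] by simp
        ultimately have "cm (a j) (a i) = \<one>\<^bsub>G\<^esub>" using trivial by blast
        then show ?thesis using s.commuting_rhs[of i j] ij by (simp add: s.gens)
      qed
      then obtain T where "s.concat_cost 0 T" "T < ?L ^ (3 * e + 4)"
        using s.many_layers_cost(2)[of e] im e by auto
      moreover have "real (3 * e + 4) \<le> 3 * log 2 (real n) + 1"
        using log2_ge[of "e + 1" n] big e by simp
      ultimately show ?thesis using that by blast
    qed
    have "real T \<le> real (?L ^ m)" using T(2) by (intro of_nat_mono) simp
    also have "\<dots> \<le> real ?L powr (3 * log 2 (real n) + 1)" by (rule power_le_powr_log[OF L0 T(3)])
    finally show ?thesis using T(1) by blast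
  qed
  then obtain T where T: "s.concat_cost 0 T" "real T \<le> real ?L powr (3 * log 2 (real n) + 1)" by blast
  show ?thesis
  proof (intro exI[of _ s.pres] conjI allI impI ballI)
    show "pc_presentation s.pres" by (rule s.pc_presentation_pres)
    show "1 < expo s.pres i" for i using p1 by simp
    show "consistent s.pres" by (rule s.consistent_pres[OF d0])
    show "favourable s.pres" by (rule s.favourable_pres[OF d0])
    show "presentation_of s.pres G" by (rule s.presentation_of_pres[OF d0])
    fix u w assume "normal_word s.pres u \<and> normal_word s.pres w"
    then show "collects_left_within s.pres (u @ w)
        (((real p - 1) * log (real p) (real (order G)))
          powr (3 * log 2 (log (real p) (real (order G))) + 1))"
      unfolding log L using s.collects_within[OF T(1) _ _ T(2)] by blast
  qed
qed

end
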